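(* Let $m$ and $n$ be positive integers that are not both odd. Then there exists a biembedding of $K_{2mn+1}$ into an orientable surface $\Sigma$ whose face lengths are multiples of $m$ or multiples of $n$.
   Context: $K_v$ is the complete graph on $v$ vertices. An embedding of a graph $\Gamma$ in a surface $\Sigma$ is a continuous injective map $\psi:\Gamma\to\Sigma$, where $\Gamma$ is viewed with the usual topology as a 1-dimensional simplicial complex; its faces are the connected components of $\Sigma\setminus\psi(\Gamma)$. A circuit is a closed trail (edges are not repeated, vertices may be), and a circuit decomposition of $\Gamma$ is a set of circuits whose edge-sets partition $E(\Gamma)$. A biembedding of $\Gamma$ is a face 2-colorable embedding of $\Gamma$ (faces colored with two colors so that each edge lies on the boundary of one face of each color) for which there are two circuit decompositions $\mathcal{D},\mathcal{D}'$ of $\Gamma$ such that the boundaries of the faces in one color class are the circuits of $\mathcal{D}$ and those in the other color class are the circuits of $\mathcal{D}'$. The length of a face is the number of edges of its boundary circuit; the conclusion is that each face length is a multiple of $m$ or a multiple of $n$. *)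

theory Defs
  imports "HOL-Complex_Analysis.Complex_Analysis"
begin

section \<open>Closed surfaces and orientability\<close>

definition chart :: "'a topology \<Rightarrow> 'a set \<Rightarrow> ('a \<Rightarrow> complex) \<Rightarrow> bool" where
  "chart S U \<phi> \<longleftrightarrow>
     openin S U \<and> open (\<phi> ` U) \<and>
     homeomorphic_map (subtopology S U) (top_of_set (\<phi> ` U)) \<phi>"

text \<open>As usual in topological graph theory, a surface is a compact connected 2-manifold without
  boundary. Second countability is not listed because it follows from compactness.\<close>

definition surface :: "'a topology \<Rightarrow> bool" where
  "surface S \<longleftrightarrow>
     compact_space S \<and> connected_space S \<and> Hausdorff_space S \<and>
     (\<forall>x \<in> topspace S. \<exists>U \<phi>. x \<in> U \<and> chart S U \<phi>)"

text \<open>For a homeomorphism between open subsets of the plane, the winding number below is always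
  \<open>1\<close> or \<open>-1\<close> (the local degree at \<open>z\<close>).\<close>

definition orientation_preserving_on :: "complex set \<Rightarrow> (complex \<Rightarrow> complex) \<Rightarrow> bool" where
  "orientation_preserving_on D f \<longleftrightarrow>
     (\<forall>z r. 0 < r \<and> cball z r \<subseteq> D \<longrightarrow> winding_number (f \<circ> circlepath z r) (f z) = 1)"

definition orientable :: "'a topology \<Rightarrow> bool" where
  "orientable S \<longleftrightarrow>
     (\<exists>\<A>. (\<forall>(U, \<phi>) \<in> \<A>. chart S U \<phi>) \<and> (\<Union>(U, \<phi>) \<in> \<A>. U) = topspace S \<and>
        (\<forall>(U, \<phi>) \<in> \<A>. \<forall>(V, \<psi>) \<in> \<A>.
           orientation_preserving_on (\<phi> ` (U \<inter> V)) (\<psi> \<circ> inv_into U \<phi>)))"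

section \<open>Simple graphs, circuits and circuit decompositions\<close>

type_synonym 'v graph = "'v set \<times> 'v set set"

definition complete_graph :: "nat \<Rightarrow> nat graph" where
  "complete_graph v = ({..<v}, {e. e \<subseteq> {..<v} \<and> card e = 2})"

text \<open>A closed walk is given by the list of its successive vertices, without repeating the first
  one at the end; its \<open>k\<close>-th edge joins entry \<open>k\<close> to the cyclically following entry. Hence the
  length of the list is the number of edges.\<close>

definition next_vertex :: "'v list \<Rightarrow> nat \<Rightarrow> 'v" where
  "next_vertex c k = c ! (Suc k mod length c)"

definition walk_edge :: "'v list \<Rightarrow> nat \<Rightarrow> 'v set" where
  "walk_edge c k = {c ! k, next_vertex c k}"

definition walk_edges :: "'v list \<Rightarrow> 'v set set" where
  "walk_edges c = walk_edge c ` {..<length c}"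

definition circuit :: "'v graph \<Rightarrow> 'v list \<Rightarrow> bool" where
  "circuit \<Gamma> c \<longleftrightarrow>
     c \<noteq> [] \<and> walk_edges c \<subseteq> snd \<Gamma> \<and> inj_on (walk_edge c) {..<length c}"

text \<open>Lists that differ by rotation or reversal describe the same circuit; injectivity of
  \<^const>\<open>walk_edges\<close> makes \<open>\<D>\<close> contain just one of them.\<close>

definition circuit_decomposition :: "'v graph \<Rightarrow> 'v list set \<Rightarrow> bool" where
  "circuit_decomposition \<Gamma> \<D> \<longleftrightarrow>
     (\<forall>c \<in> \<D>. circuit \<Gamma> c) \<and> inj_on walk_edges \<D> \<and> partition_on (snd \<Gamma>) (walk_edges ` \<D>)"

section \<open>Embeddings and biembeddings\<close>

text \<open>The 1-dimensional simplicial complex of a (finite) graph, in barycentric coordinates.\<close>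

definition graph_space :: "'v graph \<Rightarrow> ('v \<Rightarrow> real) topology" where
  "graph_space \<Gamma> = subtopology (powertop_real UNIV)
     {x. (\<forall>i. 0 \<le> x i) \<and>
         (\<exists>s \<in> (\<lambda>u. {u}) ` fst \<Gamma> \<union> snd \<Gamma>. (\<forall>i. i \<notin> s \<longrightarrow> x i = 0) \<and> sum x s = 1)}"

definition edge_segment :: "'v graph \<Rightarrow> 'v set \<Rightarrow> ('v \<Rightarrow> real) set" where
  "edge_segment \<Gamma> e = {x \<in> topspace (graph_space \<Gamma>). \<forall>i. i \<notin> e \<longrightarrow> x i = 0}"

text \<open>The point of the edge \<open>{u, w}\<close> (with \<open>u \<noteq> w\<close>) dividing it in the ratio \<open>t : 1 - t\<close>,
  starting from \<open>u\<close>.\<close>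

definition edge_point :: "'v \<Rightarrow> 'v \<Rightarrow> real \<Rightarrow> 'v \<Rightarrow> real" where
  "edge_point u w t = (\<lambda>i. if i = u then 1 - t else if i = w then t else 0)"

definition graph_embedding :: "'v graph \<Rightarrow> 'a topology \<Rightarrow> (('v \<Rightarrow> real) \<Rightarrow> 'a) \<Rightarrow> bool" where
  "graph_embedding \<Gamma> S \<psi> \<longleftrightarrow>
     continuous_map (graph_space \<Gamma>) S \<psi> \<and> inj_on \<psi> (topspace (graph_space \<Gamma>))"

definition faces :: "'v graph \<Rightarrow> 'a topology \<Rightarrow> (('v \<Rightarrow> real) \<Rightarrow> 'a) \<Rightarrow> 'a set set" where
  "faces \<Gamma> S \<psi> =
     connected_components_of (subtopology S (topspace S - \<psi> ` topspace (graph_space \<Gamma>)))"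

text \<open>The boundary of a face \<open>F\<close> is the circuit \<open>c\<close> if \<open>F\<close> is an open disc attached along \<open>c\<close>: the
  closed unit disc is mapped onto the closure of \<open>F\<close>, its interior homeomorphically onto \<open>F\<close>,
  while its boundary circle traverses the edges of \<open>c\<close> in their cyclic order. Merely comparing
  the frontier of \<open>F\<close> with the edges of \<open>c\<close> would not see the order of the edges (which is not
  determined by the set of edges, as \<open>c\<close> may visit a vertex repeatedly), nor exclude faces that
  are not discs. Taking all edges to be traversed at constant speed is no restriction, since a
  reparametrisation of the circle extends radially to the disc.\<close>

definition face_boundary ::
  "'v graph \<Rightarrow> 'a topology \<Rightarrow> (('v \<Rightarrow> real) \<Rightarrow> 'a) \<Rightarrow> 'a set \<Rightarrow> 'v list \<Rightarrow> bool" where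
  "face_boundary \<Gamma> S \<psi> F c \<longleftrightarrow>
     circuit \<Gamma> c \<and>
     (\<exists>h :: complex \<Rightarrow> 'a.
        continuous_map (top_of_set (cball 0 1)) S h \<and>
        homeomorphic_map (top_of_set (ball 0 1)) (subtopology S F) h \<and>
        (\<forall>k < length c. \<forall>t \<in> {0..1}.
           h (cis (2 * pi * (real k + t) / real (length c))) =
           \<psi> (edge_point (c ! k) (next_vertex c k) t)))"

text \<open>The predicate \<open>black\<close> is the face 2-colouring.\<close>

definition biembedding :: "'v graph \<Rightarrow> 'a topology \<Rightarrow> (('v \<Rightarrow> real) \<Rightarrow> 'a) \<Rightarrow> bool" where
  "biembedding \<Gamma> S \<psi> \<longleftrightarrow>
     graph_embedding \<Gamma> S \<psi> \<and>
     (\<exists>black :: 'a set \<Rightarrow> bool.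
        let B = {F \<in> faces \<Gamma> S \<psi>. black F};
            W = {F \<in> faces \<Gamma> S \<psi>. \<not> black F}
        in
          (\<forall>e \<in> snd \<Gamma>.
             (\<exists>!F. F \<in> B \<and> \<psi> ` edge_segment \<Gamma> e \<subseteq> S frontier_of F) \<and>
             (\<exists>!F. F \<in> W \<and> \<psi> ` edge_segment \<Gamma> e \<subseteq> S frontier_of F)) \<and>
          (\<exists>\<D> \<D>'.
             circuit_decomposition \<Gamma> \<D> \<and> circuit_decomposition \<Gamma> \<D>' \<and>
             (\<exists>b. bij_betw b B \<D> \<and> (\<forall>F \<in> B. face_boundary \<Gamma> S \<psi> F (b F))) \<and>
             (\<exists>b'. bij_betw b' W \<D>' \<and> (\<forall>F \<in> W. face_boundary \<Gamma> S \<psi> F (b' F)))))"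

definition has_face_length ::
  "'v graph \<Rightarrow> 'a topology \<Rightarrow> (('v \<Rightarrow> real) \<Rightarrow> 'a) \<Rightarrow> 'a set \<Rightarrow> nat \<Rightarrow> bool" where
  "has_face_length \<Gamma> S \<psi> F l \<longleftrightarrow> (\<exists>c. face_boundary \<Gamma> S \<psi> F c \<and> l = length c)"

text \<open>HOL cannot quantify existentially over types, so a carrier type for the points of a surface
  has to be fixed. Every surface has the cardinality of the continuum (and in fact embeds in
  Euclidean 4-space), so no surface is lost, up to homeomorphism, by taking its points in
  \<^typ>\<open>nat \<Rightarrow> real\<close>. The topology is an arbitrary one on a subset of this type.\<close>

type_synonym surface_space = "(nat \<Rightarrow> real) topology"

end

theory Submission
  imports Defs "HOL-Combinatorics.Cycles"
begin

text \<open>Put \<open>M = m n\<close> and orient \<open>K\<^bsub>2M+1\<^esub>\<close> as the rotational tournament with arcs \<open>x \<rightarrow> x + i + 1\<close>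
  modulo \<open>2M + 1\<close>, where \<open>i\<close> is a residue modulo \<open>M\<close>. A black face continues an arc with parameter
  \<open>i\<close> by the arc with parameter \<open>i + n\<close>, a white face by the arc with parameter \<open>i + n + 1\<close>. A black
  face of length \<open>l\<close> has \<open>M\<close> dividing \<open>l n\<close>, so \<open>m\<close> divides \<open>l\<close>; a white one has \<open>M\<close> dividing
  \<open>l (n + 1)\<close>, so \<open>n\<close> divides \<open>l\<close>. Around every vertex the two rules alternate to a
  single cycle on the outgoing arcs, because they differ by \<open>1\<close>.

  Gluing a closed disc along each of these circuits gives the surface. The quotient maps every
  black disc to the unit disc and every white one to its exterior in the Riemann sphere, ramified
  only over \<open>0\<close>, \<open>1\<close> and \<open>\<infinity>\<close>; pulling back the coordinate of the sphere makes all transition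
  maps holomorphic, hence orientation preserving.\<close>

section \<open>Charts with holomorphic transition maps\<close>

text \<open>Both faces at an arc run along it in its own direction. So each colour is a single
  permutation of the arcs, whose cycles are the boundary circuits, and a white disc has to be turned
  over before its orientation agrees with that of the black ones. Going around a vertex leads from
  an outgoing arc back through its black face to an incoming arc and on by the white rule to another
  outgoing arc, which changes the parameter by \<open>(n + 1) - n = 1\<close>. If the two shifts
  differed by a number not prime to \<open>M\<close>, the discs at the vertex would form several
  cycles and the glued space would be pinched there. The pair \<open>n\<close>, \<open>n + 1\<close>
  avoids this, and its second member is prime to \<open>n\<close>. The delicate points are the
  vertices, where \<open>2 M\<close> half-discs have to fit around one point. The covering of the
  sphere has ramification index \<open>M\<close> there, so the local coordinate is an
  \<open>M\<close>-th root. Holomorphy is compared only away from ramified points, each of which is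
  kept in one chart.\<close>

lemma winding_number_injective_holomorphic:
  assumes holf: "f holomorphic_on D" and "open D" and injf: "inj_on f D"
    and "0 < r" and sub: "cball z r \<subseteq> D"
  shows "winding_number (f \<circ> circlepath z r) (f z) = 1"
proof -
  \<comment> \<open>The argument principle asks for a connected open domain, which \<open>D\<close>
    need not be; a ball slightly larger than the closed disc serves.\<close>
  obtain R where R: "R > r" "ball z R \<subseteq> D"
  proof -
    have "compact (cball z r)" "open D" by (auto simp: assms)
    then obtain e where e: "e > 0" "(\<Union>x\<in>cball z r. ball x e) \<subseteq> D"
      using compact_subset_open_imp_ball_epsilon_subset[OF _ _ sub] by metis
    have "ball z (r + e) \<subseteq> (\<Union>x\<in>cball z r. ball x e)"
    proof
      fix w assume w: "w \<in> ball z (r + e)"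
      have "dist z w < r + e" using w by simp
      show "w \<in> (\<Union>x\<in>cball z r. ball x e)"
      proof (cases "dist z w \<le> r")
        case True then show ?thesis using e(1) by (intro UN_I[of w]) auto
      next
        case False
        \<comment> \<open>The point where the segment from \<open>z\<close> to \<open>w\<close>
          leaves the closed disc.\<close>
        define x where "x = z + of_real (r / dist z w) * (w - z)"
        have d: "dist z w > 0" using False \<open>0 < r\<close> by linarith
        have "dist z x = r" using d \<open>0<r\<close> by (simp add: x_def dist_norm norm_mult norm_divide norm_minus_commute)
        moreover have "w - x = of_real (1 - r / dist z w) * (w - z)"
          by (simp add: x_def algebra_simps)
        then have "norm (w - x) = \<bar>1 - r / dist z w\<bar> * dist z w"
          by (metis dist_commute dist_norm norm_mult norm_of_real)
        then have "norm (w - x) = dist z w - r"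
          using d False by (simp add: abs_if left_diff_distrib)
        then have "dist x w < e" using \<open>dist z w < r + e\<close> by (simp add: dist_norm norm_minus_commute)
        ultimately show ?thesis by (intro UN_I[of x]) auto
      qed
    qed
    then show ?thesis using that[of "r + e"] e by auto
  qed
  define B where "B = ball z R"
  have B: "open B" "connected B" "z \<in> B" "f holomorphic_on B" "inj_on f B" "cball z r \<subseteq> B"
    using R \<open>0 < r\<close> holf injf
    by (auto simp: B_def intro: holomorphic_on_subset inj_on_subset)
  \<comment> \<open>By injectivity \<open>F\<close> vanishes in \<open>B\<close> only at
    \<open>z\<close>, and this zero is simple because an injective holomorphic function has nonzero
    derivative. The argument principle then counts it once.\<close>
  define F where "F = (\<lambda>w. f w - f z)"
  have FB: "F holomorphic_on B" unfolding F_def using B by (intro holomorphic_intros) auto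
  have zeros: "{w \<in> B. F w = 0 \<or> w \<in> {}} = {z}"
    using B(3,5) by (auto simp: F_def dest: inj_onD)
  have derF: "deriv F z = deriv f z"
    unfolding F_def using B(1,3,4) holomorphic_on_imp_differentiable_at by (subst deriv_diff) auto
  have "deriv f z \<noteq> 0"
    using holomorphic_injective_imp_regular[OF B(4,1,5,3)] .
  then have zord: "zorder F z = 1"
    using derF by (intro zorder_zero_eqI[OF FB B(1,3)]) (auto simp: F_def)
  have val: "valid_path (circlepath z r)" by simp
  have pim: "path_image (circlepath z r) \<subseteq> B - {w \<in> B. F w = 0 \<or> w \<in> {}}"
    unfolding zeros using B(6) \<open>0 < r\<close> by auto
  have "contour_integral (circlepath z r) (\<lambda>x. deriv F x * 1 / F x) =
      2 * pi * \<i> * (\<Sum>p\<in>{w \<in> B. F w = 0 \<or> w \<in> {}}. winding_number (circlepath z r) p * 1 * zorder F p)"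
  proof (rule argument_principle[OF B(1,2)])
    show "\<forall>w. w \<notin> B \<longrightarrow> winding_number (circlepath z r) w = 0"
      using B(6) \<open>0 < r\<close> by (intro allI impI winding_number_zero_outside[of _ "cball z r"]) auto
    show "finite {w \<in> B. F w = 0 \<or> w \<in> {}}" unfolding zeros by simp
    show "path_image (circlepath z r) \<subseteq> B - {w \<in> B. F w = 0 \<or> w \<in> {}}" by (rule pim)
  qed (use FB in auto)
  then have 1: "contour_integral (circlepath z r) (\<lambda>x. deriv F x / F x) = 2 * pi * \<i>"
    unfolding zeros using \<open>0 < r\<close> by (simp add: zord winding_number_circlepath_centre)
  have an: "f analytic_on B" using B by (simp add: analytic_on_open)
  have pB: "path_image (circlepath z r) \<subseteq> B" using pim by auto
  \<comment> \<open>The substitution \<open>w = f x\<close> turns the winding integral along the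
    image curve into the integral of the logarithmic derivative along the circle.\<close>
  have "contour_integral (f \<circ> circlepath z r) (\<lambda>w. 1 / (w - f z))
      = contour_integral (circlepath z r) (\<lambda>x. deriv f x * (1 / (f x - f z)))"
    by (rule contour_integral_comp_analyticW[OF an val pB])
  also have "\<dots> = contour_integral (circlepath z r) (\<lambda>x. deriv F x / F x)"
  proof (rule contour_integral_cong)
    fix x assume "x \<in> path_image (circlepath z r)"
    then have "f field_differentiable at x" using pB B holomorphic_on_imp_differentiable_at by blast
    then have "deriv F x = deriv f x" unfolding F_def by (subst deriv_diff) auto
    then show "deriv f x * (1 / (f x - f z)) = deriv F x / F x" by (simp add: F_def)
  qed simp
  finally have 2: "contour_integral (f \<circ> circlepath z r) (\<lambda>w. 1 / (w - f z)) = 2 * pi * \<i>"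
    using 1 by simp
  have "valid_path (f \<circ> circlepath z r)"
    by (rule valid_path_compose_holomorphic[OF val B(4,1) pB])
  moreover have "f z \<notin> path_image (f \<circ> circlepath z r)"
    using pim unfolding zeros F_def path_image_compose using B(3,5) by (force dest: inj_onD)
  ultimately show ?thesis
    using 2 by (simp add: winding_number_valid_path)
qed

text \<open>The inverse of a chart. Points of the glued space are described by explicit maps from
  plane coordinates, so injectivity, continuity and openness are easier to check in this
  direction.\<close>

definition parametrization :: "'a topology \<Rightarrow> complex set \<Rightarrow> (complex \<Rightarrow> 'a) \<Rightarrow> bool" where
  "parametrization S \<Omega> P \<longleftrightarrow>
     open \<Omega> \<and> inj_on P \<Omega> \<and> continuous_map (top_of_set \<Omega>) S P \<and>
     (\<forall>O' \<subseteq> \<Omega>. open O' \<longrightarrow> openin S (P ` O'))"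

lemma parametrization_homeomorphic_map:
  assumes "parametrization S \<Omega> P"
  shows "homeomorphic_map (top_of_set \<Omega>) (subtopology S (P ` \<Omega>)) P"
proof -
  have o: "open \<Omega>" "inj_on P \<Omega>" "continuous_map (top_of_set \<Omega>) S P"
    and op: "\<And>O'. O' \<subseteq> \<Omega> \<Longrightarrow> open O' \<Longrightarrow> openin S (P ` O')"
    using assms by (auto simp: parametrization_def)
  have "openin S (P ` \<Omega>)" using op o by blast
  then have sub: "P ` \<Omega> \<subseteq> topspace S" by (simp add: openin_subset)
  show ?thesis
  proof (rule bijective_open_imp_homeomorphic_map)
    show "continuous_map (top_of_set \<Omega>) (subtopology S (P ` \<Omega>)) P"
      using o by (simp add: continuous_map_in_subtopology)
    show "open_map (top_of_set \<Omega>) (subtopology S (P ` \<Omega>)) P"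
      unfolding open_map_def
    proof (intro allI impI)
      fix V assume "openin (top_of_set \<Omega>) V"
      then have "open V" "V \<subseteq> \<Omega>" using o by (auto simp: openin_open_eq)
      then show "openin (subtopology S (P ` \<Omega>)) (P ` V)"
        using op by (simp add: image_mono openin_subtopology_Int openin_subset_topspace_eq openin_subtopology) (metis image_mono inf.absorb1)
    qed
  qed (use sub o in auto)
qed

lemma chart_parametrization:
  assumes "parametrization S \<Omega> P"
  shows "chart S (P ` \<Omega>) (inv_into \<Omega> P)"
proof -
  have "inj_on P \<Omega>" "open \<Omega>" "openin S (P ` \<Omega>)"
    using assms by (auto simp: parametrization_def)
  moreover have "inv_into \<Omega> P ` P ` \<Omega> = \<Omega>"
    using \<open>inj_on P \<Omega>\<close> by (simp add: inv_into_image_cancel)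
  moreover have "homeomorphic_map (subtopology S (P ` \<Omega>)) (top_of_set \<Omega>) (inv_into \<Omega> P)"
  proof -
    have sub: "P ` \<Omega> \<subseteq> topspace S" using \<open>openin S (P ` \<Omega>)\<close> by (simp add: openin_subset)
    have "homeomorphic_map (top_of_set \<Omega>) (subtopology S (P ` \<Omega>)) P"
      by (rule parametrization_homeomorphic_map[OF assms])
    then obtain g where g: "homeomorphic_maps (top_of_set \<Omega>) (subtopology S (P ` \<Omega>)) P g"
      using homeomorphic_map_maps by blast
    then have "homeomorphic_map (subtopology S (P ` \<Omega>)) (top_of_set \<Omega>) g"
      using homeomorphic_map_maps homeomorphic_maps_sym by blast
    moreover have "g y = inv_into \<Omega> P y" if "y \<in> topspace (subtopology S (P ` \<Omega>))" for y
      using that g \<open>inj_on P \<Omega>\<close> by (auto simp: homeomorphic_maps_def)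
    ultimately show ?thesis
      by (metis (full_types) homeomorphic_map_eq)
  qed
  ultimately show ?thesis
    unfolding chart_def by simp
qed

text \<open>The function \<open>q\<close> plays the role of a ramified covering; only the point with parameter \<open>0\<close> of a
  chart may be ramified.\<close>

lemma orientable_by_holomorphic_functions:
  fixes \<P> :: "(complex set \<times> (complex \<Rightarrow> 'a)) set" and q :: "'a \<Rightarrow> complex"
  assumes par: "\<And>\<Omega> P. (\<Omega>, P) \<in> \<P> \<Longrightarrow> parametrization S \<Omega> P"
    and cov: "topspace S = (\<Union>(\<Omega>, P)\<in>\<P>. P ` \<Omega>)"
    and hol: "\<And>\<Omega> P. (\<Omega>, P) \<in> \<P> \<Longrightarrow> (q \<circ> P) holomorphic_on (\<Omega> - {0})"
    and der: "\<And>\<Omega> P z. (\<Omega>, P) \<in> \<P> \<Longrightarrow> z \<in> \<Omega> - {0} \<Longrightarrow> deriv (q \<circ> P) z \<noteq> 0"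
    and centre: "\<And>\<Omega> P \<Omega>' P'. (\<Omega>, P) \<in> \<P> \<Longrightarrow> (\<Omega>', P') \<in> \<P> \<Longrightarrow> (\<Omega>, P) \<noteq> (\<Omega>', P') \<Longrightarrow>
       0 \<in> \<Omega> \<Longrightarrow> P 0 \<notin> P' ` \<Omega>'"
  shows "orientable S"
proof -
  define \<A> where "\<A> = (\<lambda>(\<Omega>, P). (P ` \<Omega>, inv_into \<Omega> P)) ` \<P>"
  have charts: "\<forall>(U, \<phi>)\<in>\<A>. chart S U \<phi>"
    using chart_parametrization[OF par] by (auto simp: \<A>_def)
  have cover: "(\<Union>(U, \<phi>)\<in>\<A>. U) = topspace S"
    unfolding cov \<A>_def by force
  have trans: "orientation_preserving_on (inv_into \<Omega> P ` (P ` \<Omega> \<inter> P' ` \<Omega>'))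
      (inv_into \<Omega>' P' \<circ> inv_into (P ` \<Omega>) (inv_into \<Omega> P))"
    if \<P>: "(\<Omega>, P) \<in> \<P>" "(\<Omega>', P') \<in> \<P>" for \<Omega> P \<Omega>' P'
  proof -
    have p: "parametrization S \<Omega> P" "parametrization S \<Omega>' P'" using par \<P> by auto
    then have inj: "inj_on P \<Omega>" "inj_on P' \<Omega>'" and op: "open \<Omega>" "open \<Omega>'"
      by (auto simp: parametrization_def)
    define D where "D = inv_into \<Omega> P ` (P ` \<Omega> \<inter> P' ` \<Omega>')"
    define f where "f = inv_into \<Omega>' P' \<circ> P"
    have Deq: "D = {z \<in> \<Omega>. P z \<in> P' ` \<Omega>'}"
    proof (intro set_eqI iffI)
      fix z assume "z \<in> D"
      then obtain w where w: "w \<in> \<Omega>" "P w \<in> P' ` \<Omega>'" "z = inv_into \<Omega> P (P w)"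
        unfolding D_def by blast
      then have "z = w" using inj by simp
      then show "z \<in> {z \<in> \<Omega>. P z \<in> P' ` \<Omega>'}" using w by auto
    next
      fix z assume "z \<in> {z \<in> \<Omega>. P z \<in> P' ` \<Omega>'}"
      then have "inv_into \<Omega> P (P z) = z" "P z \<in> P ` \<Omega> \<inter> P' ` \<Omega>'" using inj by auto
      then show "z \<in> D" unfolding D_def by (metis imageI)
    qed
    have feq: "(inv_into \<Omega>' P' \<circ> inv_into (P ` \<Omega>) (inv_into \<Omega> P)) z = f z" if "z \<in> \<Omega>" for z
    proof -
      have "inv_into (P ` \<Omega>) (inv_into \<Omega> P) z = P z"
        using that inj by (intro inv_into_f_eq) (auto intro!: inj_on_inv_into)
      then show ?thesis by (simp add: f_def)
    qed
    have contP: "continuous_map (top_of_set \<Omega>) S P"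
      using p by (auto simp: parametrization_def)
    have "openin S (P' ` \<Omega>')" using p op by (auto simp: parametrization_def)
    then have "openin (top_of_set \<Omega>) {z \<in> topspace (top_of_set \<Omega>). P z \<in> P' ` \<Omega>'}"
      using contP openin_continuous_map_preimage by blast
    then have openD: "open D"
      using op by (simp add: Deq openin_open_eq)
    have f: "P' (f z) = P z" "f z \<in> \<Omega>'" if "z \<in> D" for z
      using that by (auto simp: Deq f_def f_inv_into_f inv_into_into)
    have injf: "inj_on f D"
    proof (rule inj_onI)
      fix x y assume xy: "x \<in> D" "y \<in> D" "f x = f y"
      then have "P x = P y" using f(1) by metis
      then show "x = y" using xy inj(1) unfolding Deq by (auto dest: inj_onD)
    qed
    have contf: "continuous_on D f"
    proof -
      have "continuous_map (subtopology S (P' ` \<Omega>')) (top_of_set (inv_into \<Omega>' P' ` P' ` \<Omega>')) (inv_into \<Omega>' P')"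
        using chart_parametrization[OF p(2)] by (simp add: chart_def homeomorphic_imp_continuous_map)
      then have "continuous_map (subtopology S (P' ` \<Omega>')) euclidean (inv_into \<Omega>' P')"
        by (simp add: continuous_map_in_subtopology)
      moreover have "continuous_map (top_of_set D) (subtopology S (P' ` \<Omega>')) P"
        using contP Deq by (auto simp: continuous_map_in_subtopology intro: continuous_map_from_subtopology_mono)
      ultimately have "continuous_map (top_of_set D) euclidean (inv_into \<Omega>' P' \<circ> P)"
        using continuous_map_compose by blast
      then show ?thesis by (simp add: f_def)
    qed
    have holf: "f holomorphic_on D"
    proof (cases "(\<Omega>, P) = (\<Omega>', P')")
      \<comment> \<open>Within one chart the transition is the identity; only here can the parameter
        0 lie in the domain.\<close>
      case True
      then have "f z = z" if "z \<in> D" for z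
        using that f[OF that] inj unfolding Deq by (auto dest: inj_onD)
      then show ?thesis
        by (intro holomorphic_transform[OF holomorphic_on_ident]) auto
    next
      case False
      \<comment> \<open>A possibly ramified point belongs to one chart only, so two different charts
        overlap where both parameters are nonzero. There the transition is
        \<open>q \<circ> P\<close> followed by a local inverse of
        \<open>q \<circ> P'\<close>.\<close>
      have nz: "z \<noteq> 0" "f z \<noteq> 0" if "z \<in> D" for z
      proof -
        show "z \<noteq> 0" using centre[OF \<P> False] that by (auto simp: Deq)
        show "f z \<noteq> 0"
          using centre[OF \<P>(2,1)] False f[OF that] that by (force simp: Deq)
      qed
      have "\<exists>e>0. f holomorphic_on ball z0 e" if z0: "z0 \<in> D" for z0
      proof -
        have op': "open (\<Omega>' - {0})" using op by (simp add: open_delete)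
        have m: "f z0 \<in> \<Omega>' - {0}" using f nz z0 by auto
        obtain r where r: "r > 0" "ball (f z0) r \<subseteq> \<Omega>' - {0}" "inj_on (q \<circ> P') (ball (f z0) r)"
          using has_complex_derivative_locally_injective[OF hol[OF \<P>(2)] m op' der[OF \<P>(2) m]] .
        have "(q \<circ> P') holomorphic_on ball (f z0) r"
          using hol[OF \<P>(2)] r(2) holomorphic_on_subset by blast
        then obtain k where k: "k holomorphic_on (q \<circ> P') ` ball (f z0) r"
            "\<And>z. z \<in> ball (f z0) r \<Longrightarrow> k ((q \<circ> P') z) = z"
          using holomorphic_has_inverse[OF _ open_ball r(3)] by metis
        have "open (D \<inter> f -` ball (f z0) r)"
          using contf openD by (simp add: continuous_open_preimage)
        then obtain e where e: "e > 0" "ball z0 e \<subseteq> D \<inter> f -` ball (f z0) r"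
          using z0 r(1) by (metis IntI centre_in_ball open_contains_ball vimageI)
        have keq: "k ((q \<circ> P) z) = f z" if "z \<in> ball z0 e" for z
        proof -
          have z: "z \<in> D" "f z \<in> ball (f z0) r" using e that by auto
          then have "(q \<circ> P) z = (q \<circ> P') (f z)" using f by simp
          then show ?thesis using k(2) z by metis
        qed
        have im: "(q \<circ> P) ` ball z0 e \<subseteq> (q \<circ> P') ` ball (f z0) r"
        proof safe
          fix z assume "z \<in> ball z0 e"
          then have z: "z \<in> D" "f z \<in> ball (f z0) r" using e by auto
          then show "(q \<circ> P) z \<in> (q \<circ> P') ` ball (f z0) r" using f(1)[of z] by (metis comp_apply imageI)
        qed
        have "D \<subseteq> \<Omega> - {0}" using nz(1) Deq by blast
        then have "ball z0 e \<subseteq> \<Omega> - {0}" using e(2) by blast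
        then have "(q \<circ> P) holomorphic_on ball z0 e"
          by (rule holomorphic_on_subset[OF hol[OF \<P>(1)]])
        then have "(k \<circ> (q \<circ> P)) holomorphic_on ball z0 e"
          using k(1) im by (rule holomorphic_on_compose_gen)
        then have "f holomorphic_on ball z0 e"
          by (rule holomorphic_transform) (use keq in auto)
        then show ?thesis using e(1) by blast
      qed
      then have "f analytic_on D"
        by (meson analytic_on_def)
      then show ?thesis by (rule analytic_imp_holomorphic)
    qed
    show ?thesis
      unfolding orientation_preserving_on_def D_def[symmetric]
    proof (intro allI impI)
      fix z r assume zr: "0 < r \<and> cball z r \<subseteq> D"
      let ?g = "inv_into \<Omega>' P' \<circ> inv_into (P ` \<Omega>) (inv_into \<Omega> P)"
      have "?g holomorphic_on D"
        by (rule holomorphic_transform[OF holf]) (use feq Deq in auto)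
      moreover have "inj_on ?g D"
        using injf feq Deq by (auto simp: inj_on_def simp del: comp_apply)
      ultimately show "winding_number (?g \<circ> circlepath z r) (?g z) = 1"
        using winding_number_injective_holomorphic openD zr by blast
    qed
  qed
  show ?thesis
    unfolding orientable_def
  proof (intro exI[of _ \<A>] conjI)
    show "\<forall>(U, \<phi>)\<in>\<A>. \<forall>(V, \<psi>)\<in>\<A>. orientation_preserving_on (\<phi> ` (U \<inter> V)) (\<psi> \<circ> inv_into U \<phi>)"
      using trans by (force simp: \<A>_def)
  qed (use charts cover in auto)
qed

section \<open>Gluing discs along a rotation system\<close>

text \<open>In \<open>pt d t s\<close>, \<open>d\<close> is an arc, \<open>t\<close> (with \<open>0 \<le> t < 1\<close>) a position along it, and \<open>s\<close> the signed
  height over it: positive in the black face at \<open>d\<close>, negative in the white one, \<open>0\<close> on the arc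
  itself. Face centres lie at infinite height.\<close>

definition vert :: "nat \<Rightarrow> nat \<Rightarrow> real" where
  "vert x = (\<lambda>_. 0)(1 := real x)"

definition pt :: "nat \<times> nat \<Rightarrow> real \<Rightarrow> real \<Rightarrow> nat \<Rightarrow> real" where
  "pt d t s = (\<lambda>_. 0)(0 := 1, 1 := real (fst d), 2 := real (snd d), 3 := t, 4 := s)"

text \<open>Coordinate 0 is a tag: 0 for vertices, 1 for points over an arc, 2 and 3 for black and
  white centres. Coordinates 3 and 4, meant for position and height, are 0 at vertices and
  centres.\<close>

definition ctr :: "bool \<Rightarrow> nat \<times> nat \<Rightarrow> nat \<Rightarrow> real" where
  "ctr c d = (\<lambda>_. 0)(0 := if c then 2 else 3, 1 := real (fst d), 2 := real (snd d))"

lemma vert_eq [simp]: "vert x = vert y \<longleftrightarrow> x = y"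
proof
  assume "vert x = vert y"
  then have "vert x 1 = vert y 1" by simp
  then show "x = y" by (simp add: vert_def)
qed simp

lemma pt_eq [simp]: "pt d t s = pt d' t' s' \<longleftrightarrow> d = d' \<and> t = t' \<and> s = s'"
proof
  assume "pt d t s = pt d' t' s'"
  then have "pt d t s i = pt d' t' s' i" for i by simp
  from this[of 1] this[of 2] this[of 3] this[of 4] show "d = d' \<and> t = t' \<and> s = s'"
    by (simp add: pt_def prod_eq_iff)
qed simp

lemma ctr_eq [simp]: "ctr c d = ctr c' d' \<longleftrightarrow> c = c' \<and> d = d'"
proof
  assume "ctr c d = ctr c' d'"
  then have "ctr c d i = ctr c' d' i" for i by simp
  from this[of 0] this[of 1] this[of 2] show "c = c' \<and> d = d'"
    by (auto simp: ctr_def prod_eq_iff split: if_splits)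
qed simp

lemma point_kinds_distinct [simp]:
  "vert x \<noteq> pt d t s" "pt d t s \<noteq> vert x" "vert x \<noteq> ctr c e" "ctr c e \<noteq> vert x"
  "pt d t s \<noteq> ctr c e" "ctr c e \<noteq> pt d t s"
proof -
  have "vert x 0 \<noteq> pt d t s 0" "vert x 0 \<noteq> ctr c e 0" "pt d t s 0 \<noteq> ctr c e 0"
    by (auto simp: vert_def pt_def ctr_def)
  then show "vert x \<noteq> pt d t s" "pt d t s \<noteq> vert x" "vert x \<noteq> ctr c e" "ctr c e \<noteq> vert x"
    "pt d t s \<noteq> ctr c e" "ctr c e \<noteq> pt d t s" by metis+
qed

section \<open>Integer powers of a bijection\<close>

definition zpow :: "('a \<Rightarrow> 'a) \<Rightarrow> int \<Rightarrow> 'a \<Rightarrow> 'a" where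
  "zpow f j = (if 0 \<le> j then f ^^ nat j else inv f ^^ nat (- j))"

lemma zpow_0 [simp]: "zpow f 0 x = x"
  by (simp add: zpow_def)

lemma zpow_of_nat: "zpow f (int n) = f ^^ n"
  by (simp add: zpow_def)

lemma zpow_minus_one: "zpow f (- 1) x = inv f x"
  by (simp add: zpow_def)

lemma zpow_add_one:
  assumes "bij f"
  shows "zpow f (j + 1) x = f (zpow f j x)"
proof (cases "0 \<le> j")
  case True
  then show ?thesis by (simp add: zpow_def nat_add_distrib)
next
  case False
  then have "nat (- j) = Suc (nat (- (j + 1)))" by simp
  then have "zpow f j x = inv f ((inv f ^^ nat (- (j + 1))) x)"
    using False by (simp add: zpow_def)
  then have "f (zpow f j x) = (inv f ^^ nat (- (j + 1))) x"
    using assms by (simp add: bij_is_surj surj_f_inv_f)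
  moreover have "zpow f (j + 1) x = (inv f ^^ nat (- (j + 1))) x"
    using False by (cases "j = -1") (auto simp: zpow_def)
  ultimately show ?thesis by simp
qed

lemma zpow_add:
  assumes "bij f"
  shows "zpow f (i + j) x = zpow f i (zpow f j x)"
proof (induction i rule: int_induct[where k = 0])
  case (step1 i)
  then show ?case
    using zpow_add_one[OF assms, of "i + j" x] zpow_add_one[OF assms, of i "zpow f j x"]
    by (simp add: algebra_simps)
next
  case (step2 i)
  then have "f (zpow f (i - 1 + j) x) = f (zpow f (i - 1) (zpow f j x))"
    using zpow_add_one[OF assms, of "i - 1 + j" x] zpow_add_one[OF assms, of "i - 1" "zpow f j x"]
    by (simp add: algebra_simps)
  then show ?case using assms by (simp add: bij_is_inj inj_eq)
qed simp

text \<open>The covering of the punctured closed disc by the closed upper half-plane, with period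
  \<open>l\<close>. Successive unit intervals of the real axis become the \<open>l\<close> equal
  arcs of the unit circle.\<close>

definition turn :: "nat \<Rightarrow> complex \<Rightarrow> complex" where
  "turn l u = exp (2 * of_real pi * \<i> * u / of_nat l)"

lemma turn_nonzero [simp]: "turn l u \<noteq> 0"
  by (simp add: turn_def)

lemma turn_add: "turn l (u + u') = turn l u * turn l u'"
  by (simp add: turn_def distrib_left add_divide_distrib exp_add)

lemma norm_turn: "norm (turn l u) = exp (- (2 * pi * Im u / of_nat l))"
  by (simp add: turn_def norm_exp_eq_Re Re_divide_of_nat)

lemma norm_turn_of_int [simp]: "norm (turn l (of_int j)) = 1"
  by (simp add: norm_turn)

lemma norm_turn_le_1: "0 < l \<Longrightarrow> norm (turn l u) \<le> 1 \<longleftrightarrow> 0 \<le> Im u"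
proof -
  have "\<not> pi \<le> 0" by (simp add: not_le)
  then show "0 < l \<Longrightarrow> norm (turn l u) \<le> 1 \<longleftrightarrow> 0 \<le> Im u"
    by (simp add: norm_turn zero_le_divide_iff zero_le_mult_iff)
qed

lemma norm_turn_less_1: "0 < l \<Longrightarrow> norm (turn l u) < 1 \<longleftrightarrow> 0 < Im u"
  by (simp add: norm_turn zero_less_divide_iff zero_less_mult_iff)

lemma turn_eq_iff:
  assumes "0 < l"
  shows "turn l u = turn l u' \<longleftrightarrow> (\<exists>k::int. u = u' + of_int (int l * k))"
proof -
  have "2 * of_real pi * \<i> * u / of_nat l = 2 * of_real pi * \<i> * u' / of_nat l + of_int (2 * k) * of_real pi * \<i>
      \<longleftrightarrow> u = u' + of_int (int l * k)" for k :: int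
  proof -
    let ?a = "2 * of_real pi * \<i> / of_nat l :: complex"
    have "2 * of_real pi * \<i> * u / of_nat l = ?a * u"
      "2 * of_real pi * \<i> * u' / of_nat l + of_int (2 * k) * of_real pi * \<i> = ?a * (u' + of_int (int l * k))"
      using assms by (simp_all add: field_simps)
    moreover have "?a \<noteq> 0" using assms by simp
    ultimately show ?thesis by (simp only: mult_cancel_left) simp
  qed
  then show ?thesis
    unfolding turn_def exp_eq by simp
qed

lemma turn_Ln:
  assumes "0 < l" "w \<noteq> 0"
  shows "turn l (of_nat l * Ln w / (2 * of_real pi * \<i>)) = w"
  using assms by (simp add: turn_def)

lemma turn_surj:
  assumes "0 < l" "w \<noteq> 0"
  obtains u where "w = turn l u"
  using turn_Ln[OF assms] by metis

lemma turn_power: "0 < l \<Longrightarrow> turn l u ^ l = exp (2 * of_real pi * \<i> * u)"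
  by (simp add: turn_def flip: exp_of_nat_mult)

lemma turn_holomorphic: "turn l holomorphic_on A"
  unfolding turn_def by (intro holomorphic_intros) auto

lemma continuous_on_turn: "continuous_on A (turn l)"
  using turn_holomorphic holomorphic_on_imp_continuous_on by blast

lemma open_turn_image:
  assumes "0 < l" "open A"
  shows "open (turn l ` A)"
proof (rule open_mapping_thm[of "turn l" UNIV])
  show "\<not> turn l constant_on UNIV"
  proof
    assume "turn l constant_on UNIV"
    then have "norm (turn l 0) = norm (turn l \<i>)" by (auto simp: constant_on_def)
    then show False using assms(1) by (simp add: norm_turn)
  qed
qed (use assms turn_holomorphic in auto)

abbreviation upper :: "complex set" where
  "upper \<equiv> {u. 0 \<le> Im u}"

text \<open>Exactly the points of \<open>upper\<close> are sent into the closed disc, so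
  intersecting an open set with \<open>upper\<close> amounts to intersecting its open image with the
  disc.\<close>

lemma openin_turn_image:
  assumes "0 < l" "openin (top_of_set upper) A"
  shows "openin (top_of_set (cball 0 1)) (turn l ` A)"
proof -
  obtain B where B: "open B" "A = upper \<inter> B"
    using assms(2) by (auto simp: openin_open)
  have "turn l ` A = cball 0 1 \<inter> turn l ` B"
    using B(2) norm_turn_le_1[OF assms(1)] by auto
  then show ?thesis
    using open_turn_image[OF assms(1) B(1)] by (auto simp: openin_open)
qed

definition sg :: "bool \<Rightarrow> real" where
  "sg c = (if c then 1 else - 1)"

lemma sg_simps [simp]: "sg True = 1" "sg False = - 1"
  by (simp_all add: sg_def)

lemma sg_mult_eq:
  "0 < s \<Longrightarrow> 0 \<le> s' \<Longrightarrow> sg c * s = sg c' * s' \<Longrightarrow> c = c' \<and> s = s'"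
  by (cases c; cases c') auto

text \<open>\<open>T c d\<close> is the arc following \<open>d\<close> in its face of colour \<open>c\<close> (\<^const>\<open>True\<close> is black). The last
  assumption says that the faces at the vertex \<open>x\<close> form a single cycle: the incoming arc shared by the
  black face leaving through \<open>rot x k\<close> and the white face leaving through \<open>rot x (k + 1)\<close>.\<close>

locale rotation_system =
  fixes v N :: nat and D :: "(nat \<times> nat) set"
    and T :: "bool \<Rightarrow> nat \<times> nat \<Rightarrow> nat \<times> nat"
    and rot :: "nat \<Rightarrow> nat \<Rightarrow> nat \<times> nat"
  assumes D_sub: "D \<subseteq> {..<v} \<times> {..<v}"
    and D_tournament: "x < v \<Longrightarrow> y < v \<Longrightarrow> x \<noteq> y \<Longrightarrow> (x, y) \<in> D \<longleftrightarrow> (y, x) \<notin> D"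
    and D_irrefl: "(x, x) \<notin> D"
    and v_pos: "0 < v" and N_pos: "0 < N"
    and T_permutes: "T c permutes D"
    and fst_T: "d \<in> D \<Longrightarrow> fst (T c d) = snd d"
    and rot_bij: "x < v \<Longrightarrow> bij_betw (rot x) {..<N} {d \<in> D. fst d = x}"
    and rot_T: "x < v \<Longrightarrow> k < N \<Longrightarrow> inv (T False) (rot x (Suc k mod N)) = inv (T True) (rot x k)"
begin

section \<open>Faces as cycles of the arc permutations\<close>

lemma fst_less: "d \<in> D \<Longrightarrow> fst d < v" and snd_less: "d \<in> D \<Longrightarrow> snd d < v"
  using D_sub by auto

lemma finite_D: "finite D"
  using D_sub finite_subset by blast

lemma bij_T: "bij (T c)"
  using T_permutes permutes_bij by blast

lemma permutation_T: "permutation (T c)"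
  using T_permutes finite_D by (auto simp: permutation_permutes)

text \<open>Negative \<open>j\<close> runs backwards along the face; with all integers available the
  boundary unrolls along the whole real axis.\<close>

definition dart :: "bool \<Rightarrow> nat \<times> nat \<Rightarrow> int \<Rightarrow> nat \<times> nat" where
  "dart c d j = zpow (T c) j d"

definition len :: "bool \<Rightarrow> nat \<times> nat \<Rightarrow> nat" where
  "len c d = least_power (T c) d"

lemma dart_0 [simp]: "dart c d 0 = d"
  by (simp add: dart_def)

lemma dart_of_nat: "dart c d (int k) = (T c ^^ k) d"
  by (simp add: dart_def zpow_of_nat)

lemma dart_minus_one: "dart c d (- 1) = inv (T c) d"
  by (simp add: dart_def zpow_minus_one)

lemma dart_add: "dart c d (i + j) = dart c (dart c d i) j"
  using zpow_add[OF bij_T, of c j i d] by (simp add: dart_def add.commute)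

lemma dart_add_one: "dart c d (j + 1) = T c (dart c d j)"
  by (simp add: dart_def zpow_add_one[OF bij_T])

lemma dart_in_D [simp]: "dart c d j \<in> D \<longleftrightarrow> d \<in> D"
proof (induction j rule: int_induct[where k = 0])
  case (step1 i)
  then show ?case by (simp add: dart_add_one permutes_in_image[OF T_permutes])
next
  case (step2 i)
  have "dart c d i = T c (dart c d (i - 1))" using dart_add_one[of c d "i - 1"] by simp
  then show ?case using step2 by (simp add: permutes_in_image[OF T_permutes])
qed simp

lemma fst_dart_add_one: "d \<in> D \<Longrightarrow> fst (dart c d (j + 1)) = snd (dart c d j)"
  by (simp add: dart_add_one fst_T)

lemma snd_dart_minus_one: "d \<in> D \<Longrightarrow> snd (dart c d (- 1)) = fst d"
  using fst_dart_add_one[of d c "- 1"] by simp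

lemma dart_cancel: "dart c d i = dart c d' j \<longleftrightarrow> d' = dart c d (i - j)"
proof
  assume "dart c d i = dart c d' j"
  then have "dart c (dart c d i) (- j) = dart c (dart c d' j) (- j)" by simp
  then show "d' = dart c d (i - j)" by (simp flip: dart_add)
qed (simp flip: dart_add)

lemma len_pos: "0 < len c d"
  unfolding len_def by (rule least_power_of_permutation[OF permutation_T])

lemma dart_eq_self_iff: "dart c d k = d \<longleftrightarrow> int (len c d) dvd k"
proof -
  have nn: "dart c d k = d \<longleftrightarrow> int (len c d) dvd k" if "0 \<le> k" for k
  proof -
    have "k = int (nat k)" using that by simp
    then have "dart c d k = (T c ^^ nat k) d" by (metis dart_of_nat)
    then have "dart c d k = d \<longleftrightarrow> len c d dvd nat k"
      using least_power_dvd[OF permutation_T] by (simp add: len_def)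
    then show ?thesis using \<open>k = int (nat k)\<close> by (metis int_dvd_int_iff)
  qed
  show ?thesis
  proof (cases "0 \<le> k")
    case False
    have "dart c d k = d \<longleftrightarrow> dart c d (- k) = d"
      using dart_cancel[of c d k d 0] by (auto simp: dart_cancel[of c d "- k" d 0])
        (metis add.right_inverse add.left_inverse dart_0 dart_add)+
    then show ?thesis using nn[of "- k"] False by simp
  qed (use nn in blast)
qed

lemma dart_eq_iff: "dart c d i = dart c d j \<longleftrightarrow> int (len c d) dvd i - j"
  using dart_cancel[of c d i d j] dart_eq_self_iff[of c d "i - j"] by auto

lemma len_dart [simp]: "len c (dart c d j) = len c d"
proof -
  have "int (len c (dart c d j)) dvd k \<longleftrightarrow> int (len c d) dvd k" for k
    using dart_eq_self_iff[of c "dart c d j" k] dart_eq_iff[of c d "j + k" j] by (simp flip: dart_add)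
  from this[of "int (len c d)"] this[of "int (len c (dart c d j))"]
  show ?thesis by (simp add: dvd_antisym)
qed

lemma turn_len_surj: "w \<noteq> 0 \<Longrightarrow> \<exists>u. w = turn (len c d) u"
  using turn_surj[OF len_pos] by metis

text \<open>A distinguished arc of each face, so that the centre does not depend on the starting arc.\<close>

definition rep :: "bool \<Rightarrow> nat \<times> nat \<Rightarrow> nat \<times> nat" where
  "rep c d = (SOME e. \<exists>j. e = dart c d j)"

lemma rep_dart_ex: "\<exists>j. rep c d = dart c d j"
  unfolding rep_def by (rule someI_ex) blast

lemma rep_eq_iff: "rep c d = rep c d' \<longleftrightarrow> (\<exists>j. d' = dart c d j)"
proof
  assume "rep c d = rep c d'"
  then show "\<exists>j. d' = dart c d j"
    using rep_dart_ex[of c d] rep_dart_ex[of c d'] dart_cancel by metis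
next
  assume "\<exists>j. d' = dart c d j"
  then obtain j where j: "d' = dart c d j" ..
  have "(\<exists>i. e = dart c d' i) \<longleftrightarrow> (\<exists>i. e = dart c d i)" for e
  proof
    assume "\<exists>i. e = dart c d i"
    then obtain i where "e = dart c d i" ..
    then have "e = dart c d' (i - j)" unfolding j by (simp flip: dart_add)
    then show "\<exists>i. e = dart c d' i" ..
  qed (metis j dart_add)
  then show "rep c d = rep c d'" unfolding rep_def by simp
qed

lemma rep_rep [simp]: "rep c (rep c d) = rep c d"
  using rep_dart_ex[of c d] rep_eq_iff by metis

lemma rep_in_D [simp]: "rep c d \<in> D \<longleftrightarrow> d \<in> D"
  using rep_dart_ex[of c d] by auto

text \<open>The upper half-plane unrolls a face: the real interval \<open>[j, j + 1]\<close> is the \<open>j\<close>-th arc after \<open>d\<close>. In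
  a white face the height is reflected.\<close>

definition lam :: "bool \<Rightarrow> nat \<times> nat \<Rightarrow> complex \<Rightarrow> nat \<Rightarrow> real" where
  "lam c d u = (if frac (Re u) = 0 \<and> Im u = 0 then vert (fst (dart c d \<lfloor>Re u\<rfloor>))
     else pt (dart c d \<lfloor>Re u\<rfloor>) (frac (Re u)) (sg c * Im u))"

lemma lam_add_of_int: "lam c d (u + of_int j) = lam c (dart c d j) u"
proof -
  have "frac (Re u + of_int j) = frac (Re u)"
    by (simp add: frac_def)
  then show ?thesis by (simp add: lam_def add.commute flip: dart_add)
qed

lemma lam_diff_of_int: "lam c (dart c d j) (u - of_int j) = lam c d u"
  using lam_add_of_int[of c d "u - of_int j" j] by simp

lemma lam_period: "lam c d (u + of_int (int (len c d) * k)) = lam c d u"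
proof -
  have "dart c d (int (len c d) * k) = d" by (simp add: dart_eq_self_iff)
  then show ?thesis by (simp only: lam_add_of_int)
qed

lemma lam_unit:
  assumes "0 \<le> Re u" "Re u < 1"
  shows "lam c d u = (if u = 0 then vert (fst d) else pt d (Re u) (sg c * Im u))"
proof -
  have "\<lfloor>Re u\<rfloor> = 0" "frac (Re u) = Re u" using assms by (auto simp: frac_eq floor_eq_iff)
  then show ?thesis by (simp add: lam_def complex_eq_iff)
qed

lemma lam_negative:
  assumes "- 1 < Re u" "Re u < 0"
  shows "lam c d u = pt (dart c d (- 1)) (1 + Re u) (sg c * Im u)"
proof -
  have "lam c d u = lam c (dart c d (- 1)) (u + 1)"
    using lam_diff_of_int[of c d "- 1" u] by simp
  also have "\<dots> = pt (dart c d (- 1)) (1 + Re u) (sg c * Im u)"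
    using assms by (subst lam_unit) (auto simp: complex_eq_iff)
  finally show ?thesis .
qed

lemma lam_not_ctr [simp]: "lam c d u \<noteq> ctr c' d'" "ctr c' d' \<noteq> lam c d u"
  by (auto simp: lam_def)

text \<open>A positive height fixes the colour through the sign of the last coordinate; after that
  only the starting arc is undetermined.\<close>

lemma lam_eqD:
  assumes "lam c d u = lam c' d' u'" "0 < Im u" "0 \<le> Im u'"
  shows "c' = c" "\<exists>j. d' = dart c d j \<and> u = u' + of_int j"
proof -
  have eq: "dart c d \<lfloor>Re u\<rfloor> = dart c' d' \<lfloor>Re u'\<rfloor>" "frac (Re u) = frac (Re u')" "sg c * Im u = sg c' * Im u'"
    using assms by (auto simp: lam_def split: if_splits)
  show c: "c' = c" using sg_mult_eq[OF assms(2,3) eq(3)] by simp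
  let ?j = "\<lfloor>Re u\<rfloor> - \<lfloor>Re u'\<rfloor>"
  have "d' = dart c d ?j" using eq(1) c dart_cancel by blast
  moreover have "u = u' + of_int ?j"
    using eq(2) sg_mult_eq[OF assms(2,3) eq(3)] by (simp add: complex_eq_iff frac_def)
  ultimately show "\<exists>j. d' = dart c d j \<and> u = u' + of_int j" by blast
qed

text \<open>The unrolled face modulo translation by its length, closed up by the centre. Any inverse
  branch of \<open>turn\<close> would give the same map, by \<open>lam_period\<close>;
  \<open>Ln\<close> supplies one.\<close>

definition disc :: "bool \<Rightarrow> nat \<times> nat \<Rightarrow> complex \<Rightarrow> nat \<Rightarrow> real" where
  "disc c d w = (if w = 0 then ctr c (rep c d)
     else lam c d (of_nat (len c d) * Ln w / (2 * of_real pi * \<i>)))"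

lemma disc_0 [simp]: "disc c d 0 = ctr c (rep c d)"
  by (simp add: disc_def)

lemma disc_turn: "disc c d (turn (len c d) u) = lam c d u"
proof -
  let ?u = "of_nat (len c d) * Ln (turn (len c d) u) / (2 * of_real pi * \<i>)"
  have "turn (len c d) ?u = turn (len c d) u"
    by (rule turn_Ln) (auto simp: len_pos)
  then obtain k where "?u = u + of_int (int (len c d) * k)"
    using turn_eq_iff[OF len_pos] by blast
  then show ?thesis unfolding disc_def using lam_period by simp
qed

text \<open>\<open>turn\<close> carries translation by \<open>j\<close> to a rotation, and the
  centre is the same because all arcs of a face have the same \<open>rep\<close>.\<close>

lemma disc_dart: "disc c (dart c d j) w = disc c d (w * turn (len c d) (of_int j))"
proof (cases "w = 0")
  case True
  then show ?thesis using rep_eq_iff by (metis disc_0 mult_zero_left)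
next
  case False
  then obtain u where w: "w = turn (len c d) u" using turn_len_surj by blast
  have "disc c (dart c d j) w = lam c (dart c d j) u"
    using disc_turn[of c "dart c d j" u] by (simp add: w)
  also have "\<dots> = disc c d (turn (len c d) (u + of_int j))"
    by (simp add: disc_turn lam_add_of_int)
  finally show ?thesis by (simp add: w turn_add)
qed

text \<open>Nothing is glued inside a face: equal points are one point of one face seen from two
  starting arcs. Only \<open>w\<close> has to be interior, so the lemma also excludes that an
  interior point lies on the boundary circle of some disc.\<close>

lemma disc_eqD:
  assumes "disc c d w = disc c' d' w'" "norm w < 1" "norm w' \<le> 1"
  shows "c' = c" "\<exists>j. d' = dart c d j \<and> w = w' * turn (len c d) (of_int j)"
proof -
  have "c' = c \<and> (\<exists>j. d' = dart c d j \<and> w = w' * turn (len c d) (of_int j))"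
  proof (cases "w = 0")
    case True
    then have "w' = 0" using assms(1) by (auto simp: disc_def split: if_splits)
    then have "c' = c" "rep c d = rep c d'" using assms(1) True by auto
    then show ?thesis using True \<open>w' = 0\<close> rep_eq_iff[of c d d'] by simp
  next
    case False
    then obtain u where w: "w = turn (len c d) u" using turn_len_surj by blast
    have "w' \<noteq> 0" using assms(1) False by (auto simp: disc_def)
    then obtain u' where w': "w' = turn (len c' d') u'" using turn_len_surj by blast
    have "lam c d u = lam c' d' u'" using assms(1) by (simp add: w w' disc_turn)
    moreover have "0 < Im u" "0 \<le> Im u'"
      using assms(2,3) by (simp_all add: w w' norm_turn_less_1 norm_turn_le_1 len_pos)
    ultimately have "c' = c" "\<exists>j. d' = dart c d j \<and> u = u' + of_int j"
      by (rule lam_eqD)+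
    then show ?thesis by (auto simp: w w' turn_add)
  qed
  then show "c' = c" "\<exists>j. d' = dart c d j \<and> w = w' * turn (len c d) (of_int j)" by blast+
qed

section \<open>The glued space and its quotient topology\<close>

definition X :: "(nat \<Rightarrow> real) set" where
  "X = (\<Union>c. \<Union>d\<in>D. disc c d ` cball 0 1)"

text \<open>The final topology for all maps \<open>disc c d\<close>. A face occurs here once for
  each of its arcs, but these copies differ only by rotations.\<close>

definition S :: "(nat \<Rightarrow> real) topology" where
  "S = topology (\<lambda>U. U \<subseteq> X \<and>
     (\<forall>c. \<forall>d\<in>D. openin (top_of_set (cball 0 1)) {w \<in> cball 0 1. disc c d w \<in> U}))"

lemma openin_S:
  "openin S U \<longleftrightarrow> U \<subseteq> X \<and>
     (\<forall>c. \<forall>d\<in>D. openin (top_of_set (cball 0 1)) {w \<in> cball 0 1. disc c d w \<in> U})"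
proof -
  have "istopology (\<lambda>U. U \<subseteq> X \<and>
     (\<forall>c. \<forall>d\<in>D. openin (top_of_set (cball 0 1)) {w \<in> cball 0 1. disc c d w \<in> U}))"
    unfolding istopology_def
  proof (intro conjI allI impI)
    fix U V
    assume U: "U \<subseteq> X \<and> (\<forall>c. \<forall>d\<in>D. openin (top_of_set (cball 0 1)) {w \<in> cball 0 1. disc c d w \<in> U})"
      and V: "V \<subseteq> X \<and> (\<forall>c. \<forall>d\<in>D. openin (top_of_set (cball 0 1)) {w \<in> cball 0 1. disc c d w \<in> V})"
    show "\<forall>d\<in>D. openin (top_of_set (cball 0 1)) {w \<in> cball 0 1. disc c d w \<in> U \<inter> V}" for c
    proof (rule ballI)
      fix d assume "d \<in> D"
      then have "openin (top_of_set (cball 0 1))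
          ({w \<in> cball 0 1. disc c d w \<in> U} \<inter> {w \<in> cball 0 1. disc c d w \<in> V})"
        using U V by (intro openin_Int) auto
      moreover have "{w \<in> cball 0 1. disc c d w \<in> U \<inter> V} =
          {w \<in> cball 0 1. disc c d w \<in> U} \<inter> {w \<in> cball 0 1. disc c d w \<in> V}"
        by blast
      ultimately show "openin (top_of_set (cball 0 1)) {w \<in> cball 0 1. disc c d w \<in> U \<inter> V}"
        by simp
    qed
    show "U \<inter> V \<subseteq> X" using U by blast
  next
    fix K
    assume K: "\<forall>U\<in>K. U \<subseteq> X \<and> (\<forall>c. \<forall>d\<in>D. openin (top_of_set (cball 0 1)) {w \<in> cball 0 1. disc c d w \<in> U})"
    have "{w \<in> cball 0 1. disc c d w \<in> \<Union> K} = (\<Union>U\<in>K. {w \<in> cball 0 1. disc c d w \<in> U})" for c d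
      by blast
    moreover have "openin (top_of_set (cball 0 1)) (\<Union>U\<in>K. {w \<in> cball 0 1. disc c d w \<in> U})" if "d \<in> D" for c d
      using K that by (intro openin_Union) blast
    ultimately show "\<forall>d\<in>D. openin (top_of_set (cball 0 1)) {w \<in> cball 0 1. disc c d w \<in> \<Union> K}" for c
      by simp
    show "\<Union> K \<subseteq> X" using K by blast
  qed
  then show ?thesis unfolding S_def by (simp only: topology_inverse')
qed

lemma topspace_S: "topspace S = X"
proof -
  have "disc c d w \<in> X" if "d \<in> D" "w \<in> cball 0 1" for c d w
    using that unfolding X_def by blast
  then have "{w \<in> cball 0 1. disc c d w \<in> X} = cball 0 1" if "d \<in> D" for c d
    using that by blast
  then have "openin S X" by (simp add: openin_S)
  then have "X \<subseteq> topspace S" by (rule openin_subset)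
  moreover have "topspace S \<subseteq> X" using openin_topspace[of S] unfolding openin_S by blast
  ultimately show ?thesis by blast
qed

lemma disc_in_X: "d \<in> D \<Longrightarrow> norm w \<le> 1 \<Longrightarrow> disc c d w \<in> X"
  unfolding X_def by (intro UN_I[of c] UN_I[of d] imageI) auto

lemma lam_in_X: "d \<in> D \<Longrightarrow> 0 \<le> Im u \<Longrightarrow> lam c d u \<in> X"
  using disc_in_X[of d "turn (len c d) u" c] by (simp add: disc_turn norm_turn_le_1 len_pos)

lemma continuous_map_disc: "d \<in> D \<Longrightarrow> continuous_map (top_of_set (cball 0 1)) S (disc c d)"
  by (auto simp: continuous_map_def openin_S topspace_S disc_in_X)

lemma continuous_map_lam: "d \<in> D \<Longrightarrow> continuous_map (top_of_set upper) S (lam c d)"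
proof -
  assume d: "d \<in> D"
  have "continuous_map (top_of_set upper) (top_of_set (cball 0 1)) (turn (len c d))"
    by (auto simp: continuous_on_turn norm_turn_le_1 len_pos)
  then have "continuous_map (top_of_set upper) S (disc c d \<circ> turn (len c d))"
    using continuous_map_disc[OF d] continuous_map_compose by blast
  then show ?thesis by (simp add: o_def disc_turn)
qed

text \<open>Away from the centres every point of a disc comes from the half-plane, and
  \<open>turn\<close>, being open, takes the preimage of \<open>U\<close> there to its preimage in
  the disc.\<close>

lemma openin_S_lam:
  assumes "U \<subseteq> X" "\<And>c d. ctr c d \<notin> U"
    and op: "\<And>c d. d \<in> D \<Longrightarrow> openin (top_of_set upper) {u \<in> upper. lam c d u \<in> U}"
  shows "openin S U"
proof -
  have "{w \<in> cball 0 1. disc c d w \<in> U} = turn (len c d) ` {u \<in> upper. lam c d u \<in> U}" for c d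
  proof (intro set_eqI iffI)
    fix w assume w: "w \<in> {w \<in> cball 0 1. disc c d w \<in> U}"
    have "w \<noteq> 0"
    proof
      assume "w = 0"
      then show False using w assms(2)[of c "rep c d"] by simp
    qed
    then obtain u where "w = turn (len c d) u" using turn_len_surj by blast
    then show "w \<in> turn (len c d) ` {u \<in> upper. lam c d u \<in> U}"
      using w by (auto simp: disc_turn norm_turn_le_1 len_pos)
  next
    fix w assume "w \<in> turn (len c d) ` {u \<in> upper. lam c d u \<in> U}"
    then show "w \<in> {w \<in> cball 0 1. disc c d w \<in> U}"
      by (auto simp: disc_turn norm_turn_le_1 len_pos)
  qed
  then show ?thesis
    using assms(1) op openin_turn_image[OF len_pos] by (simp add: openin_S)
qed

lemma X_cases:
  assumes "p \<in> X"
  obtains (interior) c d w where "d \<in> D" "norm w < 1" "p = disc c d w"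
    | (edge) d t where "d \<in> D" "0 < t" "t < 1" "p = pt d t 0"
    | (vertex) x where "x < v" "p = vert x"
proof -
  obtain c d w where p: "d \<in> D" "norm w \<le> 1" "p = disc c d w"
    using assms by (auto simp: X_def)
  show ?thesis
  proof (cases "norm w < 1")
    case True
    then show ?thesis using p interior by blast
  next
    case False
    then have "w \<noteq> 0" by auto
    then obtain u where w: "w = turn (len c d) u" using turn_len_surj by blast
    then have "Im u = 0"
      using False p(2) norm_turn_le_1[OF len_pos, of c d u] norm_turn_less_1[OF len_pos, of c d u] by simp
    then have "p = (if frac (Re u) = 0 then vert (fst (dart c d \<lfloor>Re u\<rfloor>)) else pt (dart c d \<lfloor>Re u\<rfloor>) (frac (Re u)) 0)"
      by (simp add: p(3) w disc_turn lam_def)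
    moreover have e: "dart c d \<lfloor>Re u\<rfloor> \<in> D" using p(1) by simp
    moreover have "0 \<le> frac (Re u)" "frac (Re u) < 1" by (simp_all add: frac_lt_1)
    ultimately show ?thesis
      using edge[OF e, of "frac (Re u)"] vertex[OF fst_less[OF e]]
      by (cases "frac (Re u) = 0") auto
  qed
qed

lemma parametrization_disc:
  assumes d: "d \<in> D"
  shows "parametrization S (ball 0 1) (disc c d)"
  unfolding parametrization_def
proof (intro conjI allI impI)
  show "inj_on (disc c d) (ball 0 1)"
  proof (rule inj_onI)
    fix w w' assume "w \<in> ball 0 1" "w' \<in> ball 0 1" "disc c d w = disc c d w'"
    then obtain j where j: "d = dart c d j" "w = w' * turn (len c d) (of_int j)"
      using disc_eqD(2)[of c d w c d w'] by auto
    have "int (len c d) dvd j" using j(1) dart_eq_self_iff by metis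
    then obtain k where k: "j = int (len c d) * k" by blast
    have "turn (len c d) (of_int j) = turn (len c d) 0"
      unfolding turn_eq_iff[OF len_pos] k by (intro exI[of _ k]) simp
    then show "w = w'" using j(2) by (simp add: turn_def)
  qed
  show "continuous_map (top_of_set (ball 0 1)) S (disc c d)"
    by (rule continuous_map_from_subtopology_mono[OF continuous_map_disc[OF d] ball_subset_cball])
  fix V :: "complex set" assume V: "V \<subseteq> ball 0 1" "open V"
  show "openin S (disc c d ` V)"
    unfolding openin_S
  proof (intro conjI allI ballI)
    show "disc c d ` V \<subseteq> X" using V d by (auto intro!: disc_in_X)
    fix c' d' assume "d' \<in> D"
    \<comment> \<open>In another disc the set reappears as rotated copies of \<open>V\<close> if
      that disc belongs to the same face, and not at all otherwise.\<close>
    have "{w \<in> cball 0 1. disc c' d' w \<in> disc c d ` V} =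
        (\<Union>j\<in>{j. c' = c \<and> d' = dart c d j}. (\<lambda>w. w * turn (len c d) (of_int j)) -` V)"
    proof (intro set_eqI iffI)
      fix w assume w: "w \<in> {w \<in> cball 0 1. disc c' d' w \<in> disc c d ` V}"
      then obtain z where z: "z \<in> V" "disc c d z = disc c' d' w" by auto
      then have "norm z < 1" "norm w \<le> 1" using V w by auto
      then show "w \<in> (\<Union>j\<in>{j. c' = c \<and> d' = dart c d j}. (\<lambda>w. w * turn (len c d) (of_int j)) -` V)"
        using disc_eqD[OF z(2)] z(1) by auto
    next
      fix w assume "w \<in> (\<Union>j\<in>{j. c' = c \<and> d' = dart c d j}. (\<lambda>w. w * turn (len c d) (of_int j)) -` V)"
      then obtain j where j: "c' = c" "d' = dart c d j" "w * turn (len c d) (of_int j) \<in> V" by auto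
      then have "norm (w * turn (len c d) (of_int j)) < 1" using V by auto
      then have "norm w \<le> 1" by (simp add: norm_mult)
      then show "w \<in> {w \<in> cball 0 1. disc c' d' w \<in> disc c d ` V}"
        using j by (auto simp: disc_dart)
    qed
    moreover have "open (\<Union>j\<in>{j. c' = c \<and> d' = dart c d j}. (\<lambda>w. w * turn (len c d) (of_int j)) -` V)"
      using V(2) by (intro open_UN ballI open_vimage continuous_intros)
    ultimately have "open {w \<in> cball 0 1. disc c' d' w \<in> disc c d ` V}" by simp
    then show "openin (top_of_set (cball 0 1)) {w \<in> cball 0 1. disc c' d' w \<in> disc c d ` V}"
      by (rule open_subset[rotated]) auto
  qed
qed simp

end

section \<open>Charts around edges and vertices\<close>

text \<open>Turns the white half-plane over, so that the black and the white face of an arc lie on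
  opposite sides of it. As an involution it also serves as its own inverse.\<close>

definition flip :: "bool \<Rightarrow> complex \<Rightarrow> complex" where
  "flip c u = (if c then u else cnj u)"

lemma flip_simps [simp]:
  "Re (flip c u) = Re u" "Im (flip c u) = sg c * Im u" "norm (flip c u) = norm u" "flip c (flip c u) = u"
  "flip c u = 0 \<longleftrightarrow> u = 0"
  by (auto simp: flip_def)

lemma sg_sq [simp]: "sg c * (sg c * s) = s"
  by (simp add: sg_def)

lemma flip_eq_iff [simp]: "flip c u = flip c u' \<longleftrightarrow> u = u'"
  by (simp add: flip_def)

lemma continuous_on_flip [continuous_intros]: "continuous_on A f \<Longrightarrow> continuous_on A (\<lambda>x. flip c (f x))"
  by (cases c) (auto simp: flip_def intro: continuous_intros)

text \<open>The argument of a point of the closed upper half-plane in full turns. The rotation by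
  \<open>-\<i>\<close> keeps it away from the branch cut of \<^const>\<open>Arg\<close>.\<close>

definition turns :: "complex \<Rightarrow> real" where
  "turns u = 1 / 4 + Arg (- \<i> * u) / (2 * pi)"

lemma exp_turns: "of_real (norm u) * exp (2 * of_real pi * \<i> * of_real (turns u)) = u"
proof -
  have "2 * of_real pi * \<i> * of_real (turns u) = of_real pi / 2 * \<i> + \<i> * of_real (Arg (- \<i> * u))"
    by (simp add: turns_def field_simps)
  then have "exp (2 * of_real pi * \<i> * of_real (turns u)) = \<i> * cis (Arg (- \<i> * u))"
    by (simp add: exp_add cis_conv_exp) (simp add: exp_eq_polar complex_eq_iff flip: cis_conv_exp)
  moreover have "of_real (norm u) * cis (Arg (- \<i> * u)) = - \<i> * u"
    using rcis_cmod_Arg[of "- \<i> * u"] by (simp add: rcis_def norm_mult)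
  ultimately have "of_real (norm u) * exp (2 * of_real pi * \<i> * of_real (turns u)) = \<i> * (- \<i> * u)"
    by (metis mult.left_commute)
  then show ?thesis by simp
qed

lemma turns_positive: "Im u = 0 \<Longrightarrow> 0 < Re u \<Longrightarrow> turns u = 0"
proof -
  assume u: "Im u = 0" "0 < Re u"
  have "Arg (- \<i> * u) = - pi / 2"
  proof (rule cis_Arg_unique)
    show "sgn (- \<i> * u) = cis (- pi / 2)" using u by (simp add: complex_eq_iff sgn_eq cmod_def)
    show "- pi < - pi / 2" "- pi / 2 \<le> pi" using pi_gt_zero by linarith+
  qed
  then show ?thesis by (simp add: turns_def)
qed

lemma turns_negative: "Im u = 0 \<Longrightarrow> Re u < 0 \<Longrightarrow> turns u = 1 / 2"
proof -
  assume u: "Im u = 0" "Re u < 0"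
  have "Arg (- \<i> * u) = pi / 2"
  proof (rule cis_Arg_unique)
    show "sgn (- \<i> * u) = cis (pi / 2)" using u by (simp add: complex_eq_iff sgn_eq cmod_def)
    show "- pi < pi / 2" "pi / 2 \<le> pi" using pi_gt_zero by linarith+
  qed
  then show ?thesis by (simp add: turns_def)
qed

lemma continuous_on_turns: "continuous_on (upper - {0}) turns"
proof -
  have "continuous_on (upper - {0}) (\<lambda>u. Arg (- \<i> * u))"
    unfolding continuous_on_eq_continuous_within
  proof
    fix u assume u: "u \<in> upper - {0}"
    \<comment> \<open>The real part of \<open>- \<i> * u\<close> is \<open>Im u\<close>, which is
      nonnegative, so the branch cut could be met only at \<open>u = 0\<close>.\<close>
    have "- \<i> * u \<notin> \<real>\<^sub>\<le>\<^sub>0"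
      using u by (auto simp: complex_nonpos_Reals_iff complex_eq_iff)
    then have "continuous (at (- \<i> * u) within (*) (- \<i>) ` (upper - {0})) Arg"
      by (rule continuous_within_Arg)
    then show "continuous (at u within upper - {0}) (\<lambda>u. Arg (- \<i> * u))"
      by (intro continuous_within_compose2[of u _ "\<lambda>u. - \<i> * u" Arg] continuous_intros)
  qed
  then show ?thesis
    unfolding turns_def by (intro continuous_on_add continuous_on_const continuous_on_divide) auto
qed

text \<open>The branches of the \<open>n\<close>-th root of \<open>flip c u\<close> which place \<open>2 n\<close> half-discs around \<open>0\<close>: from the
  ray with number \<open>k\<close> the black one extends counterclockwise and the white one clockwise.\<close>

definition sector :: "nat \<Rightarrow> bool \<Rightarrow> nat \<Rightarrow> complex \<Rightarrow> complex" where
  "sector n c k u = of_real (root n (norm u)) * turn n (of_real (real k + sg c * turns u))"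

lemma sector_eq_0_iff [simp]: "0 < n \<Longrightarrow> sector n c k u = 0 \<longleftrightarrow> u = 0"
  by (simp add: sector_def)

lemma norm_sector: "norm (sector n c k u) = root n (norm u)"
  by (simp add: sector_def norm_mult norm_turn real_root_ge_zero)

lemma sector_power:
  assumes "0 < n"
  shows "sector n c k u ^ n = flip c u"
proof -
  have p: "complex_of_real (root n (norm u)) ^ n = of_real (norm u)"
    using assms by (metis norm_ge_zero of_real_power real_root_pow_pos2)
  have "exp (2 * of_real pi * \<i> * of_real (real k + sg c * turns u))
      = exp (2 * of_real pi * \<i> * of_real (sg c * turns u))"
    unfolding exp_eq by (intro exI[of _ "int k"]) (simp add: algebra_simps)
  then have "sector n c k u ^ n = of_real (norm u) * exp (2 * of_real pi * \<i> * of_real (sg c * turns u))"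
    using assms by (simp add: sector_def power_mult_distrib turn_power p)
  also have "\<dots> = flip c u"
  proof (cases c)
    case True
    then show ?thesis using exp_turns[of u] by (simp add: flip_def)
  next
    case False
    have "cnj (of_real (norm u) * exp (2 * of_real pi * \<i> * of_real (turns u))) = cnj u"
      by (simp only: exp_turns)
    then show ?thesis using False by (simp add: flip_def exp_cnj)
  qed
  finally show ?thesis .
qed

text \<open>The sign of the imaginary part of the \<open>n\<close>-th power decides the colour. The
  root of unity by which \<open>\<zeta>\<close> differs from the branch on ray 0 gives the number of
  the ray.\<close>

lemma sector_surj:
  assumes n: "0 < n"
  obtains c k u where "k < n" "u \<in> upper" "\<zeta> = sector n c k u"
proof -
  define c where "c = (0 \<le> Im (\<zeta> ^ n))"
  define u where "u = flip c (\<zeta> ^ n)"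
  have u: "u \<in> upper" by (auto simp: u_def c_def sg_def)
  show ?thesis
  proof (cases "\<zeta> = 0")
    case True
    then show ?thesis using that[of 0 0 c] n by simp
  next
    case False
    define \<xi> where "\<xi> = sector n c 0 u"
    have "u \<noteq> 0" using False by (simp add: u_def)
    then have "\<xi> \<noteq> 0" using n by (simp add: \<xi>_def)
    have "\<xi> ^ n = \<zeta> ^ n" by (simp add: \<xi>_def sector_power[OF n] u_def)
    then have "(\<zeta> / \<xi>) ^ n = 1" using False by (simp add: power_divide)
    then obtain k where k: "k < n" "\<zeta> / \<xi> = cis (2 * pi * real k / real n)"
      using Complex.bij_betw_roots_unity[OF n] by (auto simp: bij_betw_def)
    have "turn n (of_real (real k)) = cis (2 * pi * real k / real n)"
      by (simp add: turn_def cis_conv_exp mult_ac)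
    moreover have "\<zeta> = \<xi> * (\<zeta> / \<xi>)" using \<open>\<xi> \<noteq> 0\<close> by simp
    ultimately have "\<zeta> = \<xi> * turn n (of_real (real k))" using k by simp
    then have "\<zeta> = sector n c k u"
      by (simp add: \<xi>_def sector_def turn_add)
    then show ?thesis using that k u by blast
  qed
qed

text \<open>In units of an \<open>n\<close>-th of a full turn, the black half-disc \<open>k\<close>
  covers the angles from \<open>k\<close> to \<open>k + 1/2\<close> and the white one those from
  \<open>k - 1/2\<close> to \<open>k\<close>. Apart from the origin, different half-discs can share
  only the ray at \<open>k\<close> (positive real \<open>u\<close>), where both colours have the
  same number, or the ray at \<open>k + 1/2\<close> (negative real \<open>u\<close>), where black
  \<open>k\<close> meets white \<open>k + 1\<close>.\<close>

lemma sector_eqD: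
  assumes n: "0 < n" and k: "k < n" "k' < n" and u: "u \<in> upper" "u' \<in> upper"
    and eq: "sector n c k u = sector n c' k' u'"
  shows "u = 0 \<and> u' = 0 \<or> 
         c = c' \<and> k = k' \<and> u = u' \<or> 
         Im u = 0 \<and> u = u' \<and> 0 < Re u \<and> k = k' \<or> 
         Im u = 0 \<and> u = u' \<and> Re u < 0 \<and> c \<and> \<not> c' \<and> k' = Suc k mod n \<or>
         Im u = 0 \<and> u = u' \<and> Re u < 0 \<and> c' \<and> \<not> c \<and> k = Suc k' mod n"
proof (cases "u = 0")
  case True
  then show ?thesis using eq n by (metis sector_eq_0_iff)
next
  case False
  have "sector n c k u ^ n = sector n c' k' u' ^ n" using eq by simp
  then have fl: "flip c u = flip c' u'" by (simp add: sector_power[OF n])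
  then have nu: "norm u = norm u'" by (metis flip_simps(3))
  then have "turn n (of_real (real k + sg c * turns u)) = turn n (of_real (real k' + sg c' * turns u'))"
    using eq False n nu by (auto simp: sector_def)
  then obtain m where "complex_of_real (real k + sg c * turns u) = of_real (real k' + sg c' * turns u') + of_int (int n * m)"
    using turn_eq_iff[OF n] by blast
  then have "complex_of_real (real k + sg c * turns u) = of_real (real k' + sg c' * turns u' + real n * of_int m)"
    by simp
  then have m: "real k + sg c * turns u = real k' + sg c' * turns u' + real n * of_int m"
    by (simp only: of_real_eq_iff)
  have re: "Re u = Re u'" "sg c * Im u = sg c' * Im u'" using arg_cong[OF fl, of Re] arg_cong[OF fl, of Im] by simp_all
  have same: "k = k'" if "real k = real k' + real n * of_int m"
  proof -
    have "real_of_int (int k) = real_of_int (int k' + int n * m)" using that by simp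
    then have "int k = int k' + int n * m" by (simp only: of_int_eq_iff)
    then have "int k mod int n = int k' mod int n" by simp
    then show ?thesis using k by simp
  qed
  have next_k: "b = Suc a mod n" if "a < n" "b < n" "real b = real a + 1 + real n * of_int l" for a b :: nat and l
  proof -
    have "real_of_int (int b) = real_of_int (int a + 1 + int n * l)" using that(3) by simp
    then have "int b = int a + 1 + int n * l" by (simp only: of_int_eq_iff)
    then have "int b mod int n = int (Suc a) mod int n" by (simp add: add.commute)
    then have "int (b mod n) = int (Suc a mod n)" by (simp add: zmod_int)
    then show ?thesis using that(2) by simp
  qed
  show ?thesis
  proof (cases "Im u = 0")
    case False
    then have "0 < Im u" "0 \<le> Im u'" using u by auto
    then have cc: "c = c'" "Im u = Im u'" using sg_mult_eq re(2) by blast+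
    then have "u = u'" using re by (simp add: complex_eq_iff)
    then show ?thesis using m cc same by simp
  next
    case True
    then have uu: "u = u'" using re by (auto simp: complex_eq_iff sg_def split: if_splits)
    have "Re u \<noteq> 0" using True False by (simp add: complex_eq_iff)
    then consider "0 < Re u" | "Re u < 0" by linarith
    then show ?thesis
    proof cases
      case 1
      then show ?thesis using m True uu same turns_positive[of u] by auto
    next
      case 2
      then have t: "turns u = 1 / 2" "turns u' = 1 / 2" using True uu turns_negative by auto
      show ?thesis
      proof (cases "c = c'")
        case True
        then show ?thesis using m t same uu by simp
      next
        case neq: False
        show ?thesis
        proof (cases c)
          case c: True
          have "k' = Suc k mod n"
            using m t neq c k by (intro next_k[of k k' "- m"]) auto
          then show ?thesis using True 2 uu neq c by simp
        next
          case c: False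
          have "k = Suc k' mod n"
            using m t neq c k by (intro next_k[of k' k m]) auto
          then show ?thesis using True 2 uu neq c by simp
        qed
      qed
    qed
  qed
qed

lemma sector_positive: "Im u = 0 \<Longrightarrow> 0 < Re u \<Longrightarrow> sector n c k u = sector n c' k u"
  by (simp add: sector_def turns_positive)

lemma sector_negative:
  assumes "0 < n" "k < n" "Im u = 0" "Re u < 0"
  shows "sector n True k u = sector n False (Suc k mod n) u"
proof -
  obtain l :: int where l: "int (Suc k) = int (Suc k mod n) + int n * l"
    by (metis mod_mult_div_eq of_nat_add of_nat_mult)
  then have "real (Suc k) = real (Suc k mod n) + real n * of_int l"
    by (metis of_int_add of_int_mult of_int_of_nat_eq)
  then have "complex_of_real (real k + 1 / 2) = complex_of_real (real (Suc k mod n) - 1 / 2 + real n * of_int l)"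
    by (simp only: of_real_eq_iff)
  then have "turn n (of_real (real k + 1 / 2)) = turn n (of_real (real (Suc k mod n) - 1 / 2))"
    unfolding turn_eq_iff[OF assms(1)] by (intro exI[of _ l]) simp
  then show ?thesis using assms by (simp add: sector_def turns_negative)
qed

text \<open>The angle has no limit at 0, but the modulus alone forces the limit 0 there.\<close>

lemma continuous_on_sector:
  assumes n: "0 < n"
  shows "continuous_on upper (sector n c k)"
  unfolding continuous_on_eq_continuous_within
proof
  fix u assume u: "u \<in> upper"
  show "continuous (at u within upper) (sector n c k)"
  proof (cases "u = 0")
    case True
    have "((\<lambda>u. root n (norm u)) \<longlongrightarrow> root n (norm (0::complex))) (at 0 within upper)"
      by (intro tendsto_intros)
    then have "((\<lambda>u. norm (sector n c k u)) \<longlongrightarrow> 0) (at 0 within upper)"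
      by (simp add: norm_sector)
    then have "(sector n c k \<longlongrightarrow> 0) (at 0 within upper)"
      by (rule tendsto_norm_zero_cancel)
    moreover have "sector n c k 0 = 0" using n by simp
    ultimately show ?thesis unfolding True continuous_within by simp
  next
    case False
    have "continuous_on (upper - {0}) (sector n c k)"
      unfolding sector_def turn_def
      by (intro continuous_intros continuous_on_turns) (use n in auto)
    then have "continuous (at u within upper - {0}) (sector n c k)"
      using u False by (simp add: continuous_on_eq_continuous_within)
    moreover have "at u within upper - {0} = at u within upper"
      using False by (intro at_within_nhd[of u "- {0}"]) auto
    ultimately show ?thesis by (metis)
  qed
qed

context rotation_system
begin

section \<open>Charts across the arcs\<close>

definition edge :: "nat \<times> nat \<Rightarrow> complex \<Rightarrow> nat \<Rightarrow> real" where
  "edge d u = pt d (Re u) (Im u)"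

abbreviation strip :: "complex set" where
  "strip \<equiv> {u. 0 < Re u \<and> Re u < 1}"

lemma lam_strip: "u \<in> strip \<Longrightarrow> lam c d u = pt d (Re u) (sg c * Im u)"
  by (subst lam_unit) auto

lemma edge_eq_lam: "u \<in> strip \<Longrightarrow> edge d u = lam c d (flip c u)"
  by (simp add: lam_strip edge_def)

lemma edge_in_X: "d \<in> D \<Longrightarrow> u \<in> strip \<Longrightarrow> edge d u \<in> X"
proof -
  assume d: "d \<in> D" "u \<in> strip"
  define c where "c = (0 \<le> Im u)"
  have "0 \<le> Im (flip c u)" by (simp add: c_def sg_def)
  then show ?thesis using edge_eq_lam[OF d(2), of d c] lam_in_X d(1) by metis
qed

lemma open_strip: "open strip"
  by (intro open_Collect_conj open_Collect_less continuous_intros)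

text \<open>The upper half of the strip lies in the black disc at \<open>d\<close>, the lower half,
  reflected, in the white one. Continuity is pasted from these two closed halves, which agree on the
  real axis.\<close>

lemma parametrization_edge:
  assumes d: "d \<in> D"
  shows "parametrization S strip (edge d)"
  unfolding parametrization_def
proof (intro conjI allI impI)
  show "open strip" by (rule open_strip)
  show "inj_on (edge d) strip"
    by (auto simp: inj_on_def edge_def complex_eq_iff)
  show "continuous_map (top_of_set strip) S (edge d)"
  proof (rule pasting_lemma_closed[where I = UNIV and T = "\<lambda>c. strip \<inter> flip c -` upper"
        and f = "\<lambda>c u. lam c d (flip c u)"])
    show "closedin (top_of_set strip) (strip \<inter> flip c -` upper)" for c
      by (intro continuous_closedin_preimage continuous_on_flip continuous_intros closed_halfspace_Im_ge)
    show "continuous_map (subtopology (top_of_set strip) (strip \<inter> flip c -` upper)) S (\<lambda>u. lam c d (flip c u))" for c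
    proof -
      have "continuous_map (top_of_set (strip \<inter> flip c -` upper)) (top_of_set upper) (flip c)"
        by (auto intro!: continuous_on_flip continuous_intros)
      then have "continuous_map (top_of_set (strip \<inter> flip c -` upper)) S (lam c d \<circ> flip c)"
        using continuous_map_lam[OF d] continuous_map_compose by blast
      then show ?thesis by (simp add: o_def subtopology_subtopology Int_absorb1)
    qed
    show "\<exists>c. c \<in> UNIV \<and> u \<in> strip \<inter> flip c -` upper \<and> edge d u = lam c d (flip c u)"
      if "u \<in> topspace (top_of_set strip)" for u
      using that edge_eq_lam[of u d "0 \<le> Im u"] by (intro exI[of _ "0 \<le> Im u"]) (auto simp: sg_def)
    show "lam c d (flip c u) = lam c' d (flip c' u)"
      if "u \<in> topspace (top_of_set strip) \<inter> (strip \<inter> flip c -` upper) \<inter> (strip \<inter> flip c' -` upper)" for c c' u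
      using that edge_eq_lam[of u d c] edge_eq_lam[of u d c'] by simp
  qed simp_all
  fix V assume V: "V \<subseteq> strip" "open V"
  show "openin S (edge d ` V)"
  proof (rule openin_S_lam)
    show "edge d ` V \<subseteq> X" using V(1) edge_in_X[OF d] by blast
    show "ctr c e \<notin> edge d ` V" for c e by (auto simp: edge_def)
    fix c e assume "e \<in> D"
    \<comment> \<open>The face meets the chart wherever it runs through \<open>d\<close>, which
      gives one translate of \<open>V\<close> for each position \<open>j\<close> of \<open>d\<close>
      along it.\<close>
    have "{u \<in> upper. lam c e u \<in> edge d ` V} = upper \<inter> (\<Union>j\<in>{j. dart c e j = d}. (\<lambda>u. flip c (u - of_int j)) -` V)"
    proof (intro set_eqI iffI)
      fix u assume u: "u \<in> {u \<in> upper. lam c e u \<in> edge d ` V}"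
      then obtain z where z: "z \<in> V" "lam c e u = pt d (Re z) (Im z)" by (auto simp: edge_def)
      then have "dart c e \<lfloor>Re u\<rfloor> = d" "frac (Re u) = Re z" "sg c * Im u = Im z"
        by (auto simp: lam_def split: if_splits)
      moreover from this have "flip c (u - of_int \<lfloor>Re u\<rfloor>) = z"
        by (simp add: complex_eq_iff frac_def)
      ultimately show "u \<in> upper \<inter> (\<Union>j\<in>{j. dart c e j = d}. (\<lambda>u. flip c (u - of_int j)) -` V)"
        using u z by auto
    next
      fix u assume "u \<in> upper \<inter> (\<Union>j\<in>{j. dart c e j = d}. (\<lambda>u. flip c (u - of_int j)) -` V)"
      then obtain j where j: "u \<in> upper" "dart c e j = d" "flip c (u - of_int j) \<in> V" by auto
      have "lam c e u = lam c d (u - of_int j)" using lam_diff_of_int[of c e j u] j(2) by simp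
      also have "\<dots> = edge d (flip c (u - of_int j))"
        using V(1) j(3) by (subst edge_eq_lam[of _ _ c]) auto
      finally show "u \<in> {u \<in> upper. lam c e u \<in> edge d ` V}" using j by auto
    qed
    moreover have "open (\<Union>j\<in>{j. dart c e j = d}. (\<lambda>u. flip c (u - of_int j)) -` V)"
      using V(2) by (intro open_UN ballI open_vimage continuous_on_flip continuous_intros)
    ultimately show "openin (top_of_set upper) {u \<in> upper. lam c e u \<in> edge d ` V}"
      by (simp add: openin_open_Int)
  qed
qed

section \<open>Charts at the vertices\<close>

lemma rot_in: "x < v \<Longrightarrow> k < N \<Longrightarrow> rot x k \<in> D \<and> fst (rot x k) = x"
  using rot_bij[of x] by (auto simp: bij_betw_def)

lemma rot_inj: "x < v \<Longrightarrow> k < N \<Longrightarrow> k' < N \<Longrightarrow> rot x k = rot x k' \<longleftrightarrow> k = k'"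
  using rot_bij[of x] by (auto simp: bij_betw_def inj_on_def)

lemma rot_surj: "d \<in> D \<Longrightarrow> \<exists>k<N. d = rot (fst d) k"
  using rot_bij[OF fst_less[of d]] by (auto simp: bij_betw_def)

lemma dart_rot: "x < v \<Longrightarrow> k < N \<Longrightarrow> dart False (rot x (Suc k mod N)) (- 1) = dart True (rot x k) (- 1)"
  by (simp add: dart_minus_one rot_T)

lemma small_Re: "norm u < 1 / 2 \<Longrightarrow> - (1 / 2) < Re u \<and> Re u < 1 / 2"
  using abs_Re_le_cmod[of u] by linarith

text \<open>The radius 1/2 keeps the beginning of an arc (position below 1/2) apart from its end
  (position above 1/2). To the left of 0 the point lies over the preceding arc, whence
  \<open>1 + Re u\<close>.\<close>

lemma lam_small:
  assumes "norm u < 1 / 2"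
  shows "lam c d u = (if u = 0 then vert (fst d)
     else if 0 \<le> Re u then pt d (Re u) (sg c * Im u) else pt (dart c d (- 1)) (1 + Re u) (sg c * Im u))"
  using small_Re[OF assms] lam_unit[of u c d] lam_negative[of u c d] by auto

text \<open>This makes \<open>star\<close> well defined. On a ray shared by black \<open>k\<close>
  and white \<open>k + 1\<close> both half-discs must border the same incoming arc, which is what
  \<open>rot_T\<close> provides.\<close>

lemma lam_eq_if_sector_eq:
  assumes x: "x < v" and k: "k < N" "k' < N" and u: "u \<in> upper" "u' \<in> upper"
    and small: "norm u < 1 / 2" "norm u' < 1 / 2"
    and eq: "sector N c k u = sector N c' k' u'"
  shows "lam c (rot x k) u = lam c' (rot x k') u'"
  using sector_eqD[OF N_pos k u eq]
proof (elim disjE conjE)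
  assume "u = 0" "u' = 0"
  then show ?thesis using rot_in[OF x k(1)] rot_in[OF x k(2)] by (simp add: lam_small)
next
  assume "Im u = 0" "u = u'" "0 < Re u" "k = k'"
  then show ?thesis using small by (auto simp: lam_small)
next
  assume "Im u = 0" "u = u'" "Re u < 0" "c" "\<not> c'" "k' = Suc k mod N"
  then show ?thesis using small dart_rot[OF x k(1)] by (auto simp: lam_small)
next
  assume "Im u = 0" "u = u'" "Re u < 0" "c'" "\<not> c" "k = Suc k' mod N"
  then show ?thesis using small dart_rot[OF x k(2)] by (auto simp: lam_small)
qed simp

text \<open>This makes \<open>star\<close> injective. Off the boundary \<open>lam_eqD\<close> leaves
  no freedom. On it, equal outgoing arcs have equal numbers, and equal incoming arcs are related by
  \<open>dart_rot\<close>, so the two half-discs share the corresponding ray.\<close>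

lemma sector_eq_if_lam_eq:
  assumes x: "x < v" and k: "k < N" "k' < N" and u: "u \<in> upper" "u' \<in> upper"
    and small: "norm u < 1 / 2" "norm u' < 1 / 2"
    and eq: "lam c (rot x k) u = lam c' (rot x k') u'"
  shows "sector N c k u = sector N c' k' u'"
proof -
  have int: "sector N c k u = sector N c' k' u'"
    if a: "k < N" "k' < N" "0 < Im u" "0 \<le> Im u'" "norm u < 1 / 2" "norm u' < 1 / 2"
      "lam c (rot x k) u = lam c' (rot x k') u'" for c k u c' k' u'
  proof -
    have "c' = c" "\<exists>j. rot x k' = dart c (rot x k) j \<and> u = u' + of_int j"
      using lam_eqD[OF a(7) a(3,4)] by auto
    then obtain j where j: "rot x k' = dart c (rot x k) j" "u = u' + of_int j" by blast
    \<comment> \<open>Both real parts are below 1/2 in absolute value, so their integer difference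
      must vanish.\<close>
    have "\<bar>real_of_int j\<bar> < 1" using small_Re[OF a(5)] small_Re[OF a(6)] j(2) by auto
    then have "j = 0" by linarith
    then show ?thesis using j \<open>c' = c\<close> rot_inj[OF x a(1,2)] by simp
  qed
  consider "0 < Im u" | "0 < Im u'" | "Im u = 0" "Im u' = 0" using u by fastforce
  then show ?thesis
  proof cases
    case 1 then show ?thesis using int[OF k 1 _ small eq] u by simp
  next
    case 2 then show ?thesis using int[OF k(2,1) 2 _ small(2,1) eq[symmetric]] u by simp
  next
    case 3
    note im0 = 3
    have 0: "u = 0 \<longleftrightarrow> u' = 0" using eq small by (auto simp: lam_small split: if_splits)
    show ?thesis
    proof (cases "u = 0")
      case True
      then show ?thesis using 0 N_pos by (metis sector_eq_0_iff)
    next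
      case False
      then have nz: "u \<noteq> 0" "u' \<noteq> 0" using 0 by auto
      then have r: "Re u \<noteq> 0" "Re u' \<noteq> 0" using 3 by (auto simp: complex_eq_iff)
      have same_sign: "0 < Re u \<longleftrightarrow> 0 < Re u'"
        using eq r nz small_Re[OF small(1)] small_Re[OF small(2)] small by (auto simp: lam_small split: if_splits)
      show ?thesis
      proof (cases "0 < Re u")
        case True
        then have "rot x k = rot x k'" "Re u = Re u'"
          using eq nz same_sign small by (auto simp: lam_small)
        then show ?thesis using sector_positive True 3 rot_inj[OF x k] by (simp add: complex_eq_iff) (metis complex_eq_iff)
      next
        case False
        then have neg: "Re u < 0" "Re u' < 0" using r same_sign by auto
        then have d: "dart c (rot x k) (- 1) = dart c' (rot x k') (- 1)" "Re u = Re u'"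
          using eq nz small by (auto simp: lam_small)
        then have uu: "u = u'" using 3 by (simp add: complex_eq_iff)
        have inj: "rot x a = rot x b" if "dart c (rot x a) (- 1) = dart c (rot x b) (- 1)" for c a b
          using that dart_cancel[of c "rot x a" "- 1" "rot x b" "- 1"] by simp
        have wrap: "Suc a mod N < N" for a using N_pos by simp
        consider "c = c'" | "c" "\<not> c'" | "\<not> c" "c'" by blast
        then show ?thesis
        proof cases
          case 1 then show ?thesis using d inj[of c k k'] rot_inj[OF x k] uu by auto
        next
          case 2
          then have "dart False (rot x (Suc k mod N)) (- 1) = dart False (rot x k') (- 1)"
            using d dart_rot[OF x k(1)] by simp
          then have "k' = Suc k mod N" using inj[of False "Suc k mod N" k'] rot_inj[OF x wrap k(2), of k] by simp
          then show ?thesis using sector_negative[OF N_pos k(1) im0(1) neg(1)] 2 uu by simp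
        next
          case 3
          then have "dart False (rot x (Suc k' mod N)) (- 1) = dart False (rot x k) (- 1)"
            using d dart_rot[OF x k(2)] by simp
          then have "k = Suc k' mod N" using inj[of False "Suc k' mod N" k] rot_inj[OF x wrap k(1), of k'] by simp
          then show ?thesis using sector_negative[OF N_pos k(2) im0(2) neg(2)] 3 uu by simp
        qed
      qed
    qed
  qed
qed

text \<open>A point on a ray belongs to more than one half-disc, and the origin to all of them;
  hence a choice, which \<open>star_sector\<close> shows to be immaterial.\<close>

definition star :: "nat \<Rightarrow> complex \<Rightarrow> nat \<Rightarrow> real" where
  "star x \<zeta> = (SOME p. \<exists>c k u. k < N \<and> u \<in> upper \<and> norm u < 1 / 2 \<and> \<zeta> = sector N c k u \<and>
     p = lam c (rot x k) u)"

lemma star_sector: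
  assumes "x < v" "k < N" "u \<in> upper" "norm u < 1 / 2"
  shows "star x (sector N c k u) = lam c (rot x k) u"
  unfolding star_def
proof (rule some_equality)
  fix p assume "\<exists>c' k' u'. k' < N \<and> u' \<in> upper \<and> norm u' < 1 / 2 \<and> sector N c k u = sector N c' k' u' \<and>
     p = lam c' (rot x k') u'"
  then show "p = lam c (rot x k) u"
    using lam_eq_if_sector_eq[OF assms(1)] assms by metis
qed (use assms in blast)

abbreviation star_dom :: "complex set" where
  "star_dom \<equiv> {\<zeta>. norm \<zeta> ^ N < 1 / 2}"

lemma sector_in_star_dom: "sector N c k u \<in> star_dom \<longleftrightarrow> norm u < 1 / 2"
proof -
  have "norm (sector N c k u) ^ N = norm u"
    using sector_power[OF N_pos, of c k u] by (metis flip_simps(3) norm_power)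
  then show ?thesis by simp
qed

lemma star_dom_cases:
  assumes "\<zeta> \<in> star_dom"
  obtains c k u where "k < N" "u \<in> upper" "norm u < 1 / 2" "\<zeta> = sector N c k u"
  using sector_surj[OF N_pos, of \<zeta>] assms sector_in_star_dom by metis

lemma open_star_dom: "open star_dom"
  by (intro open_Collect_less continuous_intros)

lemma star_in_X: "x < v \<Longrightarrow> \<zeta> \<in> star_dom \<Longrightarrow> star x \<zeta> \<in> X"
  by (erule star_dom_cases) (use lam_in_X rot_in star_sector in auto)

lemma inj_star: "x < v \<Longrightarrow> inj_on (star x) star_dom"
proof (rule inj_onI)
  fix \<zeta> \<zeta>' assume x: "x < v" and z: "\<zeta> \<in> star_dom" "\<zeta>' \<in> star_dom" "star x \<zeta> = star x \<zeta>'"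
  obtain c k u where 1: "k < N" "u \<in> upper" "norm u < 1 / 2" "\<zeta> = sector N c k u"
    using z(1) by (rule star_dom_cases)
  obtain c' k' u' where 2: "k' < N" "u' \<in> upper" "norm u' < 1 / 2" "\<zeta>' = sector N c' k' u'"
    using z(2) by (rule star_dom_cases)
  have "lam c (rot x k) u = lam c' (rot x k') u'"
    using z(3) 1 2 star_sector x by simp
  then show "\<zeta> = \<zeta>'"
    using sector_eq_if_lam_eq[OF x 1(1) 2(1) 1(2) 2(2) 1(3) 2(3)] 1(4) 2(4) by simp
qed

lemma continuous_map_star:
  assumes x: "x < v"
  shows "continuous_map (top_of_set star_dom) S (star x)"
proof -
  \<comment> \<open>The closed half-disc in position \<open>(c, k)\<close>, as the set where the
    branch \<open>sector N c k\<close> undoes the \<open>N\<close>-th power. In this form its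
    closedness follows from continuity, and the \<open>N\<close>-th power is the coordinate on
    it.\<close>
  define A where "A c k = {\<zeta> \<in> {\<zeta>. 0 \<le> Im (flip c (\<zeta> ^ N))}. sector N c k (flip c (\<zeta> ^ N)) - \<zeta> = 0}" for c k
  have A: "\<zeta> \<in> A c k \<longleftrightarrow> (\<exists>u\<in>upper. \<zeta> = sector N c k u)" for \<zeta> c k
  proof
    assume "\<exists>u\<in>upper. \<zeta> = sector N c k u"
    then show "\<zeta> \<in> A c k" by (auto simp: A_def sector_power[OF N_pos] simp del: flip_simps(2))
  qed (auto simp: A_def simp del: flip_simps(2) intro!: bexI[of _ "flip c (\<zeta> ^ N)"])
  have closedA: "closed (A c k)" for c k
  proof -
    have h: "closed {\<zeta>. 0 \<le> Im (flip c (\<zeta> ^ N))}"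
      by (intro closed_Collect_le continuous_intros continuous_on_flip)
    have "continuous_on {\<zeta>. 0 \<le> Im (flip c (\<zeta> ^ N))} (\<lambda>\<zeta>. sector N c k (flip c (\<zeta> ^ N)) - \<zeta>)"
      by (intro continuous_intros continuous_on_compose2[OF continuous_on_sector[OF N_pos]] continuous_on_flip) auto
    then show ?thesis unfolding A_def by (intro continuous_closed_preimage_constant h)
  qed
  show ?thesis
  proof (rule pasting_lemma_closed[where I = "UNIV \<times> {..<N}" and T = "\<lambda>(c, k). star_dom \<inter> A c k"
        and f = "\<lambda>(c, k) \<zeta>. lam c (rot x k) (flip c (\<zeta> ^ N))"])
    show "closedin (top_of_set star_dom) (case i of (c, k) \<Rightarrow> star_dom \<inter> A c k)" for i
      using closedA by (cases i) (auto intro: closedin_closed_Int)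
    show "continuous_map (subtopology (top_of_set star_dom) (case i of (c, k) \<Rightarrow> star_dom \<inter> A c k)) S
        (case i of (c, k) \<Rightarrow> \<lambda>\<zeta>. lam c (rot x k) (flip c (\<zeta> ^ N)))" if "i \<in> UNIV \<times> {..<N}" for i
    proof -
      obtain c k where "i = (c, k)" by (cases i)
      with that have i: "i = (c, k)" "k < N" by auto
      have "continuous_map (top_of_set (star_dom \<inter> A c k)) (top_of_set upper) (\<lambda>\<zeta>. flip c (\<zeta> ^ N))"
        by (auto simp: A_def simp del: flip_simps(2) intro!: continuous_on_flip continuous_intros)
      then have "continuous_map (top_of_set (star_dom \<inter> A c k)) S (lam c (rot x k) \<circ> (\<lambda>\<zeta>. flip c (\<zeta> ^ N)))"
        using continuous_map_lam rot_in[OF x i(2)] continuous_map_compose by blast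
      then show ?thesis by (simp add: i o_def subtopology_subtopology Int_absorb1)
    qed
    have val: "star x \<zeta> = lam c (rot x k) (flip c (\<zeta> ^ N))" if \<zeta>: "\<zeta> \<in> star_dom" "k < N" "\<zeta> \<in> A c k" for c k \<zeta>
    proof -
      obtain u where u: "u \<in> upper" "\<zeta> = sector N c k u" using \<zeta>(3) A by blast
      then have "norm u < 1 / 2" using \<zeta>(1) sector_in_star_dom by blast
      then show ?thesis using star_sector[OF x \<zeta>(2) u(1)] by (simp add: u(2) sector_power[OF N_pos])
    qed
    show "(case i of (c, k) \<Rightarrow> \<lambda>\<zeta>. lam c (rot x k) (flip c (\<zeta> ^ N))) \<zeta> = (case j of (c, k) \<Rightarrow> \<lambda>\<zeta>. lam c (rot x k) (flip c (\<zeta> ^ N))) \<zeta>"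
      if "i \<in> UNIV \<times> {..<N}" "j \<in> UNIV \<times> {..<N}"
        "\<zeta> \<in> topspace (top_of_set star_dom) \<inter> (case i of (c, k) \<Rightarrow> star_dom \<inter> A c k) \<inter> (case j of (c, k) \<Rightarrow> star_dom \<inter> A c k)"
      for i j \<zeta>
      using that val[of \<zeta> "snd i" "fst i"] val[of \<zeta> "snd j" "fst j"] by (cases i; cases j) auto
    show "\<exists>j. j \<in> UNIV \<times> {..<N} \<and> \<zeta> \<in> (case j of (c, k) \<Rightarrow> star_dom \<inter> A c k) \<and>
        star x \<zeta> = (case j of (c, k) \<Rightarrow> \<lambda>\<zeta>. lam c (rot x k) (flip c (\<zeta> ^ N))) \<zeta>"
      if "\<zeta> \<in> topspace (top_of_set star_dom)" for \<zeta>
    proof -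
      have z: "\<zeta> \<in> star_dom" using that by simp
      then obtain c k u where 1: "k < N" "u \<in> upper" "\<zeta> = sector N c k u" by (rule star_dom_cases)
      then have "\<zeta> \<in> A c k" using A by blast
      then show ?thesis using 1(1) z val[OF z 1(1)] by (intro exI[of _ "(c, k)"]) auto
    qed
  qed simp
qed

text \<open>A face may pass the vertex \<open>x\<close> several times. A point of the face that lies
  in the star of \<open>x\<close> is shown to be close to one of these passages, at position
  \<open>j\<close>, so that the comparison of half-discs at \<open>x\<close> applies.\<close>

lemma lam_eq_star_corner:
  assumes x: "x < v" and d: "d \<in> D" and u: "u \<in> upper" and k': "k' < N" and u': "u' \<in> upper" "norm u' < 1 / 2"
    and eq: "lam c d u = lam c' (rot x k') u'"
  obtains j k where "k < N" "dart c d j = rot x k" "norm (u - of_int j) < 1 / 2"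
    "lam c (rot x k) (u - of_int j) = lam c' (rot x k') u'"
proof -
  \<comment> \<open>Rounding to the nearest integer instead of downwards refers points shortly
    before a vertex to that vertex as well.\<close>
  define j where "j = \<lfloor>Re u + 1 / 2\<rfloor>"
  define w where "w = u - of_int j"
  define e where "e = dart c d j"
  have w: "- (1 / 2) \<le> Re w" "Re w < 1 / 2" "0 \<le> Im w"
    using u unfolding w_def j_def by (simp_all, linarith+)
  have e: "e \<in> D" using d by (simp add: e_def)
  have eq': "lam c e w = lam c' (rot x k') u'"
    using eq lam_diff_of_int[of c d j u] by (simp add: e_def w_def)
  have lw: "lam c e w = (if w = 0 then vert (fst e)
     else if 0 \<le> Re w then pt e (Re w) (sg c * Im w) else pt (dart c e (- 1)) (1 + Re w) (sg c * Im w))"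
    using w lam_unit[of w c e] lam_negative[of w c e] by auto
  note lu = lam_small[OF u'(2), of c' "rot x k'"]
  have r: "rot x k' \<in> D" "fst (rot x k') = x" using rot_in[OF x k'] by auto
  have su: "- (1 / 2) < Re u'" "Re u' < 1 / 2" using small_Re[OF u'(2)] by auto
  have "fst e = x \<and> norm w = norm u'"
  proof (cases "0 < Im u'")
    case True
    obtain i where i: "c = c'" "e = dart c' (rot x k') i" "u' = w + of_int i"
      using lam_eqD[OF eq'[symmetric] True w(3)] by auto
    have "\<bar>real_of_int i\<bar> < 1" using i(3) w su by auto
    then have "i = 0" by linarith
    then show ?thesis using i r by simp
  next
    case False
    then have im: "Im u' = 0" using u' by simp
    show ?thesis
    proof (cases "u' = 0")
      case True
      then show ?thesis using eq' lw lu r by (auto split: if_splits)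
    next
      case nz: False
      then have "w \<noteq> 0" using eq' lw lu by (auto split: if_splits)
      have "Im w = 0" using eq' lw lu nz im by (auto split: if_splits simp: sg_def)
      have sign: "0 \<le> Re w \<longleftrightarrow> 0 \<le> Re u'"
        using eq' lw lu nz \<open>w \<noteq> 0\<close> w su by (auto split: if_splits)
      have nw: "norm w = \<bar>Re w\<bar>" "norm u' = \<bar>Re u'\<bar>" using \<open>Im w = 0\<close> im by (simp_all add: cmod_def)
      show ?thesis
      proof (cases "0 \<le> Re w")
        case True
        then show ?thesis using eq' lw lu nz \<open>w \<noteq> 0\<close> sign r nw by auto
      next
        case False
        then have "dart c e (- 1) = dart c' (rot x k') (- 1)" "Re w = Re u'"
          using eq' lw lu nz \<open>w \<noteq> 0\<close> sign by auto
        then show ?thesis using snd_dart_minus_one[OF e, of c] snd_dart_minus_one[OF r(1), of c'] r nw by simp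
      qed
    qed
  qed
  moreover obtain k where "k < N" "e = rot (fst e) k" using rot_surj[OF e] by blast
  ultimately show ?thesis
    using that[of k j] eq' u'(2) by (auto simp: e_def w_def)
qed

lemma parametrization_star:
  assumes x: "x < v"
  shows "parametrization S star_dom (star x)"
  unfolding parametrization_def
proof (intro conjI allI impI open_star_dom inj_star continuous_map_star x)
  fix V assume V: "V \<subseteq> star_dom" "open V"
  have star_lam: "\<exists>c k u. k < N \<and> u \<in> upper \<and> norm u < 1 / 2 \<and> \<zeta> = sector N c k u \<and> star x \<zeta> = lam c (rot x k) u"
    if "\<zeta> \<in> V" for \<zeta>
    using star_dom_cases[of \<zeta>] that V(1) star_sector[OF x] by (metis subsetD)
  show "openin S (star x ` V)"
  proof (rule openin_S_lam)
    show "star x ` V \<subseteq> X" using V(1) star_in_X[OF x] by blast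
    show "ctr c e \<notin> star x ` V" for c e using star_lam by fastforce
    fix c d assume d: "d \<in> D"
    let ?B = "\<lambda>k j. {u \<in> upper. norm (u - of_int j) < 1 / 2 \<and> sector N c k (u - of_int j) \<in> V}"
    \<comment> \<open>One piece for every passage of the face through \<open>x\<close>: at position
      \<open>j\<close> it leaves \<open>x\<close> by the arc \<open>rot x k\<close>.\<close>
    have "{u \<in> upper. lam c d u \<in> star x ` V} = (\<Union>(k, j)\<in>{(k, j). k < N \<and> dart c d j = rot x k}. ?B k j)"
    proof (intro set_eqI iffI)
      fix u assume u: "u \<in> {u \<in> upper. lam c d u \<in> star x ` V}"
      then obtain \<zeta> where \<zeta>: "\<zeta> \<in> V" "lam c d u = star x \<zeta>" by blast
      obtain c' k' u' where 1: "k' < N" "u' \<in> upper" "norm u' < 1 / 2" "\<zeta> = sector N c' k' u'"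
        "star x \<zeta> = lam c' (rot x k') u'" using star_lam[OF \<zeta>(1)] by blast
      have "lam c d u = lam c' (rot x k') u'" "u \<in> upper" using 1 \<zeta> u by auto
      then obtain j k where jk: "k < N" "dart c d j = rot x k" "norm (u - of_int j) < 1 / 2"
          "lam c (rot x k) (u - of_int j) = lam c' (rot x k') u'"
        using lam_eq_star_corner[OF x d _ 1(1-3)] by metis
      have "u - of_int j \<in> upper" using u by simp
      then have "sector N c k (u - of_int j) = \<zeta>"
        using sector_eq_if_lam_eq[OF x jk(1) 1(1) _ 1(2) jk(3) 1(3) jk(4)] 1(4) by simp
      then have "u \<in> ?B k j" using jk u \<zeta>(1) by simp
      then show "u \<in> (\<Union>(k, j)\<in>{(k, j). k < N \<and> dart c d j = rot x k}. ?B k j)"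
        using jk by blast
    next
      fix u assume "u \<in> (\<Union>(k, j)\<in>{(k, j). k < N \<and> dart c d j = rot x k}. ?B k j)"
      then obtain k j where a: "k < N" "dart c d j = rot x k" "u \<in> upper" "norm (u - of_int j) < 1 / 2"
        "sector N c k (u - of_int j) \<in> V" by auto
      have "lam c d u = lam c (rot x k) (u - of_int j)" using lam_diff_of_int[of c d j u] a(2) by simp
      also have "\<dots> = star x (sector N c k (u - of_int j))"
        using star_sector[OF x a(1) _ a(4)] a(3) by simp
      finally show "u \<in> {u \<in> upper. lam c d u \<in> star x ` V}" using a by auto
    qed
    moreover have "openin (top_of_set upper) (?B k j)" for k j
    proof -
      have "continuous_on upper (\<lambda>u. sector N c k (u - of_int j))"
        by (intro continuous_on_compose2[OF continuous_on_sector[OF N_pos]] continuous_intros) auto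
      then have "openin (top_of_set upper) (upper \<inter> (\<lambda>u. sector N c k (u - of_int j)) -` V)"
        using V(2) by (rule continuous_openin_preimage_gen)
      moreover have "openin (top_of_set upper) (upper \<inter> {u. norm (u - of_int j) < 1 / 2})"
        by (intro openin_open_Int open_Collect_less continuous_intros)
      moreover have "?B k j = (upper \<inter> (\<lambda>u. sector N c k (u - of_int j)) -` V) \<inter> (upper \<inter> {u. norm (u - of_int j) < 1 / 2})"
        by auto
      ultimately show ?thesis by (metis (no_types, lifting) openin_Int)
    qed
    ultimately show "openin (top_of_set upper) {u \<in> upper. lam c d u \<in> star x ` V}"
      by (simp add: split_beta) (intro openin_Union; auto)
  qed
qed

end

section \<open>The surface is closed and orientable\<close>

definition separated_points :: "'a topology \<Rightarrow> 'a \<Rightarrow> 'a \<Rightarrow> bool" where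
  "separated_points X p q \<longleftrightarrow> (\<exists>U V. openin X U \<and> openin X V \<and> p \<in> U \<and> q \<in> V \<and> disjnt U V)"

lemma separated_pointsI:
  "openin X U \<Longrightarrow> openin X V \<Longrightarrow> p \<in> U \<Longrightarrow> q \<in> V \<Longrightarrow> U \<inter> V = {} \<Longrightarrow> separated_points X p q"
  unfolding separated_points_def disjnt_def by blast

lemma separated_points_sym: "separated_points X p q \<Longrightarrow> separated_points X q p"
  unfolding separated_points_def by (metis disjnt_sym)

lemma Hausdorff_space_separated_points:
  "Hausdorff_space X \<longleftrightarrow> (\<forall>p\<in>topspace X. \<forall>q\<in>topspace X. p \<noteq> q \<longrightarrow> separated_points X p q)"
  unfolding Hausdorff_space_def separated_points_def by blast

lemma separated_points_parametrization:
  assumes "parametrization X \<Omega> P" "p \<in> P ` \<Omega>" "q \<in> P ` \<Omega>" "p \<noteq> q"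
  shows "separated_points X p q"
proof -
  have P: "open \<Omega>" "inj_on P \<Omega>" "\<And>V. V \<subseteq> \<Omega> \<Longrightarrow> open V \<Longrightarrow> openin X (P ` V)"
    using assms(1) by (auto simp: parametrization_def)
  obtain a b where ab: "a \<in> \<Omega>" "b \<in> \<Omega>" "p = P a" "q = P b" using assms(2,3) by blast
  then have "a \<noteq> b" using assms(4) by auto
  then obtain U V where UV: "open U" "open V" "a \<in> U" "b \<in> V" "U \<inter> V = {}"
    using hausdorff by metis
  show ?thesis
  proof (rule separated_pointsI)
    show "openin X (P ` (\<Omega> \<inter> U))" "openin X (P ` (\<Omega> \<inter> V))"
      using P UV by auto
    show "P ` (\<Omega> \<inter> U) \<inter> P ` (\<Omega> \<inter> V) = {}"
      using UV(5) P(2) by (auto dest: inj_onD)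
  qed (use ab UV in auto)
qed

lemma parametrization_flip:
  assumes "parametrization X \<Omega> P" "flip c -` \<Omega> = \<Omega>"
  shows "parametrization X \<Omega> (P \<circ> flip c)"
proof -
  have P: "open \<Omega>" "inj_on P \<Omega>" "continuous_map (top_of_set \<Omega>) X P"
      "\<And>V. V \<subseteq> \<Omega> \<Longrightarrow> open V \<Longrightarrow> openin X (P ` V)"
    using assms(1) by (auto simp: parametrization_def)
  have fl: "flip c ` V = flip c -` V" for V
    by (auto simp: image_iff) (metis flip_simps(4))
  have img: "flip c ` \<Omega> = \<Omega>" by (simp only: fl assms(2))
  have cont: "continuous_on A (flip c)" for A
    using continuous_on_flip[OF continuous_on_id, of A c] by simp
  show ?thesis
    unfolding parametrization_def
  proof (intro conjI allI impI)
    show "inj_on (P \<circ> flip c) \<Omega>"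
      using P(2) img by (intro comp_inj_on) (auto simp: inj_on_def)
    show "continuous_map (top_of_set \<Omega>) X (P \<circ> flip c)"
      using P(3) img cont by (intro continuous_map_compose[where X' = "top_of_set \<Omega>"]) auto
    show "openin X ((P \<circ> flip c) ` V)" if V: "V \<subseteq> \<Omega>" "open V" for V
    proof -
      have "open (flip c ` V)" unfolding fl using V(2) cont by (intro open_vimage) auto
      moreover have "flip c ` V \<subseteq> \<Omega>" using V(1) img by blast
      ultimately have "openin X (P ` flip c ` V)" using P(4) by blast
      then show ?thesis by (simp only: image_comp)
    qed
  qed (rule P)
qed

lemma nonzero_derivative_transform:
  fixes f g :: "complex \<Rightarrow> complex"
  assumes "open A" "\<And>z. z \<in> A \<Longrightarrow> f z = g z"
    and "\<And>z. z \<in> A \<Longrightarrow> \<exists>D. (g has_field_derivative D) (at z) \<and> D \<noteq> 0"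
  shows "f holomorphic_on A \<and> (\<forall>z\<in>A. deriv f z \<noteq> 0)"
proof -
  have "\<exists>D. (f has_field_derivative D) (at z) \<and> D \<noteq> 0" if z: "z \<in> A" for z
  proof -
    obtain D where "(g has_field_derivative D) (at z)" "D \<noteq> 0" using assms(3)[OF z] by blast
    then have "(f has_field_derivative D) (at z)"
      using has_field_derivative_transform_within_open[of g D z A f] assms z by metis
    then show ?thesis using \<open>D \<noteq> 0\<close> by blast
  qed
  then show ?thesis
    using assms(1) by (auto simp: holomorphic_on_open dest: DERIV_imp_deriv)
qed

context rotation_system
begin

text \<open>Allows one disc chart per face. Charts for several starting arcs would share their
  centre, against the condition on parameter 0 in
  \<open>orientable_by_holomorphic_functions\<close>.\<close>

lemma disc_of_rep: "\<exists>w'. norm w' = norm w \<and> disc c d w = disc c (rep c d) w'"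
proof -
  obtain j where j: "rep c d = dart c d j" using rep_dart_ex by blast
  then have "d = dart c (rep c d) (- j)" by (simp flip: dart_add)
  then have "disc c d w = disc c (rep c d) (w * turn (len c (rep c d)) (of_int (- j)))"
    using disc_dart by metis
  then show ?thesis by (intro exI[of _ "w * turn (len c (rep c d)) (of_int (- j))"]) (simp add: norm_mult norm_turn)
qed

lemma disc_interior_cases:
  assumes "norm w < 1"
  obtains "disc c d w = ctr c (rep c d)" "w = 0" | e t s where "disc c d w = pt e t s" "s \<noteq> 0" "w \<noteq> 0"
proof (cases "w = 0")
  case True
  then show ?thesis using that(1) by simp
next
  case False
  then obtain u where u: "w = turn (len c d) u" using turn_len_surj by blast
  then have "0 < Im u" using assms norm_turn_less_1[OF len_pos] by simp
  then show ?thesis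
    using that(2)[of "dart c d \<lfloor>Re u\<rfloor>" "frac (Re u)" "sg c * Im u"] False
    by (auto simp: u disc_turn lam_def sg_def split: if_splits)
qed

lemma disc_interior_not_graph:
  assumes "norm w < 1"
  shows "disc c d w \<noteq> vert x" "disc c d w \<noteq> pt e t 0"
  by (rule disc_interior_cases[OF assms, of c d]; simp)+

text \<open>Locates a point of a star by the arc it lies over: near the beginning of an outgoing or
  the end of an incoming arc, within the distance \<open>norm \<zeta> ^ N\<close>. Both the
  disjointness of stars and the separation of vertices from arcs rest on this.\<close>

lemma star_cases:
  assumes x: "x < v" and z: "\<zeta> \<in> star_dom"
  obtains "\<zeta> = 0" "star x \<zeta> = vert x"
    | d t s where "d \<in> D" "fst d = x" "star x \<zeta> = pt d t s" "0 \<le> t" "t < 1 / 2" "t \<le> norm \<zeta> ^ N"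
    | d t s where "d \<in> D" "snd d = x" "star x \<zeta> = pt d t s" "1 / 2 < t" "t < 1" "1 - t \<le> norm \<zeta> ^ N"
proof -
  obtain c k u where u: "k < N" "u \<in> upper" "norm u < 1 / 2" "\<zeta> = sector N c k u"
    using z by (rule star_dom_cases)
  have e: "star x \<zeta> = lam c (rot x k) u" using u star_sector x by simp
  have n: "norm \<zeta> ^ N = norm u"
    using sector_power[OF N_pos, of c k u] u(4) by (metis flip_simps(3) norm_power)
  have r: "rot x k \<in> D" "fst (rot x k) = x" using rot_in[OF x u(1)] by auto
  have p: "dart c (rot x k) (- 1) \<in> D" "snd (dart c (rot x k) (- 1)) = x"
    using snd_dart_minus_one[OF r(1)] r by auto
  have R: "\<bar>Re u\<bar> \<le> norm \<zeta> ^ N" using n abs_Re_le_cmod by simp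
  show ?thesis
  proof (cases "u = 0")
    case True
    then show ?thesis using that(1) e u r N_pos by (simp add: lam_small)
  next
    case False
    show ?thesis
    proof (cases "0 \<le> Re u")
      case True
      then show ?thesis using that(2)[OF r, of "Re u" "sg c * Im u"] e False u(3) R small_Re[OF u(3)]
        by (simp add: lam_small)
    next
      case neg: False
      then show ?thesis using that(3)[OF p, of "1 + Re u" "sg c * Im u"] e False u(3) R small_Re[OF u(3)]
        by (simp add: lam_small)
    qed
  qed
qed

lemma star_0: "x < v \<Longrightarrow> star x 0 = vert x"
proof -
  assume x: "x < v"
  have "sector N True 0 0 = 0" using N_pos by simp
  then have "star x 0 = star x (sector N True 0 0)" by (simp only:)
  also have "\<dots> = vert x" using star_sector[of x 0 0 True] N_pos rot_in[of x 0] x by (simp add: lam_small)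
  finally show ?thesis .
qed

text \<open>Whether the position is below or above 1/2 tells at which end of its arc the vertex
  sits.\<close>

lemma star_eq_imp_eq:
  assumes "x < v" "y < v" "\<zeta> \<in> star_dom" "\<zeta>' \<in> star_dom" "star x \<zeta> = star y \<zeta>'"
  shows "x = y"
  by (rule star_cases[OF assms(1,3)]; rule star_cases[OF assms(2,4)]) (use assms(5) in auto)

lemma zero_in_star_dom: "0 \<in> star_dom"
  using N_pos by (simp add: zero_power)

text \<open>In every disc of the same face the preimage is the outside of the radius
  \<open>r\<close>, because rotations preserve it; a disc of any other face misses the removed set
  altogether.\<close>

lemma openin_disc_collar:
  assumes d: "d \<in> D" and r: "r < 1"
  shows "openin S (X - disc c d ` cball 0 r)"
  unfolding openin_S
proof (intro conjI allI ballI)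
  fix c' d' assume d': "d' \<in> D"
  define Q where "Q \<longleftrightarrow> c' = c \<and> (\<exists>j. d' = dart c d j)"
  have eq: "{w \<in> cball 0 1. disc c' d' w \<in> X - disc c d ` cball 0 r} =
      cball 0 1 \<inter> (if Q then - cball 0 r else UNIV)"
  proof (intro set_eqI iffI)
    fix w assume w: "w \<in> {w \<in> cball 0 1. disc c' d' w \<in> X - disc c d ` cball 0 r}"
    have "r < norm w" if q: Q
    proof (rule ccontr)
      obtain j where j: "c' = c" "d' = dart c d j" using q unfolding Q_def by blast
      assume "\<not> r < norm w"
      then have "w * turn (len c d) (of_int j) \<in> cball 0 r" by (simp add: norm_mult)
      then show False using w j by (auto simp: disc_dart)
    qed
    then show "w \<in> cball 0 1 \<inter> (if Q then - cball 0 r else UNIV)"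
      using w by (cases Q) auto
  next
    fix w :: complex assume w: "w \<in> cball 0 1 \<inter> (if Q then - cball 0 r else UNIV)"
    have "disc c' d' w \<notin> disc c d ` cball 0 r"
    proof
      assume "disc c' d' w \<in> disc c d ` cball 0 r"
      then obtain z where z: "disc c d z = disc c' d' w" "norm z \<le> r" by auto
      then have n: "norm z < 1" "norm w \<le> 1" using r w by auto
      obtain j where j: "d' = dart c d j" "z = w * turn (len c d) (of_int j)"
        using disc_eqD(2)[OF z(1) n] by blast
      have Q unfolding Q_def using disc_eqD(1)[OF z(1) n] j(1) by blast
      then show False using w z(2) by (simp add: j(2) norm_mult)
    qed
    then show "w \<in> {w \<in> cball 0 1. disc c' d' w \<in> X - disc c d ` cball 0 r}"
      using w disc_in_X[OF d'] by auto
  qed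
  show "openin (top_of_set (cball 0 1)) {w \<in> cball 0 1. disc c' d' w \<in> X - disc c d ` cball 0 r}"
    unfolding eq by (auto intro!: openin_open_Int)
qed simp

lemma separated_points_interior:
  assumes "d \<in> D" "norm w < 1" "p \<in> X" "\<And>z. norm z < 1 \<Longrightarrow> p \<noteq> disc c d z"
  shows "separated_points S (disc c d w) p"
proof -
  obtain r where r: "norm w < r" "r < 1" using dense assms(2) by blast
  show ?thesis
  proof (rule separated_pointsI)
    have "ball 0 r \<subseteq> ball (0::complex) 1" using r by auto
    then show "openin S (disc c d ` ball 0 r)"
      using parametrization_disc[OF assms(1)] unfolding parametrization_def by blast
    show "openin S (X - disc c d ` cball 0 r)" by (rule openin_disc_collar[OF assms(1) r(2)])
    show "disc c d w \<in> disc c d ` ball 0 r" using r by auto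
    show "p \<in> X - disc c d ` cball 0 r"
    proof -
      have "p \<notin> disc c d ` cball 0 r"
      proof
        assume "p \<in> disc c d ` cball 0 r"
        then obtain z where "norm z \<le> r" "p = disc c d z" by auto
        then show False using assms(4)[of z] r(2) by simp
      qed
      then show ?thesis using assms(3) by blast
    qed
    show "disc c d ` ball 0 r \<inter> (X - disc c d ` cball 0 r) = {}" by auto
  qed
qed

lemma separated_points_vertex_edge:
  assumes x: "x < v" and d: "d \<in> D" and t: "0 < t" "t < 1"
  shows "separated_points S (vert x) (pt d t 0)"
proof -
  \<comment> \<open>Half the distance from \<open>t\<close> to the nearer end of the arc. The star
    of this size reaches less than \<open>\<epsilon>\<close> along an arc, while the disc around
    \<open>t\<close> keeps more than \<open>\<epsilon>\<close> away from both ends. The bound 1/4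
    keeps the star inside \<open>star_dom\<close>.\<close>
  define \<epsilon> where "\<epsilon> = min t (1 - t) / 2"
  have \<epsilon>: "0 < \<epsilon>" "2 * \<epsilon> \<le> t" "2 * \<epsilon> \<le> 1 - t" "\<epsilon> \<le> 1 / 4" using t by (auto simp: \<epsilon>_def min_def)
  define U where "U = star x ` {\<zeta>. norm \<zeta> ^ N < \<epsilon>}"
  define V where "V = edge d ` {u \<in> strip. norm (u - of_real t) < \<epsilon>}"
  have sub: "{\<zeta>::complex. norm \<zeta> ^ N < \<epsilon>} \<subseteq> star_dom" using \<epsilon>(4) by auto
  show ?thesis
  proof (rule separated_pointsI)
    have "open {\<zeta>::complex. norm \<zeta> ^ N < \<epsilon>}" by (intro open_Collect_less continuous_intros)
    then show "openin S U"
      using parametrization_star[OF x] sub unfolding parametrization_def U_def by blast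
    have "open (strip \<inter> {u. norm (u - of_real t) < \<epsilon>})"
      by (intro open_Int open_strip open_Collect_less continuous_intros)
    then have "open {u \<in> strip. norm (u - of_real t) < \<epsilon>}"
      by (simp add: Int_def)
    moreover have "{u \<in> strip. norm (u - of_real t) < \<epsilon>} \<subseteq> strip" by auto
    ultimately show "openin S V"
      using parametrization_edge[OF d] unfolding parametrization_def V_def by blast
    show "vert x \<in> U"
      unfolding U_def using star_0[OF x] N_pos \<epsilon>(1) by (intro image_eqI[of _ _ 0]) (auto simp: zero_power)
    show "pt d t 0 \<in> V"
      unfolding V_def using t \<epsilon>(1) by (intro image_eqI[of _ _ "of_real t"]) (auto simp: edge_def)
    show "U \<inter> V = {}"
    proof (rule ccontr)
      assume "U \<inter> V \<noteq> {}"
      then obtain \<zeta> u where *: "norm \<zeta> ^ N < \<epsilon>" "norm (u - of_real t) < \<epsilon>" "star x \<zeta> = pt d (Re u) (Im u)"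
        by (auto simp: U_def V_def edge_def)
      have "\<bar>Re u - t\<bar> < \<epsilon>" using *(2) abs_Re_le_cmod[of "u - of_real t"] by simp
      then have R: "\<epsilon> < Re u" "Re u < 1 - \<epsilon>" using \<epsilon> by auto
      have z: "\<zeta> \<in> star_dom" using *(1) sub by blast
      show False
        by (rule star_cases[OF x z]) (use * R in auto)
    qed
  qed
qed

lemma Hausdorff_S: "Hausdorff_space S"
  unfolding Hausdorff_space_separated_points topspace_S
proof (intro ballI impI)
  \<comment> \<open>Interior points are separated from everything else at once, so that only pairs
    of points on the graph remain.\<close>
  have sep: "separated_points S (disc c d w) q"
    if "d \<in> D" "norm w < 1" "q \<in> X" "disc c d w \<noteq> q" for c d w q
  proof (cases "q \<in> disc c d ` ball 0 1")
    case True
    then show ?thesis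
      using separated_points_parametrization[OF parametrization_disc[OF that(1)], of "disc c d w" c q] that by auto
  next
    case False
    then show ?thesis using that by (intro separated_points_interior) auto
  qed
  fix p q assume pq: "p \<in> X" "q \<in> X" "p \<noteq> q"
  from pq(1) show "separated_points S p q"
  proof (cases rule: X_cases)
    case (interior c d w)
    then show ?thesis using sep[OF interior(1,2) pq(2)] pq(3) by simp
  next
    case p: (edge d t)
    from pq(2) show ?thesis
    proof (cases rule: X_cases)
      case (interior c d w)
      then show ?thesis using sep[OF interior(1,2) pq(1)] pq(3) by (intro separated_points_sym[of S q p]) simp
    next
      case q: (edge d' t')
      have mem: "p \<in> edge d ` strip" "q \<in> edge d' ` strip"
        using p q by (auto simp: edge_def intro!: image_eqI[of _ _ "of_real _"])
      show ?thesis
      proof (cases "d = d'")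
        case True
        then show ?thesis using separated_points_parametrization[OF parametrization_edge[OF p(1)]] mem pq(3) by blast
      next
        case False
        have "openin S (edge d ` strip)" "openin S (edge d' ` strip)"
          using parametrization_edge[OF p(1)] parametrization_edge[OF q(1)] open_strip
          unfolding parametrization_def by blast+
        then show ?thesis by (rule separated_pointsI[OF _ _ mem]) (use False in \<open>auto simp: edge_def\<close>)
      qed
    next
      case q: (vertex y)
      then show ?thesis using separated_points_sym[OF separated_points_vertex_edge[OF q(1) p(1-3)]] p(4) by simp
    qed
  next
    case p: (vertex x)
    from pq(2) show ?thesis
    proof (cases rule: X_cases)
      case (interior c d w)
      then show ?thesis using sep[OF interior(1,2) pq(1)] pq(3) by (intro separated_points_sym[of S q p]) simp
    next
      case q: (edge d' t')
      then show ?thesis using separated_points_vertex_edge[OF p(1) q(1-3)] p(2) by simp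
    next
      case q: (vertex y)
      have "openin S (star x ` star_dom)" "openin S (star y ` star_dom)"
        using parametrization_star[OF p(1)] parametrization_star[OF q(1)] open_star_dom
        unfolding parametrization_def by blast+
      moreover have "p \<in> star x ` star_dom" "q \<in> star y ` star_dom"
        using p q star_0 zero_in_star_dom by (metis imageI)+
      ultimately show ?thesis
      proof (rule separated_pointsI)
        have "x \<noteq> y" using p q pq(3) by auto
        then show "star x ` star_dom \<inter> star y ` star_dom = {}"
          using star_eq_imp_eq[OF p(1) q(1)] by blast
      qed
    qed
  qed
qed

section \<open>Compactness and connectedness\<close>

lemma compactin_disc: "d \<in> D \<Longrightarrow> compactin S (disc c d ` cball 0 1)"
  using image_compactin[OF _ continuous_map_disc] by (simp add: compactin_subtopology)

lemma X_eq_Union: "X = \<Union>((\<lambda>(c, d). disc c d ` cball 0 1) ` (UNIV \<times> D))"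
  by (auto simp: X_def)

lemma compact_S: "compact_space S"
  unfolding compact_space_def topspace_S X_eq_Union
  by (rule compactin_Union) (use finite_D compactin_disc in auto)

lemma connectedin_disc: "d \<in> D \<Longrightarrow> connectedin S (disc c d ` cball 0 1)"
  by (rule connectedin_continuous_map_image[OF continuous_map_disc])
    (simp_all add: connectedin_subtopology)

lemma ends_in_disc:
  assumes "d \<in> D"
  shows "vert (fst d) \<in> disc c d ` cball 0 1" "vert (snd d) \<in> disc c d ` cball 0 1"
proof -
  have "lam c d u \<in> disc c d ` cball 0 1" if "Im u = 0" for u
    using that norm_turn_le_1[OF len_pos, of c d u] by (intro image_eqI[of _ _ "turn (len c d) u"]) (auto simp: disc_turn)
  moreover have "lam c d 0 = vert (fst d)" "lam c d 1 = vert (snd d)"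
    using fst_dart_add_one[OF assms, of c 0] by (simp_all add: lam_def)
  ultimately show "vert (fst d) \<in> disc c d ` cball 0 1" "vert (snd d) \<in> disc c d ` cball 0 1"
    by (metis zero_complex.simps(2) one_complex.simps(2))+
qed

text \<open>Each disc contains the start of its arc, and the tournament has an arc in one direction
  between that vertex and 0. A disc along this second arc completes a connected set through
  \<open>vert 0\<close>.\<close>

lemma connected_S: "connected_space S"
proof -
  have "\<exists>Z. connectedin S Z \<and> disc c d ` cball 0 1 \<subseteq> Z \<and> vert 0 \<in> Z" if d: "d \<in> D" for c d
  proof (cases "fst d = 0")
    case True
    then show ?thesis using connectedin_disc[OF d] ends_in_disc(1)[OF d, of c] by (intro exI[of _ "disc c d ` cball 0 1"]) auto
  next
    case False
    then obtain e where e: "e \<in> D" "{fst e, snd e} = {0, fst d}"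
      using D_tournament[of 0 "fst d"] v_pos fst_less[OF d] by fastforce
    have "vert (fst d) \<in> disc True e ` cball 0 1" "vert 0 \<in> disc True e ` cball 0 1"
      using ends_in_disc[OF e(1), of True] e(2) by (auto simp: doubleton_eq_iff)
    then show ?thesis
      using connectedin_Un[OF connectedin_disc[OF d, of c] connectedin_disc[OF e(1), of True]] ends_in_disc(1)[OF d, of c]
      by (intro exI[of _ "disc c d ` cball 0 1 \<union> disc True e ` cball 0 1"]) blast
  qed
  then have "X \<subseteq> \<Union>{Z. connectedin S Z \<and> vert 0 \<in> Z}"
    unfolding X_def by blast
  moreover have "\<Union>{Z. connectedin S Z \<and> vert 0 \<in> Z} \<subseteq> X"
    using connectedin_subset_topspace topspace_S by fastforce
  moreover have "connectedin S (\<Union>{Z. connectedin S Z \<and> vert 0 \<in> Z})"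
    by (rule connectedin_Union) auto
  ultimately show ?thesis by (simp add: connectedin_topspace subset_antisym flip: topspace_S)
qed

section \<open>The ramified covering and the oriented atlas\<close>

definition cell :: "bool \<Rightarrow> nat \<times> nat \<Rightarrow> complex \<Rightarrow> nat \<Rightarrow> real" where
  "cell c d = disc c d \<circ> flip c"

lemma parametrization_cell: "d \<in> D \<Longrightarrow> parametrization S (ball 0 1) (cell c d)"
  unfolding cell_def by (rule parametrization_flip[OF parametrization_disc]) auto

text \<open>In terms of \<open>u\<close> the ramified covering is \<open>exp (2 \<pi> \<i> u)\<close>.\<close>

definition base :: "(nat \<Rightarrow> real) \<Rightarrow> complex" where
  "base p = exp (2 * of_real pi * \<i> * Complex (p 3) (p 4))"

lemma base_lam: "base (lam c d u) = exp (2 * of_real pi * \<i> * flip c u)"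
proof -
  have "2 * of_real pi * \<i> * flip c u = 2 * of_real pi * \<i> * (if frac (Re u) = 0 \<and> Im u = 0 then 0 else Complex (frac (Re u)) (sg c * Im u))
      + of_real (real_of_int (2 * \<lfloor>Re u\<rfloor>) * pi) * \<i>"
    by (auto simp: complex_eq_iff frac_def algebra_simps)
  then have "exp (2 * of_real pi * \<i> * flip c u) =
      exp (2 * of_real pi * \<i> * (if frac (Re u) = 0 \<and> Im u = 0 then 0 else Complex (frac (Re u)) (sg c * Im u)))"
    unfolding exp_eq by blast
  moreover have "Complex 0 0 = 0" by (simp add: complex_eq_iff)
  ultimately show ?thesis
    by (auto simp: base_def lam_def vert_def pt_def)
qed

text \<open>Without the reflection in \<open>cell\<close>, \<open>base\<close> would be
  antiholomorphic on white discs; with it, the inverse power describes a map to the exterior of the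
  unit disc. At the centre \<open>base\<close> takes the value 1 from the encoding of
  \<open>ctr\<close> instead of 0 or infinity, hence \<open>w \<noteq> 0\<close>.\<close>

lemma base_cell:
  assumes "w \<noteq> 0"
  shows "base (cell c d w) = (if c then w ^ len c d else inverse (w ^ len c d))"
proof -
  obtain u where u: "flip c w = turn (len c d) u" using turn_len_surj assms by (metis flip_simps(5))
  have "base (cell c d w) = exp (2 * of_real pi * \<i> * flip c u)"
    by (simp add: cell_def u disc_turn base_lam)
  moreover have "flip c w ^ len c d = exp (2 * of_real pi * \<i> * u)"
    by (simp add: u turn_power len_pos)
  moreover have "w ^ len c d = inverse (exp (2 * of_real pi * \<i> * cnj u))"
    if "cnj w ^ len c d = exp (2 * of_real pi * \<i> * u)"
  proof -
    have "w ^ len c d = cnj (exp (2 * of_real pi * \<i> * u))"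
      by (simp flip: that)
    also have "\<dots> = exp (cnj (2 * of_real pi * \<i> * u))" by (simp only: exp_cnj)
    also have "cnj (2 * of_real pi * \<i> * u) = - (2 * of_real pi * \<i> * cnj u)" by simp
    finally show ?thesis by (simp only: exp_minus)
  qed
  ultimately show ?thesis
    by (cases c) (auto simp: flip_def)
qed

text \<open>The \<open>N\<close>-th power undoes the root in every half-disc, so one formula holds
  across all of them; its derivative can vanish only at the vertex.\<close>

lemma base_star:
  assumes x: "x < v" and z: "\<zeta> \<in> star_dom"
  shows "base (star x \<zeta>) = exp (2 * of_real pi * \<i> * \<zeta> ^ N)"
proof -
  obtain c k u where "k < N" "u \<in> upper" "norm u < 1 / 2" "\<zeta> = sector N c k u"
    using z by (rule star_dom_cases)
  then show ?thesis using star_sector[OF x] base_lam sector_power[OF N_pos] by simp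
qed

lemma orientable_S: "orientable S"
proof -
  \<comment> \<open>The condition \<open>rep c d = d\<close> selects one disc chart for each
    face.\<close>
  define \<P> where "\<P> = {(\<Omega>, P). (\<exists>d\<in>D. \<Omega> = strip \<and> P = edge d) \<or>
     (\<exists>c. \<exists>d\<in>D. rep c d = d \<and> \<Omega> = ball 0 1 \<and> P = cell c d) \<or>
     (\<exists>x<v. \<Omega> = star_dom \<and> P = star x)}"
  have in_\<P>: "d \<in> D \<Longrightarrow> (strip, edge d) \<in> \<P>" "d \<in> D \<Longrightarrow> rep c d = d \<Longrightarrow> (ball 0 1, cell c d) \<in> \<P>"
      "x < v \<Longrightarrow> (star_dom, star x) \<in> \<P>" for c d x
    unfolding \<P>_def by blast+
  have \<P>_cases: thesis if "(\<Omega>, P) \<in> \<P>" 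
      "\<And>d. d \<in> D \<Longrightarrow> \<Omega> = strip \<Longrightarrow> P = edge d \<Longrightarrow> thesis"
      "\<And>c d. d \<in> D \<Longrightarrow> rep c d = d \<Longrightarrow> \<Omega> = ball 0 1 \<Longrightarrow> P = cell c d \<Longrightarrow> thesis"
      "\<And>x. x < v \<Longrightarrow> \<Omega> = star_dom \<Longrightarrow> P = star x \<Longrightarrow> thesis" for \<Omega> P thesis
    using that unfolding \<P>_def by blast
  have par: "parametrization S \<Omega> P" if "(\<Omega>, P) \<in> \<P>" for \<Omega> P
    using that by (rule \<P>_cases) (use parametrization_edge parametrization_cell parametrization_star in metis)+
  have cover: "topspace S = (\<Union>(\<Omega>, P)\<in>\<P>. P ` \<Omega>)"
  proof
    show "(\<Union>(\<Omega>, P)\<in>\<P>. P ` \<Omega>) \<subseteq> topspace S"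
    proof (clarsimp)
      fix \<Omega> P z assume "(\<Omega>, P) \<in> \<P>" "z \<in> \<Omega>"
      moreover have "openin S (P ` \<Omega>)" using par[OF \<open>(\<Omega>, P) \<in> \<P>\<close>] unfolding parametrization_def by blast
      ultimately show "P z \<in> topspace S" using openin_subset by blast
    qed
    show "topspace S \<subseteq> (\<Union>(\<Omega>, P)\<in>\<P>. P ` \<Omega>)"
    proof
      fix p assume "p \<in> topspace S"
      then have "p \<in> X" by (simp add: topspace_S)
      then have "\<exists>\<Omega> P. (\<Omega>, P) \<in> \<P> \<and> p \<in> P ` \<Omega>"
      proof (cases rule: X_cases)
        case (interior c d w)
        obtain w' where w': "norm w' = norm w" "disc c d w = disc c (rep c d) w'" using disc_of_rep by blast
        then have "p = cell c (rep c d) (flip c w')" "flip c w' \<in> ball 0 1"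
          using interior by (auto simp: cell_def)
        moreover have "(ball 0 1, cell c (rep c d)) \<in> \<P>"
          using in_\<P>(2) interior(1) by simp
        ultimately show ?thesis by blast
      next
        case (edge d t)
        then have "p = local.edge d (of_real t)" "complex_of_real t \<in> strip" by (auto simp: edge_def)
        moreover have "(strip, local.edge d) \<in> \<P>" using in_\<P>(1) edge(1) by blast
        ultimately show ?thesis by blast
      next
        case (vertex x)
        then have "p = star x 0" using star_0 by simp
        moreover have "(star_dom, star x) \<in> \<P>" using in_\<P>(3) vertex(1) by blast
        ultimately show ?thesis using zero_in_star_dom by blast
      qed
      then show "p \<in> (\<Union>(\<Omega>, P)\<in>\<P>. P ` \<Omega>)" by blast
    qed
  qed
  have der: "(base \<circ> P) holomorphic_on (\<Omega> - {0}) \<and> (\<forall>z\<in>\<Omega> - {0}. deriv (base \<circ> P) z \<noteq> 0)" if m: "(\<Omega>, P) \<in> \<P>" for \<Omega> P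
    using m
  proof (rule \<P>_cases)
    fix d assume e: "d \<in> D" "\<Omega> = strip" "P = edge d"
    show ?thesis
    proof (rule nonzero_derivative_transform)
      show "open (\<Omega> - {0})" using e open_strip by (simp add: open_delete)
      show "(base \<circ> P) z = exp (2 * of_real pi * \<i> * z)" for z
        by (simp add: e base_def edge_def pt_def)
      show "\<exists>D. ((\<lambda>z. exp (2 * of_real pi * \<i> * z)) has_field_derivative D) (at z) \<and> D \<noteq> 0" for z :: complex
        by (intro exI conjI) (auto intro!: derivative_eq_intros)
    qed
  next
    fix c d assume f: "d \<in> D" "\<Omega> = ball 0 1" "P = cell c d"
    show ?thesis
    proof (rule nonzero_derivative_transform)
      show "open (\<Omega> - {0})" using f by (simp add: open_delete)
      show "(base \<circ> P) z = (if c then z ^ len c d else inverse (z ^ len c d))" if "z \<in> \<Omega> - {0}" for z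
        using that by (simp add: f base_cell)
      show "\<exists>D. ((\<lambda>z. if c then z ^ len c d else inverse (z ^ len c d)) has_field_derivative D) (at z) \<and> D \<noteq> 0"
        if "z \<in> \<Omega> - {0}" for z :: complex
      proof (cases c)
        case True
        have "((\<lambda>z. z ^ len c d) has_field_derivative of_nat (len c d) * z ^ (len c d - 1)) (at z)"
          by (auto intro!: derivative_eq_intros)
        then show ?thesis using True that len_pos[of c d] by (intro exI conjI) auto
      next
        case False
        have "((\<lambda>z. inverse (z ^ len c d)) has_field_derivative
            - (inverse (z ^ len c d) * (of_nat (len c d) * z ^ (len c d - 1)) * inverse (z ^ len c d))) (at z)"
          using that by (intro derivative_eq_intros) auto
        then show ?thesis using False that len_pos[of c d] by (intro exI conjI) auto
      qed
    qed
  next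
    fix x assume s: "x < v" "\<Omega> = star_dom" "P = star x"
    show ?thesis
    proof (rule nonzero_derivative_transform)
      show "open (\<Omega> - {0})" using s open_star_dom by (simp add: open_delete)
      show "(base \<circ> P) z = exp (2 * of_real pi * \<i> * z ^ N)" if "z \<in> \<Omega> - {0}" for z
        using that base_star[OF s(1)] by (simp add: s)
      show "\<exists>D. ((\<lambda>z. exp (2 * of_real pi * \<i> * z ^ N)) has_field_derivative D) (at z) \<and> D \<noteq> 0"
        if "z \<in> \<Omega> - {0}" for z :: complex
      proof -
        have "((\<lambda>z. exp (2 * of_real pi * \<i> * z ^ N)) has_field_derivative
            exp (2 * of_real pi * \<i> * z ^ N) * (2 * of_real pi * \<i> * (of_nat N * z ^ (N - 1)))) (at z)"
          by (auto intro!: derivative_eq_intros)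
        then show ?thesis using that N_pos by (intro exI conjI) auto
      qed
    qed
  qed
  have cell_0: "cell c d 0 = ctr c (rep c d)" for c d by (simp add: cell_def flip_def)
  show ?thesis
  proof (rule orientable_by_holomorphic_functions[of \<P> S base])
    \<comment> \<open>Strips omit the parameter 0. In a disc it stands for the face centre and in a
      star for the vertex, and neither of these occurs in any other chart.\<close>
    show "P 0 \<notin> P' ` \<Omega>'" if m: "(\<Omega>, P) \<in> \<P>" "(\<Omega>', P') \<in> \<P>" and ne: "(\<Omega>, P) \<noteq> (\<Omega>', P')" and 0: "0 \<in> \<Omega>" for \<Omega> P \<Omega>' P'
      using m(1)
    proof (rule \<P>_cases)
      fix d assume "\<Omega> = strip"
      then show ?thesis using 0 by simp
    next
      fix c d assume f: "d \<in> D" "rep c d = d" "\<Omega> = ball 0 1" "P = cell c d"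
      show ?thesis
        using m(2)
      proof (rule \<P>_cases)
        fix c' d' assume f': "rep c' d' = d'" "\<Omega>' = ball 0 1" "P' = cell c' d'"
        show ?thesis
        proof
          assume "P 0 \<in> P' ` \<Omega>'"
          then obtain z where z: "norm z < 1" "cell c' d' z = ctr c d" using f f' cell_0 by auto
          have n: "norm (flip c' z) < 1" using z by simp
          have dd: "disc c' d' (flip c' z) = ctr c d" using z(2) by (simp add: cell_def)
          have "ctr c' d' = ctr c d"
          proof (rule disc_interior_cases[OF n, of c' d'])
            assume "disc c' d' (flip c' z) = ctr c' (rep c' d')"
            then show ?thesis unfolding dd f'(1) by (rule sym)
          next
            fix e t s assume "disc c' d' (flip c' z) = pt e t s"
            then show ?thesis unfolding dd by simp
          qed
          then show False using ne f f' by simp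
        qed
      next
        fix x assume s: "x < v" "\<Omega>' = star_dom" "P' = star x"
        then show ?thesis using f cell_0 by (auto elim!: star_cases)
      qed (auto simp: f cell_0 edge_def)
    next
      fix x assume s: "x < v" "\<Omega> = star_dom" "P = star x"
      show ?thesis
        using m(2)
      proof (rule \<P>_cases)
        fix c' d' assume f': "\<Omega>' = ball 0 1" "P' = cell c' d'"
        show ?thesis
          using disc_interior_not_graph(1)[of "flip c' _" c' d' x] by (auto simp: f' s star_0 cell_def image_iff) (metis flip_simps(3))
      next
        fix y assume s': "y < v" "\<Omega>' = star_dom" "P' = star y"
        show ?thesis
          using star_eq_imp_eq[OF s(1) s'(1) zero_in_star_dom] ne s s' by (auto simp: image_iff)
      qed (auto simp: s star_0 edge_def)
    qed
  qed (use par cover der in auto)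
qed

lemma surface_S: "surface S"
  unfolding surface_def
proof (intro conjI compact_S connected_S Hausdorff_S ballI)
  fix p assume "p \<in> topspace S"
  moreover have "\<Union>{U. \<exists>\<phi>. chart S U \<phi>} = topspace S"
  proof -
    obtain \<A> where \<A>: "\<forall>(U, \<phi>)\<in>\<A>. chart S U \<phi>" "(\<Union>(U, \<phi>)\<in>\<A>. U) = topspace S"
      using orientable_S unfolding orientable_def by blast
    show ?thesis
    proof
      show "\<Union>{U. \<exists>\<phi>. chart S U \<phi>} \<subseteq> topspace S" by (auto simp: chart_def dest: openin_subset)
      show "topspace S \<subseteq> \<Union>{U. \<exists>\<phi>. chart S U \<phi>}" using \<A> by fastforce
    qed
  qed
  ultimately show "\<exists>U \<phi>. p \<in> U \<and> chart S U \<phi>" by blast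
qed

end

section \<open>The embedded complete graph and its faces\<close>

lemma edge_point_0: "edge_point a b 0 = (\<lambda>i. if i = a then 1 else 0)"
  by (auto simp: edge_point_def fun_eq_iff)

lemma edge_point_1: "a \<noteq> b \<Longrightarrow> edge_point a b 1 = (\<lambda>i. if i = b then 1 else 0)"
  by (auto simp: edge_point_def fun_eq_iff)

lemma edge_segment_eq:
  assumes "{a, b} \<in> snd \<Gamma>" "a \<noteq> b"
  shows "edge_segment \<Gamma> {a, b} = edge_point a b ` {0..1}"
proof (intro set_eqI iffI)
  fix x assume x: "x \<in> edge_segment \<Gamma> {a, b}"
  then have nn: "0 \<le> x i" and z: "i \<noteq> a \<Longrightarrow> i \<noteq> b \<Longrightarrow> x i = 0" for i
    by (auto simp: edge_segment_def graph_space_def)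
  obtain s where s: "s \<in> (\<lambda>u. {u}) ` fst \<Gamma> \<union> snd \<Gamma>" "\<And>i. i \<notin> s \<Longrightarrow> x i = 0" "sum x s = 1"
    using x by (auto simp: edge_segment_def graph_space_def)
  \<comment> \<open>A sum over an infinite set is 0 by convention, so the value 1 makes
    \<open>s\<close> finite.\<close>
  have fin: "finite s"
    using s(3) by (metis sum.infinite zero_neq_one)
  have "sum x s = sum x (s \<inter> {a, b})"
    using fin z by (intro sum.mono_neutral_right) auto
  also have "\<dots> = sum x {a, b}"
    using s(2) by (intro sum.mono_neutral_left) auto
  finally have sum: "x a + x b = 1" using s(3) assms(2) by simp
  have "x = edge_point a b (x b)"
    using sum z assms(2) by (auto simp: edge_point_def fun_eq_iff)
  moreover have "x b \<in> {0..1}" using sum nn[of a] nn[of b] by auto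
  ultimately show "x \<in> edge_point a b ` {0..1}" by blast
next
  fix x assume "x \<in> edge_point a b ` {0..1}"
  then obtain t where t: "0 \<le> t" "t \<le> 1" "x = edge_point a b t" by auto
  have "sum x {a, b} = 1" using assms(2) t by (simp add: edge_point_def)
  then have "\<exists>s\<in>(\<lambda>u. {u}) ` fst \<Gamma> \<union> snd \<Gamma>. (\<forall>i. i \<notin> s \<longrightarrow> x i = 0) \<and> sum x s = 1"
    using assms t by (intro bexI[of _ "{a, b}"]) (auto simp: edge_point_def)
  then show "x \<in> edge_segment \<Gamma> {a, b}"
    using t by (auto simp: edge_segment_def graph_space_def edge_point_def)
qed

text \<open>Each member is closed as well, its complement being the union of the other open members;
  a connected clopen set is a component.\<close>

lemma connected_components_of_open_partition:
  assumes conn: "\<And>F. F \<in> \<F> \<Longrightarrow> connectedin Y F" and op: "\<And>F. F \<in> \<F> \<Longrightarrow> openin Y F"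
    and ne: "\<And>F. F \<in> \<F> \<Longrightarrow> F \<noteq> {}" and un: "\<Union>\<F> = topspace Y"
    and disj: "\<And>F F'. F \<in> \<F> \<Longrightarrow> F' \<in> \<F> \<Longrightarrow> F \<noteq> F' \<Longrightarrow> F \<inter> F' = {}"
  shows "connected_components_of Y = \<F>"
proof -
  have comp: "connected_component_of_set Y x = F" if F: "F \<in> \<F>" "x \<in> F" for F x
  proof
    show "F \<subseteq> connected_component_of_set Y x"
      using connected_component_of_maximal[OF conn[OF F(1)] F(2)] .
    have "topspace Y - F = \<Union>(\<F> - {F})"
      using un disj[OF F(1)] F(1) by blast
    then have "openin Y (topspace Y - F)" using op by auto
    then have clo: "closedin Y F" using op[OF F(1)] by (simp add: closedin_def openin_subset)
    have "connected_component_of Y x x"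
      using F un by (auto simp: connected_component_of_refl)
    then have "\<not> disjnt (connected_component_of_set Y x) F"
      using F(2) by (auto simp: disjnt_def)
    then show "connected_component_of_set Y x \<subseteq> F"
      using connectedin_clopen_cases[OF connectedin_connected_component_of clo op[OF F(1)]] by blast
  qed
  show ?thesis
  proof
    show "connected_components_of Y \<subseteq> \<F>"
      unfolding connected_components_of_def using comp by (auto simp flip: un)
    show "\<F> \<subseteq> connected_components_of Y"
    proof
      fix F assume F: "F \<in> \<F>"
      then obtain x where "x \<in> F" using ne by blast
      then show "F \<in> connected_components_of Y"
        unfolding connected_components_of_def using comp[OF F] F un by blast
    qed
  qed
qed

text \<open>The image of the closed disc is compact, hence closed, and the image of the open disc is
  dense in it; so it is the closure of \<open>F\<close>.\<close>

lemma frontier_of_open_disc: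
  fixes h :: "complex \<Rightarrow> 'a"
  assumes "Hausdorff_space Y" "continuous_map (top_of_set (cball 0 1)) Y h" "h ` ball 0 1 = F" "openin Y F"
  shows "Y frontier_of F = h ` cball 0 1 - F"
proof -
  have "compactin Y (h ` cball 0 1)"
    using assms(2) by (intro image_compactin[OF _ assms(2)]) (simp add: compactin_subtopology)
  then have "closedin Y (h ` cball 0 1)" by (rule compactin_imp_closedin[OF assms(1)])
  moreover have "F \<subseteq> h ` cball 0 1" unfolding assms(3)[symmetric] by (intro image_mono ball_subset_cball)
  ultimately have "Y closure_of F \<subseteq> h ` cball 0 1" by (intro closure_of_minimal)
  moreover have "h ` cball 0 1 \<subseteq> Y closure_of F"
  proof -
    have "top_of_set (cball 0 1) closure_of ball 0 1 = cball (0::complex) 1"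
      by (simp add: closure_of_subtopology Int_absorb1)
    then show ?thesis
      using continuous_map_image_closure_subset[OF assms(2), of "ball 0 1"] assms(3) by simp
  qed
  ultimately show ?thesis
    using assms(4) by (simp add: frontier_of_def interior_of_openin)
qed

lemma cis_sector:
  assumes "0 < l" "norm z = 1"
  obtains k t where "k < l" "0 \<le> t" "t \<le> 1" "z = cis (2 * pi * (real k + t) / real l)"
proof -
  have z: "z \<noteq> 0" using assms(2) by auto
  define x where "x = Arg2pi z * real l / (2 * pi)"
  have b: "0 \<le> Arg2pi z" "Arg2pi z < 2 * pi" using Arg2pi by auto
  have x: "0 \<le> x" "x < real l" using b assms(1) by (auto simp: x_def field_simps)
  have "z = cis (2 * pi * x / real l)"
    using Arg2pi_eq[of z] assms by (simp add: x_def cis_conv_exp)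
  moreover have "x = real (nat \<lfloor>x\<rfloor>) + frac x" using x(1) by (simp add: frac_def)
  moreover have "nat \<lfloor>x\<rfloor> < l" using x by linarith
  moreover have "0 \<le> frac x" "frac x \<le> 1" using frac_lt_1[of x] by (auto intro: less_imp_le)
  ultimately show ?thesis using that by metis
qed

context rotation_system
begin

section \<open>The graph inside the surface\<close>

abbreviation ends :: "nat \<times> nat \<Rightarrow> nat set" where
  "ends d \<equiv> {fst d, snd d}"

abbreviation \<Gamma> :: "nat graph" where
  "\<Gamma> \<equiv> complete_graph v"

lemma fst_neq_snd: "d \<in> D \<Longrightarrow> fst d \<noteq> snd d"
  using D_irrefl by (metis prod.collapse)

lemma ends_in_edges: "d \<in> D \<Longrightarrow> ends d \<in> snd \<Gamma>"
  using fst_less snd_less fst_neq_snd by (auto simp: complete_graph_def)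

text \<open>A tournament has no pair of opposite arcs, so an undirected edge determines its arc.
  This lets orbits of arcs be treated as sets of edges.\<close>

lemma ends_eq_iff:
  assumes "d \<in> D" "d' \<in> D"
  shows "ends d = ends d' \<longleftrightarrow> d = d'"
proof
  assume "ends d = ends d'"
  then consider "fst d = fst d'" "snd d = snd d'" | "fst d = snd d'" "snd d = fst d'"
    by (auto simp: doubleton_eq_iff)
  then show "d = d'"
  proof cases
    case 2
    have "(fst d, snd d) \<in> D" "(snd d, fst d) \<in> D" using assms 2 by (metis prod.collapse)+
    then show ?thesis using D_tournament[OF fst_less snd_less fst_neq_snd] assms by blast
  qed (simp add: prod_eq_iff)
qed simp

lemma edges_eq: "snd \<Gamma> = ends ` D"
proof
  show "snd \<Gamma> \<subseteq> ends ` D"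
  proof
    fix e assume e: "e \<in> snd \<Gamma>"
    then obtain x y where xy: "e = {x, y}" "x \<noteq> y" "x < v" "y < v"
      by (auto simp: complete_graph_def card_2_iff)
    show "e \<in> ends ` D"
    proof (cases "(x, y) \<in> D")
      case True
      then show ?thesis using xy(1) by (intro image_eqI[of _ _ "(x, y)"]) auto
    next
      case False
      then have "(y, x) \<in> D" using D_tournament xy by blast
      then show ?thesis using xy(1) by (intro image_eqI[of _ _ "(y, x)"]) auto
    qed
  qed
qed (use ends_in_edges in blast)

lemma edge_segment_ends: "d \<in> D \<Longrightarrow> edge_segment \<Gamma> (ends d) = edge_point (fst d) (snd d) ` {0..1}"
  using ends_in_edges fst_neq_snd by (rule edge_segment_eq)

lemma topspace_graph_space: "topspace (graph_space \<Gamma>) = (\<Union>d\<in>D. edge_point (fst d) (snd d) ` {0..1})"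
proof
  show "(\<Union>d\<in>D. edge_point (fst d) (snd d) ` {0..1}) \<subseteq> topspace (graph_space \<Gamma>)"
    using edge_segment_ends by (auto simp: edge_segment_def)
  show "topspace (graph_space \<Gamma>) \<subseteq> (\<Union>d\<in>D. edge_point (fst d) (snd d) ` {0..1})"
  proof
    fix x assume x: "x \<in> topspace (graph_space \<Gamma>)"
    then obtain s where s: "s \<in> (\<lambda>u. {u}) ` fst \<Gamma> \<union> snd \<Gamma>" "\<And>i. i \<notin> s \<Longrightarrow> x i = 0"
      by (auto simp: graph_space_def)
    have "\<exists>d\<in>D. s \<subseteq> ends d"
    proof (cases "s \<in> snd \<Gamma>")
      case True
      then show ?thesis using edges_eq by auto
    next
      case False
      then obtain u where "u < v" "s = {u}" using s(1) by (auto simp: complete_graph_def)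
      then show ?thesis using rot_in[of u 0] N_pos by (intro bexI[of _ "rot u 0"]) auto
    qed
    then obtain d where "d \<in> D" "s \<subseteq> ends d" by blast
    then have "x \<in> edge_segment \<Gamma> (ends d)"
      using x s(2) by (auto simp: edge_segment_def)
    then show "x \<in> (\<Union>d\<in>D. edge_point (fst d) (snd d) ` {0..1})"
      using edge_segment_ends \<open>d \<in> D\<close> by blast
  qed
qed

lemma lam_real:
  assumes "d \<in> D" "0 \<le> t" "t \<le> 1"
  shows "lam c d (of_real t) = (if t = 0 then vert (fst d) else if t = 1 then vert (snd d) else pt d t 0)"
proof (cases "t = 1")
  case True
  then show ?thesis using fst_dart_add_one[OF assms(1), of c 0] by (simp add: lam_def)
next
  case False
  then show ?thesis using assms lam_unit[of "of_real t" c d] by auto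
qed

text \<open>Outside the vertices exactly two barycentric coordinates are positive. They single out
  the arc, and its direction tells which of them is the position.\<close>

definition emb :: "(nat \<Rightarrow> real) \<Rightarrow> nat \<Rightarrow> real" where
  "emb y = (if \<exists>x. y x = 1 then vert (THE x. y x = 1)
     else let d = (THE d. d \<in> D \<and> 0 < y (fst d) \<and> 0 < y (snd d)) in pt d (y (snd d)) 0)"

lemma emb_edge_point:
  assumes d: "d \<in> D" and t: "0 \<le> t" "t \<le> 1"
  shows "emb (edge_point (fst d) (snd d) t) = lam c d (of_real t)"
proof -
  let ?y = "edge_point (fst d) (snd d) t"
  note ne = fst_neq_snd[OF d]
  consider "t = 0" | "t = 1" | "0 < t" "t < 1" using t by linarith
  then show ?thesis
  proof cases
    case 1
    have "(THE x. ?y x = 1) = fst d" "?y (fst d) = 1"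
      by (auto simp: 1 edge_point_0 intro!: the_equality split: if_splits)
    then show ?thesis using 1 lam_real[OF d t] by (auto simp: emb_def)
  next
    case 2
    have "(THE x. ?y x = 1) = snd d" "?y (snd d) = 1"
      by (auto simp: 2 edge_point_1[OF ne] intro!: the_equality split: if_splits)
    then show ?thesis using 2 lam_real[OF d t] by (auto simp: emb_def)
  next
    case 3
    then have n1: "\<not> (\<exists>x. ?y x = 1)" by (auto simp: edge_point_def)
    have pos: "0 < ?y x \<longleftrightarrow> x \<in> ends d" for x using 3 by (auto simp: edge_point_def)
    have "(THE d. d \<in> D \<and> 0 < ?y (fst d) \<and> 0 < ?y (snd d)) = d"
    proof (rule the_equality)
      show "d \<in> D \<and> 0 < ?y (fst d) \<and> 0 < ?y (snd d)" using d pos by simp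
      fix e assume e: "e \<in> D \<and> 0 < ?y (fst e) \<and> 0 < ?y (snd e)"
      then have "fst e \<in> ends d" "snd e \<in> ends d" "fst e \<noteq> snd e" using pos fst_neq_snd by blast+
      then have "ends e = ends d" by auto
      then show "e = d" using ends_eq_iff e d by blast
    qed
    moreover have "?y (snd d) = t" using ne by (simp add: edge_point_def)
    ultimately show ?thesis using n1 3 lam_real[OF d t] by (auto simp: emb_def Let_def)
  qed
qed

lemma emb_image: "emb ` topspace (graph_space \<Gamma>) = vert ` {..<v} \<union> {pt d t 0 | d t. d \<in> D \<and> 0 < t \<and> t < 1}"
proof -
  have "emb ` topspace (graph_space \<Gamma>) = (\<Union>d\<in>D. (\<lambda>t. lam True d (of_real t)) ` {0..1})"
    unfolding topspace_graph_space image_UN image_image by (intro SUP_cong image_cong refl emb_edge_point) auto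
  also have "\<dots> = vert ` {..<v} \<union> {pt d t 0 | d t. d \<in> D \<and> 0 < t \<and> t < 1}"
  proof
    show "(\<Union>d\<in>D. (\<lambda>t. lam True d (of_real t)) ` {0..1}) \<subseteq> vert ` {..<v} \<union> {pt d t 0 | d t. d \<in> D \<and> 0 < t \<and> t < 1}"
    proof (intro UN_least subsetI)
      fix d p assume d: "d \<in> D" and "p \<in> (\<lambda>t. lam True d (of_real t)) ` {0..1}"
      then obtain t where t: "0 \<le> t" "t \<le> 1" "p = lam True d (of_real t)" by auto
      then have p: "p = (if t = 0 then vert (fst d) else if t = 1 then vert (snd d) else pt d t 0)"
        using lam_real[OF d] by simp
      consider "t = 0" | "t = 1" | "0 < t" "t < 1" using t by linarith
      then show "p \<in> vert ` {..<v} \<union> {pt d t 0 | d t. d \<in> D \<and> 0 < t \<and> t < 1}"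
      proof cases
        case 3
        then have "p = pt d t 0" using p by simp
        then show ?thesis using d 3 by blast
      qed (use p fst_less[OF d] snd_less[OF d] in auto)
    qed
    show "vert ` {..<v} \<union> {pt d t 0 | d t. d \<in> D \<and> 0 < t \<and> t < 1} \<subseteq> (\<Union>d\<in>D. (\<lambda>t. lam True d (of_real t)) ` {0..1})"
    proof (intro Un_least subsetI)
      fix p assume "p \<in> vert ` {..<v}"
      then obtain x where x: "x < v" "p = vert x" by auto
      have r: "rot x 0 \<in> D" "fst (rot x 0) = x" using rot_in[OF x(1), of 0] N_pos by auto
      then have "p = lam True (rot x 0) (of_real 0)" using lam_real[OF r(1), of 0 True] x by simp
      then show "p \<in> (\<Union>d\<in>D. (\<lambda>t. lam True d (of_real t)) ` {0..1})"
        using r(1) by (intro UN_I[of "rot x 0"] image_eqI[of _ _ 0]) auto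
    next
      fix p assume "p \<in> {pt d t 0 | d t. d \<in> D \<and> 0 < t \<and> t < 1}"
      then obtain d t where p: "d \<in> D" "0 < t" "t < 1" "p = pt d t 0" by blast
      then have "p = lam True d (of_real t)" using lam_real[of d t True] by simp
      then show "p \<in> (\<Union>d\<in>D. (\<lambda>t. lam True d (of_real t)) ` {0..1})"
        using p by (intro UN_I[of d] image_eqI[of _ _ t]) auto
    qed
  qed
  finally show ?thesis .
qed

lemma inj_emb: "inj_on emb (topspace (graph_space \<Gamma>))"
proof (rule inj_onI)
  fix y y' assume "y \<in> topspace (graph_space \<Gamma>)" "y' \<in> topspace (graph_space \<Gamma>)" and eq: "emb y = emb y'"
  then obtain d t d' t' where d: "d \<in> D" "0 \<le> t" "t \<le> 1" "y = edge_point (fst d) (snd d) t"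
    and d': "d' \<in> D" "0 \<le> t'" "t' \<le> 1" "y' = edge_point (fst d') (snd d') t'"
    unfolding topspace_graph_space by auto
  have "lam True d (of_real t) = lam True d' (of_real t')"
    using eq emb_edge_point[OF d(1-3), of True] emb_edge_point[OF d'(1-3), of True] d(4) d'(4) by simp
  then show "y = y'"
    using lam_real[OF d(1-3), of True] lam_real[OF d'(1-3), of True] fst_neq_snd[OF d(1)] fst_neq_snd[OF d'(1)]
    by (auto simp: d(4) d'(4) edge_point_0 edge_point_1 split: if_splits)
qed

lemma continuous_map_coordinate: "continuous_map (graph_space \<Gamma>) euclideanreal (\<lambda>y. y i)"
  unfolding graph_space_def
  by (intro continuous_map_from_subtopology continuous_map_product_projection) simp

lemma continuous_map_emb: "continuous_map (graph_space \<Gamma>) S emb"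
proof (rule pasting_lemma_closed[where I = D and T = "\<lambda>d. edge_segment \<Gamma> (ends d)"
      and f = "\<lambda>d y. lam True d (of_real (y (snd d)))"])
  have val: "emb y = lam True d (of_real (y (snd d)))" "0 \<le> y (snd d)"
    if d: "d \<in> D" "y \<in> edge_segment \<Gamma> (ends d)" for d y
  proof -
    obtain t where t: "0 \<le> t" "t \<le> 1" "y = edge_point (fst d) (snd d) t"
      using d edge_segment_ends by auto
    then have "y (snd d) = t" using fst_neq_snd[OF d(1)] by (simp add: edge_point_def)
    then show "emb y = lam True d (of_real (y (snd d)))" "0 \<le> y (snd d)"
      using emb_edge_point[OF d(1) t(1,2)] t by auto
  qed
  show "closedin (graph_space \<Gamma>) (edge_segment \<Gamma> (ends d))" if "d \<in> D" for d
  proof -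
    \<comment> \<open>A number exceeding both ends, so that the intersection of closed sets below
      has a nonempty index set.\<close>
    have "Suc (fst d + snd d) \<in> - ends d" by simp
    then have "- ends d \<noteq> {}" by blast
    moreover have "closedin (graph_space \<Gamma>) {y \<in> topspace (graph_space \<Gamma>). y i \<in> {0}}" for i
      by (rule closedin_continuous_map_preimage[OF continuous_map_coordinate]) simp
    ultimately have "closedin (graph_space \<Gamma>) (\<Inter>i\<in>- ends d. {y \<in> topspace (graph_space \<Gamma>). y i \<in> {0}})"
      by (intro closedin_INT)
    moreover have "(\<Inter>i\<in>- ends d. {y \<in> topspace (graph_space \<Gamma>). y i \<in> {0}}) = edge_segment \<Gamma> (ends d)"
      using \<open>- ends d \<noteq> {}\<close> unfolding edge_segment_def by blast
    ultimately show ?thesis by simp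
  qed
  show "continuous_map (subtopology (graph_space \<Gamma>) (edge_segment \<Gamma> (ends d))) S (\<lambda>y. lam True d (of_real (y (snd d))))"
    if d: "d \<in> D" for d
  proof -
    have "continuous_map (subtopology (graph_space \<Gamma>) (edge_segment \<Gamma> (ends d))) euclideanreal (\<lambda>y. y (snd d))"
      by (rule continuous_map_from_subtopology[OF continuous_map_coordinate])
    moreover have "continuous_map euclideanreal (euclidean :: complex topology) of_real"
      by (auto intro: continuous_intros)
    ultimately have "continuous_map (subtopology (graph_space \<Gamma>) (edge_segment \<Gamma> (ends d))) (euclidean :: complex topology)
        (of_real \<circ> (\<lambda>y. y (snd d)))"
      by (rule continuous_map_compose)
    then have "continuous_map (subtopology (graph_space \<Gamma>) (edge_segment \<Gamma> (ends d))) (top_of_set upper)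
        (of_real \<circ> (\<lambda>y. y (snd d)))"
      by (simp add: continuous_map_in_subtopology image_subset_iff)
    then have "continuous_map (subtopology (graph_space \<Gamma>) (edge_segment \<Gamma> (ends d))) S
        (lam True d \<circ> (of_real \<circ> (\<lambda>y. y (snd d))))"
      using continuous_map_lam[OF d] by (rule continuous_map_compose)
    then show ?thesis by (simp add: o_def)
  qed
  show "lam True d (of_real (y (snd d))) = lam True d' (of_real (y (snd d')))"
    if "d \<in> D" "d' \<in> D" "y \<in> topspace (graph_space \<Gamma>) \<inter> edge_segment \<Gamma> (ends d) \<inter> edge_segment \<Gamma> (ends d')" for d d' y
    using that val(1)[of d y] val(1)[of d' y] by simp
  show "\<exists>d. d \<in> D \<and> y \<in> edge_segment \<Gamma> (ends d) \<and> emb y = lam True d (of_real (y (snd d)))"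
    if "y \<in> topspace (graph_space \<Gamma>)" for y
    using that val(1) edge_segment_ends unfolding topspace_graph_space by blast
qed (rule finite_D)

lemma graph_embedding_emb: "graph_embedding \<Gamma> S emb"
  unfolding graph_embedding_def using continuous_map_emb inj_emb by blast

section \<open>The faces of the embedding\<close>

definition face :: "bool \<Rightarrow> nat \<times> nat \<Rightarrow> (nat \<Rightarrow> real) set" where
  "face c d = disc c d ` ball 0 1"

lemma openin_face: "d \<in> D \<Longrightarrow> openin S (face c d)"
  using parametrization_disc[of d c] unfolding parametrization_def face_def by simp

lemma face_eqI: "face c (dart c d j) = face c d"
proof -
  have sub: "face c (dart c d j) \<subseteq> face c d" for d j
    by (auto simp: face_def disc_dart norm_mult)
  from this[of d j] this[of "dart c d j" "- j"] show ?thesis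
    by (simp flip: dart_add)
qed

lemma faces_meet:
  assumes "face c d \<inter> face c' d' \<noteq> {}"
  shows "c' = c \<and> (\<exists>j. d' = dart c d j)"
proof -
  obtain w w' where w: "norm w < 1" "norm w' < 1" "disc c d w = disc c' d' w'"
    using assms by (auto simp: face_def)
  then show ?thesis using disc_eqD[OF w(3,1)] by auto
qed

lemma face_nonempty: "face c d \<noteq> {}"
  by (simp add: face_def)

lemma complement_emb: "topspace S - emb ` topspace (graph_space \<Gamma>) = (\<Union>c. \<Union>d\<in>D. face c d)"
proof (intro set_eqI iffI)
  fix p assume "p \<in> topspace S - emb ` topspace (graph_space \<Gamma>)"
  then have p: "p \<in> X" "p \<notin> vert ` {..<v} \<union> {pt d t 0 | d t. d \<in> D \<and> 0 < t \<and> t < 1}"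
    by (simp_all add: topspace_S emb_image)
  from p(1) show "p \<in> (\<Union>c. \<Union>d\<in>D. face c d)"
  proof (cases rule: X_cases)
    case (interior c d w)
    then show ?thesis by (intro UN_I[of c] UN_I[of d]) (auto simp: face_def)
  next
    case (edge d t)
    then show ?thesis using p(2) by blast
  next
    case (vertex x)
    then show ?thesis using p(2) by blast
  qed
next
  fix p assume "p \<in> (\<Union>c. \<Union>d\<in>D. face c d)"
  then obtain c d w where p: "d \<in> D" "norm w < 1" "p = disc c d w" by (auto simp: face_def)
  then have "p \<in> X" using disc_in_X by simp
  moreover have "p \<notin> emb ` topspace (graph_space \<Gamma>)"
    unfolding emb_image
    using disc_interior_not_graph(1)[OF p(2), of c d] disc_interior_not_graph(2)[OF p(2), of c d] p(3) by auto
  ultimately show "p \<in> topspace S - emb ` topspace (graph_space \<Gamma>)" by (simp add: topspace_S)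
qed

lemma faces_emb: "faces \<Gamma> S emb = (\<lambda>(c, d). face c d) ` (UNIV \<times> D)"
  unfolding faces_def complement_emb
proof (rule connected_components_of_open_partition)
  let ?W = "\<Union>c. \<Union>d\<in>D. face c d"
  have W: "face c d \<subseteq> ?W" if "d \<in> D" for c d using that by blast
  show "connectedin (subtopology S ?W) F" if mem: "F \<in> (\<lambda>(c, d). face c d) ` (UNIV \<times> D)" for F
  proof -
    obtain c d where F: "d \<in> D" "F = face c d" using mem by auto
    have "connectedin S (face c d)"
      unfolding face_def
      by (rule connectedin_continuous_map_image[OF continuous_map_disc[OF F(1)]])
        (auto simp: connectedin_subtopology)
    then show ?thesis using W F by (simp add: connectedin_subtopology)
  qed
  show "openin (subtopology S ?W) F" if "F \<in> (\<lambda>(c, d). face c d) ` (UNIV \<times> D)" for F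
    using that openin_face W by (auto intro!: openin_subset_topspace_eq simp: openin_subtopology)
  show "\<Union> ((\<lambda>(c, d). face c d) ` (UNIV \<times> D)) = topspace (subtopology S ?W)"
  proof -
    have "?W \<subseteq> topspace S" using complement_emb by blast
    then have "topspace (subtopology S ?W) = ?W" by (simp add: Int_absorb1)
    moreover have "\<Union> ((\<lambda>(c, d). face c d) ` (UNIV \<times> D)) = ?W" by auto
    ultimately show ?thesis by simp
  qed
  show "F \<inter> F' = {}"
    if mem: "F \<in> (\<lambda>(c, d). face c d) ` (UNIV \<times> D)" "F' \<in> (\<lambda>(c, d). face c d) ` (UNIV \<times> D)"
      and neq: "F \<noteq> F'" for F F'
  proof -
    obtain c d c' d' where F: "F = face c d" "F' = face c' d'" using mem by auto
    show ?thesis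
    proof (rule ccontr)
      assume "F \<inter> F' \<noteq> {}"
      then obtain j where "c' = c" "d' = dart c d j" using faces_meet[of c d c' d'] F by blast
      then show False using neq F face_eqI by simp
    qed
  qed
qed (auto simp: face_nonempty)

section \<open>Boundary circuits and face lengths\<close>

definition boundary_walk :: "bool \<Rightarrow> nat \<times> nat \<Rightarrow> nat list" where
  "boundary_walk c d = map (\<lambda>k. fst (dart c d (int k))) [0..<len c d]"

lemma length_boundary_walk [simp]: "length (boundary_walk c d) = len c d"
  by (simp add: boundary_walk_def)

lemma nth_boundary_walk: "k < len c d \<Longrightarrow> boundary_walk c d ! k = fst (dart c d (int k))"
  by (simp add: boundary_walk_def)

lemma next_vertex_boundary_walk:
  assumes "d \<in> D" "k < len c d"
  shows "next_vertex (boundary_walk c d) k = snd (dart c d (int k))"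
proof -
  have "dart c d (int (Suc k mod len c d)) = dart c d (int (Suc k))"
    unfolding dart_eq_iff by (simp add: mod_eq_dvd_iff of_nat_mod flip: mod_eq_dvd_iff)
  then have "next_vertex (boundary_walk c d) k = fst (dart c d (int k + 1))"
    using len_pos[of c d] by (simp add: next_vertex_def nth_boundary_walk add.commute)
  then show ?thesis using fst_dart_add_one[OF assms(1)] by simp
qed

lemma walk_edge_boundary_walk:
  assumes "d \<in> D" "k < len c d"
  shows "walk_edge (boundary_walk c d) k = ends (dart c d (int k))"
  using assms by (simp add: walk_edge_def nth_boundary_walk next_vertex_boundary_walk)

lemma walk_edges_boundary_walk:
  assumes "d \<in> D"
  shows "walk_edges (boundary_walk c d) = {ends e | e. \<exists>j. e = dart c d j}"
proof
  show "walk_edges (boundary_walk c d) \<subseteq> {ends e | e. \<exists>j. e = dart c d j}"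
  proof
    fix s assume "s \<in> walk_edges (boundary_walk c d)"
    then obtain k where "k < len c d" "s = walk_edge (boundary_walk c d) k"
      by (auto simp: walk_edges_def)
    then have "s = ends (dart c d (int k))" using walk_edge_boundary_walk[OF assms] by simp
    then show "s \<in> {ends e | e. \<exists>j. e = dart c d j}" by blast
  qed
  show "{ends e | e. \<exists>j. e = dart c d j} \<subseteq> walk_edges (boundary_walk c d)"
  proof
    fix s assume "s \<in> {ends e | e. \<exists>j. e = dart c d j}"
    then obtain j where s: "s = ends (dart c d j)" by blast
    define k where "k = nat (j mod int (len c d))"
    have k: "int k = j mod int (len c d)" "k < len c d"
      using len_pos[of c d] by (simp_all add: k_def nat_less_iff)
    have "dart c d (int k) = dart c d j"
      unfolding dart_eq_iff k(1) by (simp flip: mod_eq_dvd_iff)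
    then show "s \<in> walk_edges (boundary_walk c d)"
      unfolding walk_edges_def using k(2) s walk_edge_boundary_walk[OF assms k(2)]
      by (intro image_eqI[of _ _ k]) auto
  qed
qed

text \<open>Within one period of the permutation every arc of its cycle occurs once, and different
  arcs have different edges.\<close>

lemma circuit_boundary_walk:
  assumes "d \<in> D"
  shows "circuit \<Gamma> (boundary_walk c d)"
  unfolding circuit_def
proof (intro conjI)
  show "boundary_walk c d \<noteq> []" using len_pos[of c d] by (simp add: boundary_walk_def)
  show "walk_edges (boundary_walk c d) \<subseteq> snd \<Gamma>"
  proof
    fix s assume "s \<in> walk_edges (boundary_walk c d)"
    then obtain j where "s = ends (dart c d j)" unfolding walk_edges_boundary_walk[OF assms] by blast
    then show "s \<in> snd \<Gamma>" using ends_in_edges assms by simp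
  qed
  show "inj_on (walk_edge (boundary_walk c d)) {..<length (boundary_walk c d)}"
  proof (rule inj_onI)
    fix k k' assume k: "k \<in> {..<length (boundary_walk c d)}" "k' \<in> {..<length (boundary_walk c d)}"
      and "walk_edge (boundary_walk c d) k = walk_edge (boundary_walk c d) k'"
    then have "ends (dart c d (int k)) = ends (dart c d (int k'))"
      using walk_edge_boundary_walk[OF assms] by simp
    then have "dart c d (int k) = dart c d (int k')" using ends_eq_iff assms by simp
    then have "int k mod int (len c d) = int k' mod int (len c d)"
      unfolding dart_eq_iff by (simp flip: mod_eq_dvd_iff)
    then show "k = k'" using k by (simp flip: of_nat_mod)
  qed
qed

text \<open>The gluing map \<open>disc c d\<close> itself is the required map of the closed disc:
  \<open>turn\<close> sends the real interval from \<open>k\<close> to \<open>k + 1\<close> onto the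
  \<open>k\<close>-th arc of the circle at constant speed.\<close>

lemma face_boundary_boundary_walk:
  assumes d: "d \<in> D"
  shows "face_boundary \<Gamma> S emb (face c d) (boundary_walk c d)"
  unfolding face_boundary_def
proof (intro conjI exI[of _ "disc c d"] allI impI ballI)
  show "circuit \<Gamma> (boundary_walk c d)" using d by (rule circuit_boundary_walk)
  show "continuous_map (top_of_set (cball 0 1)) S (disc c d)" using d by (rule continuous_map_disc)
  show "homeomorphic_map (top_of_set (ball 0 1)) (subtopology S (face c d)) (disc c d)"
    unfolding face_def by (rule parametrization_homeomorphic_map[OF parametrization_disc[OF d]])
  fix k and t :: real assume k: "k < length (boundary_walk c d)" and t: "t \<in> {0..1}"
  let ?e = "dart c d (int k)"
  have e: "?e \<in> D" using d by simp
  have "cis (2 * pi * (real k + t) / real (length (boundary_walk c d))) = turn (len c d) (of_real t + of_int (int k))"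
    by (simp add: turn_def cis_conv_exp algebra_simps)
  then have "disc c d (cis (2 * pi * (real k + t) / real (length (boundary_walk c d)))) = lam c ?e (of_real t)"
    by (simp only: disc_turn lam_add_of_int)
  also have "\<dots> = emb (edge_point (fst ?e) (snd ?e) t)"
    using emb_edge_point[OF e] t by simp
  finally show "disc c d (cis (2 * pi * (real k + t) / real (length (boundary_walk c d)))) =
      emb (edge_point (boundary_walk c d ! k) (next_vertex (boundary_walk c d) k) t)"
    using k d by (simp add: nth_boundary_walk next_vertex_boundary_walk)
qed

text \<open>The walk \<open>w\<close> and its attaching map are arbitrary, as in the definition of
  face length. Since the frontier depends on the face alone, it restricts every possible boundary
  circuit.\<close>

lemma frontier_of_face:
  assumes d: "d \<in> D" and fb: "face_boundary \<Gamma> S emb (face c d) w"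
  shows "S frontier_of face c d = emb ` (\<Union>e\<in>walk_edges w. edge_segment \<Gamma> e)"
proof -
  obtain h where h: "continuous_map (top_of_set (cball 0 1)) S h"
      "homeomorphic_map (top_of_set (ball 0 1)) (subtopology S (face c d)) h"
      "\<And>k t. k < length w \<Longrightarrow> t \<in> {0..1} \<Longrightarrow>
         h (cis (2 * pi * (real k + t) / real (length w))) = emb (edge_point (w ! k) (next_vertex w k) t)"
    using fb unfolding face_boundary_def by blast
  have w: "w \<noteq> []" "walk_edges w \<subseteq> snd \<Gamma>" using fb by (auto simp: face_boundary_def circuit_def)
  have "face c d \<subseteq> topspace S" using openin_face[OF d] openin_subset by blast
  then have im: "h ` ball 0 1 = face c d"
    using homeomorphic_imp_surjective_map[OF h(2)] by (simp add: Int_absorb1)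
  have seg: "edge_segment \<Gamma> (walk_edge w k) = edge_point (w ! k) (next_vertex w k) ` {0..1}" if "k < length w" for k
  proof -
    have "walk_edge w k \<in> snd \<Gamma>" using w(2) that by (auto simp: walk_edges_def)
    then have "{w ! k, next_vertex w k} \<in> snd \<Gamma>" "w ! k \<noteq> next_vertex w k"
      by (auto simp: walk_edge_def complete_graph_def card_2_iff)
    then show ?thesis unfolding walk_edge_def by (rule edge_segment_eq)
  qed
  have circle: "h ` sphere 0 1 = emb ` (\<Union>e\<in>walk_edges w. edge_segment \<Gamma> e)"
  proof
    show "h ` sphere 0 1 \<subseteq> emb ` (\<Union>e\<in>walk_edges w. edge_segment \<Gamma> e)"
    proof
      fix p assume "p \<in> h ` sphere 0 1"
      then obtain z where z: "norm z = 1" "p = h z" by auto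
      obtain k t where k: "k < length w" "0 \<le> t" "t \<le> 1" "z = cis (2 * pi * (real k + t) / real (length w))"
        using cis_sector[of "length w" z] z(1) w(1) by auto
      then have "p = emb (edge_point (w ! k) (next_vertex w k) t)" using h(3) z by simp
      moreover have "edge_point (w ! k) (next_vertex w k) t \<in> edge_segment \<Gamma> (walk_edge w k)"
        using seg k by auto
      ultimately show "p \<in> emb ` (\<Union>e\<in>walk_edges w. edge_segment \<Gamma> e)"
        using k(1) unfolding walk_edges_def by blast
    qed
    show "emb ` (\<Union>e\<in>walk_edges w. edge_segment \<Gamma> e) \<subseteq> h ` sphere 0 1"
    proof
      fix p assume "p \<in> emb ` (\<Union>e\<in>walk_edges w. edge_segment \<Gamma> e)"
      then obtain k t where k: "k < length w" "t \<in> {0..1}" "p = emb (edge_point (w ! k) (next_vertex w k) t)"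
        using seg by (auto simp: walk_edges_def)
      then have "p = h (cis (2 * pi * (real k + t) / real (length w)))" using h(3) by simp
      then show "p \<in> h ` sphere 0 1" by auto
    qed
  qed
  have "S frontier_of face c d = h ` cball 0 1 - face c d"
    by (rule frontier_of_open_disc[OF Hausdorff_S h(1) im openin_face[OF d]])
  also have "\<dots> = h ` sphere 0 1"
  proof -
    have "h ` cball 0 1 = face c d \<union> h ` sphere 0 1"
    proof -
      have "cball 0 1 = ball 0 1 \<union> sphere (0::complex) 1" by auto
      then show ?thesis unfolding im[symmetric] by (simp only: image_Un)
    qed
    moreover have "h ` sphere 0 1 \<inter> face c d = {}"
    proof -
      have "h ` sphere 0 1 \<subseteq> emb ` topspace (graph_space \<Gamma>)"
        unfolding circle by (auto simp: edge_segment_def)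
      moreover have "face c d \<subseteq> topspace S - emb ` topspace (graph_space \<Gamma>)"
        unfolding complement_emb using d by blast
      ultimately show ?thesis by blast
    qed
    ultimately show ?thesis by blast
  qed
  finally show ?thesis unfolding circle .
qed

text \<open>The midpoint of an edge has nonzero weight at both ends and therefore lies on no other
  edge.\<close>

lemma segment_in_segments_iff:
  assumes e: "e \<in> snd \<Gamma>" and A: "A \<subseteq> snd \<Gamma>"
  shows "emb ` edge_segment \<Gamma> e \<subseteq> emb ` (\<Union>a\<in>A. edge_segment \<Gamma> a) \<longleftrightarrow> e \<in> A"
proof
  assume sub: "emb ` edge_segment \<Gamma> e \<subseteq> emb ` (\<Union>a\<in>A. edge_segment \<Gamma> a)"
  obtain d where d: "d \<in> D" "e = ends d" using e edges_eq by auto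
  let ?y = "edge_point (fst d) (snd d) (1 / 2)"
  have y: "?y \<in> edge_segment \<Gamma> e" using d edge_segment_ends by auto
  then have "emb ?y \<in> emb ` (\<Union>a\<in>A. edge_segment \<Gamma> a)" using sub by blast
  then obtain a z where a: "a \<in> A" "z \<in> edge_segment \<Gamma> a" "emb ?y = emb z" by auto
  then have "?y = z" using y inj_emb by (auto simp: edge_segment_def dest: inj_onD)
  obtain d' where d': "d' \<in> D" "a = ends d'" using A a(1) edges_eq by auto
  have "i \<in> ends d'" if "?y i \<noteq> 0" for i
    using a(2) that \<open>?y = z\<close> d'(2) by (auto simp: edge_segment_def)
  moreover have "?y (fst d) \<noteq> 0" "?y (snd d) \<noteq> 0"
    using fst_neq_snd[OF d(1)] by (simp_all add: edge_point_def)
  ultimately have "fst d \<in> ends d'" "snd d \<in> ends d'" by blast+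
  then have "ends d = ends d'" using fst_neq_snd[OF d(1)] by auto
  then show "e \<in> A" using a(1) d d' by simp
qed blast

lemma segments_eq_iff:
  assumes "A \<subseteq> snd \<Gamma>" "B \<subseteq> snd \<Gamma>"
    and eq: "emb ` (\<Union>a\<in>A. edge_segment \<Gamma> a) = emb ` (\<Union>a\<in>B. edge_segment \<Gamma> a)"
  shows "A = B"
proof -
  have "e \<in> A \<longleftrightarrow> e \<in> B" if "e \<in> snd \<Gamma>" for e
    using segment_in_segments_iff[OF that assms(1)] segment_in_segments_iff[OF that assms(2)] eq by simp
  then show ?thesis using assms by blast
qed

text \<open>The frontier determines the set of edges, and a circuit repeats no edge, so its length
  is the number of edges in that set.\<close>

lemma has_face_length_face:
  assumes d: "d \<in> D" and l: "has_face_length \<Gamma> S emb (face c d) l"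
  shows "l = len c d"
proof -
  obtain w where w: "face_boundary \<Gamma> S emb (face c d) w" "l = length w"
    using l by (auto simp: has_face_length_def)
  have c: "circuit \<Gamma> w" using w(1) by (simp add: face_boundary_def)
  have "walk_edges w = walk_edges (boundary_walk c d)"
  proof (rule segments_eq_iff)
    show "emb ` (\<Union>a\<in>walk_edges w. edge_segment \<Gamma> a) = emb ` (\<Union>a\<in>walk_edges (boundary_walk c d). edge_segment \<Gamma> a)"
      using frontier_of_face[OF d w(1)] frontier_of_face[OF d face_boundary_boundary_walk[OF d]] by simp
  qed (use c circuit_boundary_walk[OF d] in \<open>auto simp: circuit_def\<close>)
  moreover have "card (walk_edges u) = length u" if "circuit \<Gamma> u" for u
    using that by (simp add: walk_edges_def circuit_def card_image)
  ultimately show ?thesis using c circuit_boundary_walk[OF d, of c] w(2) by (metis length_boundary_walk)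
qed

section \<open>The two circuit decompositions\<close>

lemma face_eq_iff:
  assumes "d \<in> D" "d' \<in> D"
  shows "face c d = face c d' \<longleftrightarrow> (\<exists>j. d' = dart c d j)"
proof
  assume "face c d = face c d'"
  then have "face c d \<inter> face c d' \<noteq> {}" using face_nonempty[of c d] by simp
  then show "\<exists>j. d' = dart c d j" using faces_meet by blast
next
  assume "\<exists>j. d' = dart c d j"
  then show "face c d = face c d'" using face_eqI by metis
qed

lemma face_eq_iff_edges:
  assumes "d \<in> D" "d' \<in> D"
  shows "face c d = face c d' \<longleftrightarrow> ends d' \<in> walk_edges (boundary_walk c d)"
proof -
  have "(\<exists>j. d' = dart c d j) \<longleftrightarrow> (\<exists>e. ends d' = ends e \<and> (\<exists>j. e = dart c d j))"
    using ends_eq_iff[OF assms(2)] assms(1) by (metis dart_in_D)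
  then show ?thesis unfolding face_eq_iff[OF assms] walk_edges_boundary_walk[OF assms(1)] by simp
qed

lemma unique_face_at_edge:
  assumes "e \<in> snd \<Gamma>"
  shows "\<exists>!F. F \<in> face c ` D \<and> emb ` edge_segment \<Gamma> e \<subseteq> S frontier_of F"
proof -
  obtain d where d: "d \<in> D" "e = ends d" using assms edges_eq by auto
  have iff: "emb ` edge_segment \<Gamma> e \<subseteq> S frontier_of face c d' \<longleftrightarrow> face c d' = face c d" if "d' \<in> D" for d'
  proof -
    have "walk_edges (boundary_walk c d') \<subseteq> snd \<Gamma>"
      using circuit_boundary_walk[OF that] by (simp add: circuit_def)
    then show ?thesis
      unfolding frontier_of_face[OF that face_boundary_boundary_walk[OF that]]
      using segment_in_segments_iff[OF assms] face_eq_iff_edges[OF that d(1)] d(2) by simp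
  qed
  show ?thesis
  proof (rule ex1I[of _ "face c d"])
    show "face c d \<in> face c ` D \<and> emb ` edge_segment \<Gamma> e \<subseteq> S frontier_of face c d" using d(1) iff by blast
  qed (use iff in auto)
qed

text \<open>Different starting arcs give rotated lists with the same edges. One of them is chosen
  for each face, since a circuit decomposition may list a circuit only once.\<close>

definition face_walk :: "bool \<Rightarrow> (nat \<Rightarrow> real) set \<Rightarrow> nat list" where
  "face_walk c F = boundary_walk c (SOME d. d \<in> D \<and> F = face c d)"

lemma face_walk:
  assumes "F \<in> face c ` D"
  obtains d where "d \<in> D" "F = face c d" "face_walk c F = boundary_walk c d"
proof -
  have "\<exists>d. d \<in> D \<and> F = face c d" using assms by blast
  then have "(SOME d. d \<in> D \<and> F = face c d) \<in> D \<and> F = face c (SOME d. d \<in> D \<and> F = face c d)"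
    by (rule someI_ex)
  then show ?thesis using that unfolding face_walk_def by blast
qed

lemma ends_in_face_walk:
  assumes "F \<in> face c ` D" "d \<in> D"
  shows "ends d \<in> walk_edges (face_walk c F) \<longleftrightarrow> F = face c d"
  using face_walk[OF assms(1)] face_eq_iff_edges[OF _ assms(2)] by metis

lemma circuit_face_walk: "F \<in> face c ` D \<Longrightarrow> circuit \<Gamma> (face_walk c F)"
  using face_walk circuit_boundary_walk by metis

lemma inj_on_walk_edges_face_walk: "inj_on (\<lambda>F. walk_edges (face_walk c F)) (face c ` D)"
proof (rule inj_onI)
  fix F F' assume F: "F \<in> face c ` D" "F' \<in> face c ` D" and eq: "walk_edges (face_walk c F) = walk_edges (face_walk c F')"
  obtain d where "d \<in> D" "F = face c d" using F(1) by blast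
  then show "F = F'" using ends_in_face_walk[OF F(1)] ends_in_face_walk[OF F(2)] eq by blast
qed

lemma circuit_decomposition_face_walks: "circuit_decomposition \<Gamma> (face_walk c ` face c ` D)"
  unfolding circuit_decomposition_def
proof (intro conjI ballI)
  show "circuit \<Gamma> w" if "w \<in> face_walk c ` face c ` D" for w
    using that by (rule imageE) (simp add: circuit_face_walk)
  show "inj_on walk_edges (face_walk c ` face c ` D)"
    by (rule inj_on_imageI) (use inj_on_walk_edges_face_walk[of c] in \<open>simp add: o_def\<close>)
  have in_E: "walk_edges (face_walk c F) \<subseteq> snd \<Gamma>" if "F \<in> face c ` D" for F
    using circuit_face_walk[OF that] by (simp add: circuit_def)
  have imp: "F = face c d" if "F \<in> face c ` D" "d \<in> D" "ends d \<in> walk_edges (face_walk c F)" for F d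
    using ends_in_face_walk[OF that(1,2)] that(3) by simp
  have walk: "ends d \<in> walk_edges (face_walk c (face c d))" "face c d \<in> face c ` D" if "d \<in> D" for d
    using ends_in_face_walk[of "face c d" c d] that by simp_all
  show "partition_on (snd \<Gamma>) (walk_edges ` face_walk c ` face c ` D)"
    unfolding image_image
  proof (rule partition_onI)
    show "\<Union> ((\<lambda>d. walk_edges (face_walk c (face c d))) ` D) = snd \<Gamma>"
    proof
      show "\<Union> ((\<lambda>d. walk_edges (face_walk c (face c d))) ` D) \<subseteq> snd \<Gamma>"
        using in_E walk(2) by (intro UN_least) simp
      show "snd \<Gamma> \<subseteq> \<Union> ((\<lambda>d. walk_edges (face_walk c (face c d))) ` D)"
        unfolding edges_eq using walk(1) by (intro image_subsetI UN_I)
    qed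
    show "{} \<notin> (\<lambda>d. walk_edges (face_walk c (face c d))) ` D"
    proof
      assume "{} \<in> (\<lambda>d. walk_edges (face_walk c (face c d))) ` D"
      then obtain d where "d \<in> D" "{} = walk_edges (face_walk c (face c d))" by (elim imageE)
      then show False using walk(1)[of d] by auto
    qed
    fix A A' assume "A \<in> (\<lambda>d. walk_edges (face_walk c (face c d))) ` D"
      and "A' \<in> (\<lambda>d. walk_edges (face_walk c (face c d))) ` D" and neq: "A \<noteq> A'"
    then obtain d where d: "d \<in> D" "A = walk_edges (face_walk c (face c d))" by (elim imageE)
    obtain d' where d': "d' \<in> D" "A' = walk_edges (face_walk c (face c d'))" 
      using \<open>A' \<in> _\<close> by (elim imageE)
    show "disjnt A A'"
    proof (rule ccontr)
      assume "\<not> disjnt A A'"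
      then obtain e where e: "e \<in> A" "e \<in> A'" by (auto simp: disjnt_def)
      have "e \<in> snd \<Gamma>" using e(1) d(2) in_E[OF walk(2)[OF d(1)]] by (simp add: subset_iff)
      then obtain a where a: "a \<in> D" "e = ends a" using edges_eq by auto
      have "face c d = face c a" "face c d' = face c a"
        using imp[OF walk(2)[OF d(1)] a(1)] imp[OF walk(2)[OF d'(1)] a(1)] e d(2) d'(2) a(2) by simp_all
      then show False using neq d(2) d'(2) by simp
    qed
  qed
qed

lemma face_boundary_face_walk: "F \<in> face c ` D \<Longrightarrow> face_boundary \<Gamma> S emb F (face_walk c F)"
  using face_walk face_boundary_boundary_walk by metis

lemma bij_betw_face_walk: "bij_betw (face_walk c) (face c ` D) (face_walk c ` face c ` D)"
proof (rule bij_betw_imageI)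
  have "inj_on (walk_edges \<circ> face_walk c) (face c ` D)"
    using inj_on_walk_edges_face_walk[of c] by (simp add: o_def)
  then show "inj_on (face_walk c) (face c ` D)" by (rule inj_on_imageI2)
qed simp

lemma biembedding_emb: "biembedding \<Gamma> S emb"
proof -
  define black where "black F \<longleftrightarrow> F \<in> face True ` D" for F
  have disj: "face False d \<noteq> face True d'" for d d'
    using faces_meet[of False d True d'] face_nonempty[of False d] by auto
  have B: "{F \<in> faces \<Gamma> S emb. black F} = face True ` D"
    unfolding faces_emb black_def by auto
  have W: "{F \<in> faces \<Gamma> S emb. \<not> black F} = face False ` D"
  proof
    show "{F \<in> faces \<Gamma> S emb. \<not> black F} \<subseteq> face False ` D"
    proof
      fix F assume "F \<in> {F \<in> faces \<Gamma> S emb. \<not> black F}"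
      then obtain c d where "d \<in> D" "F = face c d" "\<not> black F" unfolding faces_emb by auto
      then show "F \<in> face False ` D" by (cases c) (auto simp: black_def)
    qed
    show "face False ` D \<subseteq> {F \<in> faces \<Gamma> S emb. \<not> black F}"
      unfolding faces_emb black_def using disj by auto
  qed
  show ?thesis
    unfolding biembedding_def
  proof (intro conjI graph_embedding_emb exI[of _ black], unfold Let_def B W, intro conjI ballI)
    show "\<exists>\<D> \<D>'. circuit_decomposition \<Gamma> \<D> \<and> circuit_decomposition \<Gamma> \<D>' \<and>
        (\<exists>b. bij_betw b (face True ` D) \<D> \<and> (\<forall>F\<in>face True ` D. face_boundary \<Gamma> S emb F (b F))) \<and>
        (\<exists>b'. bij_betw b' (face False ` D) \<D>' \<and> (\<forall>F\<in>face False ` D. face_boundary \<Gamma> S emb F (b' F)))"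
      by (intro exI[of _ "face_walk True ` face True ` D"] exI[of _ "face_walk False ` face False ` D"]
          exI[of _ "face_walk True"] exI[of _ "face_walk False"] conjI ballI
          circuit_decomposition_face_walks bij_betw_face_walk face_boundary_face_walk)
  qed (rule unique_face_at_edge; assumption)+
qed

end

section \<open>The rotational tournament\<close>

text \<open>Says that \<open>y - x\<close> is congruent to one of \<open>1, ..., M\<close> modulo
  \<open>2 * M + 1\<close>, with the wrap-around written out so that natural-number subtraction is
  safe.\<close>

definition arcs :: "nat \<Rightarrow> (nat \<times> nat) set" where
  "arcs M = {(x, y). x < 2 * M + 1 \<and> y < 2 * M + 1 \<and> (x < y \<and> y - x \<le> M \<or> y < x \<and> y + (2 * M + 1) - x \<le> M)}"

definition step :: "nat \<Rightarrow> nat \<Rightarrow> nat \<Rightarrow> nat \<times> nat" where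
  "step M x i = (x, (x + i + 1) mod (2 * M + 1))"

text \<open>Recovers the parameter \<open>i\<close> of \<open>step M x i\<close>. In the wrapped
  case it is \<open>y + (2 * M + 1) - x - 1\<close>, simplified.\<close>

definition gap :: "nat \<Rightarrow> nat \<times> nat \<Rightarrow> nat" where
  "gap M d = (if fst d < snd d then snd d - fst d - 1 else snd d + 2 * M - fst d)"

definition shift :: "nat \<Rightarrow> nat \<Rightarrow> nat \<times> nat \<Rightarrow> nat \<times> nat" where
  "shift M s d = (if d \<in> arcs M then step M (snd d) ((gap M d + s) mod M) else d)"

lemma fst_step [simp]: "fst (step M x i) = x"
  by (simp add: step_def)

lemma snd_step_less [simp]: "snd (step M x i) < Suc (2 * M)"
  by (simp add: step_def)

lemma snd_step:
  assumes "x < 2 * M + 1" "i < M"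
  shows "snd (step M x i) = (if x + i + 1 < 2 * M + 1 then x + i + 1 else x + i + 1 - (2 * M + 1))"
proof (cases "x + i + 1 < 2 * M + 1")
  case False
  then show ?thesis using assms mod_if[of "x + i + 1" "2 * M + 1"] by (simp add: step_def)
qed (simp add: step_def)

lemma step_in_arcs:
  assumes "x < 2 * M + 1" "i < M"
  shows "step M x i \<in> arcs M"
proof -
  have "step M x i = (x, snd (step M x i))" by (simp add: step_def)
  then show ?thesis using snd_step[OF assms] assms by (auto simp: arcs_def)
qed

lemma gap_step:
  assumes "x < 2 * M + 1" "i < M"
  shows "gap M (step M x i) = i"
  using snd_step[OF assms] assms by (auto simp: gap_def)

lemma arcs_cases:
  assumes "d \<in> arcs M"
  obtains x i where "x < 2 * M + 1" "i < M" "d = step M x i"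
proof -
  obtain x y where d: "d = (x, y)" by (cases d)
  have xy: "x < 2 * M + 1" "y < 2 * M + 1" "x < y \<and> y - x \<le> M \<or> y < x \<and> y + (2 * M + 1) - x \<le> M"
    using assms by (auto simp: d arcs_def)
  have g: "gap M d < M" using xy by (auto simp: gap_def d)
  moreover have "snd (step M x (gap M d)) = y"
    unfolding snd_step[OF xy(1) g] using xy by (auto simp: gap_def d)
  then have "d = step M x (gap M d)" by (simp add: d prod_eq_iff)
  ultimately show ?thesis using that xy(1) by blast
qed

lemma step_eq_iff:
  assumes "x < 2 * M + 1" "i < M" "x' < 2 * M + 1" "i' < M"
  shows "step M x i = step M x' i' \<longleftrightarrow> x = x' \<and> i = i'"
  using gap_step[OF assms(1,2)] gap_step[OF assms(3,4)] by (metis fst_step)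

lemma shift_step:
  assumes "x < 2 * M + 1" "i < M"
  shows "shift M s (step M x i) = step M (snd (step M x i)) ((i + s) mod M)"
  using step_in_arcs[OF assms] gap_step[OF assms] by (simp add: shift_def)

lemma snd_step_inject:
  assumes "x < 2 * M + 1" "x' < 2 * M + 1" "i < M" "snd (step M x i) = snd (step M x' i)"
  shows "x = x'"
  using assms snd_step[OF assms(1,3)] snd_step[OF assms(2,3)] by (auto split: if_splits)

lemma add_mod_inject:
  fixes i :: nat
  assumes "i < M" "i' < M" "(i + s) mod M = (i' + s) mod M"
  shows "i = i'"
proof -
  have "int (i + s) mod int M = int (i' + s) mod int M"
    using assms(3) by (metis of_nat_mod)
  then have "int M dvd int i - int i'" by (simp add: mod_eq_dvd_iff)
  then have "int i mod int M = int i' mod int M" by (simp only: mod_eq_dvd_iff)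
  then show ?thesis using assms(1,2) by simp
qed

lemma finite_arcs: "finite (arcs M)"
proof (rule finite_subset)
  show "arcs M \<subseteq> {..<2 * M + 1} \<times> {..<2 * M + 1}" by (auto simp: arcs_def)
qed simp

text \<open>The image arc starts where \<open>d\<close> ends and its parameter is a translate modulo
  \<open>M\<close>. Thus the end and the parameter of \<open>d\<close>, and with them its start, can
  be recovered.\<close>

lemma shift_permutes: "shift M s permutes arcs M"
proof (rule bij_imp_permutes)
  have "inj_on (shift M s) (arcs M)"
  proof (rule inj_onI)
    fix d d' assume "d \<in> arcs M" "d' \<in> arcs M" and eq: "shift M s d = shift M s d'"
    then obtain x i x' i' where d: "x < 2 * M + 1" "i < M" "d = step M x i"
      and d': "x' < 2 * M + 1" "i' < M" "d' = step M x' i'"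
      by (metis arcs_cases)
    have "step M (snd d) ((i + s) mod M) = step M (snd d') ((i' + s) mod M)"
      using eq shift_step[OF d(1,2)] shift_step[OF d'(1,2)] d(3) d'(3) by simp
    then have "snd d = snd d'" "(i + s) mod M = (i' + s) mod M"
      using step_eq_iff[of "snd d" M "(i + s) mod M" "snd d'" "(i' + s) mod M"] d d' by auto
    then have "i = i'" using add_mod_inject d d' by blast
    then show "d = d'" using snd_step_inject d d' \<open>snd d = snd d'\<close> by metis
  qed
  moreover have "shift M s ` arcs M \<subseteq> arcs M"
  proof
    fix e assume "e \<in> shift M s ` arcs M"
    then obtain d where "d \<in> arcs M" "e = shift M s d" by blast
    then obtain x i where d: "x < 2 * M + 1" "i < M" "e = shift M s (step M x i)"
      by (metis arcs_cases)
    then show "e \<in> arcs M" using shift_step[OF d(1,2)] by (simp add: step_in_arcs)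
  qed
  ultimately show "bij_betw (shift M s) (arcs M) (arcs M)"
    using finite_arcs by (simp add: bij_betw_def endo_inj_surj)
  show "d \<notin> arcs M \<Longrightarrow> shift M s d = d" for d by (simp add: shift_def)
qed

text \<open>The parameter advances by \<open>s\<close> at each step whatever vertices are visited,
  so the starting vertex \<open>y\<close> of the resulting arc can be left unspecified.\<close>

lemma shift_funpow:
  assumes "x < 2 * M + 1" "i < M"
  shows "\<exists>y < 2 * M + 1. (shift M s ^^ l) (step M x i) = step M y ((i + l * s) mod M)"
proof (induction l)
  case (Suc l)
  then obtain y where y: "y < 2 * M + 1" "(shift M s ^^ l) (step M x i) = step M y ((i + l * s) mod M)" by blast
  let ?i = "(i + l * s) mod M"
  have i: "?i < M" using assms by simp
  have "(shift M s ^^ Suc l) (step M x i) = step M (snd (step M y ?i)) ((?i + s) mod M)"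
    using shift_step[OF y(1) i] y(2) by simp
  also have "(?i + s) mod M = (i + l * s + s) mod M" by (rule mod_add_left_eq)
  also have "i + l * s + s = i + Suc l * s" by simp
  finally show ?case using snd_step_less by (metis Suc_eq_plus1)
qed (use assms in auto)

text \<open>When a face closes up, the parameter has returned to its initial value, so its total
  advance is 0 modulo \<open>M\<close>.\<close>

lemma dvd_if_shift_funpow_fixed:
  assumes d: "d \<in> arcs M" and fixed: "(shift M s ^^ l) d = d"
  shows "M dvd l * s"
proof -
  obtain x i where x: "x < 2 * M + 1" "i < M" "d = step M x i" using d by (rule arcs_cases)
  obtain y where y: "y < 2 * M + 1" "(shift M s ^^ l) d = step M y ((i + l * s) mod M)"
    using shift_funpow[OF x(1,2)] x(3) by blast
  have "(i + l * s) mod M < M" using x(2) by simp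
  then have "(i + l * s) mod M = i"
    using y fixed x step_eq_iff[OF y(1) _ x(1,2)] by metis
  then have "int (i + l * s) mod int M = int i mod int M"
    using x(2) by (metis mod_less of_nat_mod)
  then have "int M dvd int (l * s)" by (simp add: mod_eq_dvd_iff)
  then show ?thesis by (simp only: int_dvd_int_iff)
qed

lemma rotation_system_shift:
  assumes M: "0 < M"
  shows "rotation_system (2 * M + 1) M (arcs M) (\<lambda>c. shift M (if c then s else s + 1)) (step M)"
proof
  show "arcs M \<subseteq> {..<2 * M + 1} \<times> {..<2 * M + 1}" by (auto simp: arcs_def)
  show "(x, y) \<in> arcs M \<longleftrightarrow> (y, x) \<notin> arcs M" if "x < 2 * M + 1" "y < 2 * M + 1" "x \<noteq> y" for x y
    using that by (auto simp: arcs_def)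
  show "(x, x) \<notin> arcs M" for x by (simp add: arcs_def)
  show "shift M (if c then s else s + 1) permutes arcs M" for c by (rule shift_permutes)
  show "fst (shift M (if c then s else s + 1) d) = snd d" if "d \<in> arcs M" for c d
    using that by (simp add: shift_def)
  show "bij_betw (step M x) {..<M} {d \<in> arcs M. fst d = x}" if x: "x < 2 * M + 1" for x
  proof (rule bij_betw_imageI)
    show "inj_on (step M x) {..<M}" using step_eq_iff[OF x _ x] by (auto simp: inj_on_def)
    show "step M x ` {..<M} = {d \<in> arcs M. fst d = x}"
      using step_in_arcs[OF x] by (auto elim!: arcs_cases)
  qed
  show "inv (shift M (if False then s else s + 1)) (step M x (Suc k mod M)) = inv (shift M (if True then s else s + 1)) (step M x k)"
    if x: "x < 2 * M + 1" "k < M" for x k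
  proof -
    \<comment> \<open>Let \<open>e\<close> be the arc into \<open>x\<close> that the black rule
      continues by parameter \<open>k\<close>. The white shift is larger by 1 and continues the same
      \<open>e\<close> by \<open>k + 1\<close>, so both inverses give \<open>e\<close>.\<close>
    have "step M x k \<in> shift M s ` arcs M"
      using step_in_arcs[OF x] permutes_image[OF shift_permutes] by blast
    then obtain e where e: "e \<in> arcs M" "shift M s e = step M x k" by auto
    obtain y i where y: "y < 2 * M + 1" "i < M" "e = step M y i" using e(1) by (rule arcs_cases)
    have "step M (snd e) ((i + s) mod M) = step M x k"
      using e(2) shift_step[OF y(1,2)] y(3) by simp
    then have xk: "snd e = x" "(i + s) mod M = k"
      using step_eq_iff[of "snd e" M "(i + s) mod M" x k] x y by auto
    have "shift M (s + 1) e = step M (snd e) ((i + (s + 1)) mod M)"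
      using shift_step[OF y(1,2)] y(3) by simp
    also have "(i + (s + 1)) mod M = Suc k mod M"
      using xk(2) by (simp flip: xk(2) add: mod_Suc_eq)
    finally have e': "shift M (s + 1) e = step M x (Suc k mod M)" using xk(1) by simp
    have inv: "inv (shift M t) (shift M t e) = e" for t
      using permutes_inj[OF shift_permutes] by simp
    show ?thesis using inv[of s] inv[of "s + 1"] e(2) e' by simp
  qed
qed (use M in auto)

theorem theorem6p7:
  fixes m n :: nat
  assumes "m > 0" and "n > 0" and "\<not> (odd m \<and> odd n)"
  shows "\<exists>(S :: surface_space) \<psi>.
           surface S \<and> orientable S \<and>
           biembedding (complete_graph (2 * m * n + 1)) S \<psi> \<and>
           (\<forall>F \<in> faces (complete_graph (2 * m * n + 1)) S \<psi>. \<forall>l.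
              has_face_length (complete_graph (2 * m * n + 1)) S \<psi> F l \<longrightarrow> m dvd l \<or> n dvd l)"
proof -
  let ?M = "m * n"
  interpret rotation_system "2 * ?M + 1" ?M "arcs ?M" "\<lambda>c. shift ?M (if c then n else n + 1)" "step ?M"
    using assms by (intro rotation_system_shift) simp
  have v: "2 * m * n + 1 = 2 * ?M + 1" by simp
  have dvd: "?M dvd len c d * (if c then n else n + 1)" if "d \<in> arcs ?M" for c d
  proof (rule dvd_if_shift_funpow_fixed[OF that])
    have "dart c d (int (len c d)) = d" by (simp add: dart_eq_self_iff)
    then show "(shift ?M (if c then n else n + 1) ^^ len c d) d = d" by (simp only: dart_of_nat)
  qed
  have "m dvd len c d \<or> n dvd len c d" if "d \<in> arcs ?M" for c d
  proof (cases c)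
    case True
    then show ?thesis using dvd[OF that, of c] assms by simp
  next
    case False
    then have "?M dvd len c d * (n + 1)" using dvd[OF that, of c] by (simp only: if_False)
    then have "n dvd len c d * (n + 1)" by (rule dvd_mult_right)
    \<comment> \<open>Only the factor \<open>n\<close> of \<open>m * n\<close> is used for white
      faces; coprimality moves it from the product to the length.\<close>
    moreover have "coprime n (n + 1)" by simp
    ultimately show ?thesis using coprime_dvd_mult_left_iff by blast
  qed
  \<comment> \<open>Whatever boundary circuit witnesses the length \<open>l\<close>, it has as many
    edges as the cycle of arcs of the face.\<close>
  then have "m dvd l \<or> n dvd l"
    if "F \<in> faces \<Gamma> S emb" "has_face_length \<Gamma> S emb F l" for F l
    using that has_face_length_face unfolding faces_emb by fastforce
  then show ?thesis
    unfolding v using surface_S orientable_S biembedding_emb by blast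
qed

end
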